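(* Let $d\ge1$ and let $p$ be an integer. For every partition $\lambda$ of $d$, $$\frac1{d!}\sum_{\mu\in\mathbf P(d)}S_p(\mu)\,z_\mu\,\chi^\lambda(\mu)^2\;=\;T_p(\lambda).$$
   Context: $\mathbf P(d)$ is the set of partitions of $d$. For $\mu=(\mu_1,\dots,\mu_k)$ with positive parts, $S_p(\mu)=\sum_{j=1}^k\mu_j^p$. $z_\mu$ denotes the number of elements of the conjugacy class of $S_d$ with cycle type $\mu$ (the size of the class, not of the centralizer), and $\chi^\lambda(\mu)$ is the value on this class of the irreducible character of $S_d$ associated with $\lambda$. $T_p(\lambda)=\sum_{\xi\in Y_\lambda}h(\xi)^{p-1}$, where $Y_\lambda$ is the Young diagram of $\lambda$ and $h(\xi)$ is the hook-length of the cell $\xi$. *)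

theory Defs
  imports Complex_Main "HOL-Library.Function_Algebras" "HOL-Combinatorics.Orbits"
begin

subsection \<open>Partitions, hook lengths, power sums\<close>

definition partitions_of :: "nat \<Rightarrow> nat list set" where
  "partitions_of d = {mu. sorted_wrt (\<ge>) mu \<and> (\<forall>x\<in>set mu. 0 < x) \<and> sum_list mu = d}"

text \<open>Cells are pairs (row, column), both counted from 0.\<close>

definition young_diagram :: "nat list \<Rightarrow> (nat \<times> nat) set" where
  "young_diagram lam = {(i, j). i < length lam \<and> j < lam ! i}"

text \<open>The hook of a cell contains the cell itself.\<close>

definition hook :: "nat list \<Rightarrow> nat \<times> nat \<Rightarrow> (nat \<times> nat) set" where
  "hook lam = (\<lambda>(i, j). {(i', j') \<in> young_diagram lam. i' = i \<and> j \<le> j' \<or> i \<le> i' \<and> j' = j})"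

definition hook_length :: "nat list \<Rightarrow> nat \<times> nat \<Rightarrow> nat" where
  "hook_length lam c = card (hook lam c)"

text \<open>The quantities \<open>S\<^sub>p(mu)\<close> and \<open>T\<^sub>p(lam)\<close>, for any integer \<open>p\<close>; parts and hook lengths are positive.\<close>

definition part_power_sum :: "int \<Rightarrow> nat list \<Rightarrow> complex" where
  "part_power_sum p mu = (\<Sum>x\<leftarrow>mu. of_nat x powi p)"

definition hook_power_sum :: "int \<Rightarrow> nat list \<Rightarrow> complex" where
  "hook_power_sum p lam = (\<Sum>c\<in>young_diagram lam. of_nat (hook_length lam c) powi (p - 1))"

subsection \<open>Conjugacy classes of the symmetric group\<close>

text \<open>The symmetric group \<open>S\<^sub>d\<close> is the set of all permutations of \<open>{..<d}\<close>. The image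
  multiset below ranges over the set of cycles, so every cycle contributes its length once.\<close>

definition cycle_type :: "nat \<Rightarrow> (nat \<Rightarrow> nat) \<Rightarrow> nat list" where
  "cycle_type d g = rev (sorted_list_of_multiset
     (image_mset card (mset_set (orbit g ` {..<d}))))"

definition conj_class :: "nat \<Rightarrow> nat list \<Rightarrow> (nat \<Rightarrow> nat) set" where
  "conj_class d mu = {g. g permutes {..<d} \<and> cycle_type d g = mu}"

definition class_size :: "nat \<Rightarrow> nat list \<Rightarrow> nat" where
  "class_size d mu = card (conj_class d mu)"

subsection \<open>Trace of a linear endomorphism of a subspace\<close>

text \<open>Complex-valued functions as a complex vector space.\<close>

definition fun_scale :: "complex \<Rightarrow> ('a \<Rightarrow> complex) \<Rightarrow> 'a \<Rightarrow> complex" where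
  "fun_scale c f = (\<lambda>x. c * f x)"

global_interpretation cfun: vector_space "fun_scale :: complex \<Rightarrow> ('a \<Rightarrow> complex) \<Rightarrow> 'a \<Rightarrow> complex"
  by standard (simp_all add: fun_scale_def fun_eq_iff algebra_simps)

text \<open>The sum of the diagonal entries of the matrix of \<open>F\<close> on \<open>V\<close> with respect to some basis;
  meaningful for finite-dimensional \<open>V\<close> with \<open>F ` V \<subseteq> V\<close> and \<open>F\<close> linear on \<open>V\<close>.\<close>

definition trace_on :: "('a \<Rightarrow> complex) set \<Rightarrow> (('a \<Rightarrow> complex) \<Rightarrow> 'a \<Rightarrow> complex) \<Rightarrow> complex" where
  "trace_on V F =
     (let B = (SOME B. cfun.independent B \<and> cfun.span B = V)
      in \<Sum>b\<in>B. cfun.representation B (F b) b)"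

subsection \<open>Irreducible characters of the symmetric group\<close>

text \<open>The group algebra of \<open>S\<^sub>d\<close> is identified with the functions
  \<open>(nat \<Rightarrow> nat) \<Rightarrow> complex\<close> vanishing outside \<open>S\<^sub>d\<close>, where \<open>f\<close> stands for the formal sum of
  \<open>f g \<cdot> g\<close>. Then \<open>left_mult g f\<close> is the product \<open>g \<cdot> f\<close>.\<close>

definition left_mult :: "(nat \<Rightarrow> nat) \<Rightarrow> ((nat \<Rightarrow> nat) \<Rightarrow> complex) \<Rightarrow> (nat \<Rightarrow> nat) \<Rightarrow> complex" where
  "left_mult g f = (\<lambda>x. f (inv g \<circ> x))"

text \<open>The standard tableau of shape \<open>lam\<close> filled with \<open>0, 1, 2, \<dots>\<close> row by row.\<close>

definition tableau :: "nat list \<Rightarrow> nat \<times> nat \<Rightarrow> nat" where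
  "tableau lam = (\<lambda>(i, j). sum_list (take i lam) + j)"

definition row_group :: "nat list \<Rightarrow> (nat \<Rightarrow> nat) set" where
  "row_group lam = {g. g permutes {..<sum_list lam} \<and>
     (\<forall>(i, j) \<in> young_diagram lam. \<exists>j'. (i, j') \<in> young_diagram lam \<and>
        g (tableau lam (i, j)) = tableau lam (i, j'))}"

definition column_group :: "nat list \<Rightarrow> (nat \<Rightarrow> nat) set" where
  "column_group lam = {g. g permutes {..<sum_list lam} \<and>
     (\<forall>(i, j) \<in> young_diagram lam. \<exists>i'. (i', j) \<in> young_diagram lam \<and>
        g (tableau lam (i, j)) = tableau lam (i', j))}"

text \<open>The Young symmetrizer: the product in the group algebra of the sum of all elements of the
  row group and the signed sum of all elements of the column group.\<close>

definition young_symmetrizer :: "nat list \<Rightarrow> (nat \<Rightarrow> nat) \<Rightarrow> complex" where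
  "young_symmetrizer lam = (\<lambda>x. \<Sum>g\<in>row_group lam. \<Sum>h\<in>column_group lam.
     if x = g \<circ> h then of_int (sign h) else 0)"

text \<open>The irreducible \<open>S\<^sub>d\<close>-module associated with the partition \<open>lam\<close> of \<open>d\<close> (the Specht module):
  the left ideal of the complex group algebra generated by the Young symmetrizer. With this
  convention the one-row partition gives the trivial module and the one-column partition the
  sign module.\<close>

definition specht_module :: "nat list \<Rightarrow> ((nat \<Rightarrow> nat) \<Rightarrow> complex) set" where
  "specht_module lam =
     cfun.span {left_mult g (young_symmetrizer lam) | g. g permutes {..<sum_list lam}}"

definition irr_char :: "nat list \<Rightarrow> (nat \<Rightarrow> nat) \<Rightarrow> complex" where
  "irr_char lam g = trace_on (specht_module lam) (left_mult g)"

text \<open>The common value of the character on the class of cycle type \<open>mu\<close>.\<close>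

definition chi :: "nat list \<Rightarrow> nat list \<Rightarrow> complex" where
  "chi lam mu = irr_char lam (SOME g. g \<in> conj_class (sum_list lam) mu)"

end

theory Submission
  imports Defs
begin

text \<open>Since the orbit of a point \<open>a\<close> has \<open>card (orbit g a)\<close> elements, \<open>S\<^sub>p\<close> of the cycle type of
  \<open>g\<close> is the sum of \<open>card (orbit g a) powi (p - 1)\<close> over all points. Splitting off the cycle
  through \<open>a\<close>, the Murnaghan--Nakayama rule writes \<open>\<chi>\<^bsup>\<lambda>\<^esup>(g)\<close> as the signed sum of the values at the
  remaining permutation of the characters obtained from \<open>\<lambda>\<close> by removing a rim hook of length
  \<open>r = card (orbit g a)\<close>. Orthonormality turns the sum of the squares into the number of rim
  hooks of length \<open>r\<close>, which is the number of cells with hook length \<open>r\<close>.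

  The rule is immediate from Frobenius's formula. Orthonormality of the Frobenius values follows
  by induction from the rule itself. The character of the Specht module, computed as a trace, has
  norm 1, and so have the Frobenius values; testing against the permutation characters on
  colorings shows that their inner product is 1, hence they agree.\<close>

text \<open>Exponent sequences replace partitions because removing a rim hook becomes subtracting
  \<open>r\<close> from one entry. A subtraction that yields no partition needs no separate
  treatment: a repeated or negative entry makes the value 0, and an unsorted sequence only
  contributes a sign. The number \<open>k\<close> of entries stays fixed while cycles are removed.
  The basis in \<open>trace_on\<close> is an arbitrary choice, so the trace has to be found without
  it. The Young symmetrizer c satisfies c * c = n c with n = \<open>norm_const\<close> > 0. Right
  multiplication by c / n therefore projects the group algebra onto the left ideal, and the trace
  becomes a sum of coefficients of c over conjugates of the inverse of the group element. The inner
  product with the Frobenius values comes from triangularity. Their defining signed sum runs over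
  coloring counts whose contents are the row lengths shifted by a permutation \<open>w\<close>. For
  \<open>w\<close> other than the identity the content is not dominated by the row lengths, and c
  annihilates such colorings.\<close>

section \<open>Alternating pairing of exponent sequences\<close>

lemma sum_of_bool_le_interval:
  fixes a :: int
  assumes "0 \<le> a" "a \<le> int M"
  shows "(\<Sum>r=1..M. of_bool (int r \<le> a)) = a"
proof -
  have "(\<Sum>r=1..M. of_bool (int r \<le> a)) = int (card ({1..M} \<inter> {r. int r \<le> a}))"
    by simp
  also have "{1..M} \<inter> {r. int r \<le> a} = {1..nat a}"
    using assms by auto
  finally show ?thesis using assms by simp
qed

lemma sum_of_bool_single:
  fixes a :: int and P :: bool
  assumes "a \<le> int M"
  shows "(\<Sum>r=1..M. of_bool (int r = a \<and> P)) = (of_bool (0 < a \<and> P) :: int)"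
proof (cases "0 < a")
  case True
  then have "(\<Sum>r=1..M. of_bool (int r = a \<and> P)) = (\<Sum>r=1..M. if r = nat a then of_bool P else (0::int))"
    by (intro sum.cong) auto
  also have "\<dots> = of_bool P" using True assms by (subst sum.delta) auto
  finally show ?thesis using True by simp
next
  case False
  then show ?thesis by simp
qed

lemma card_le_sum_nat_set:
  fixes X :: "nat set"
  assumes "finite X"
  shows "\<Sum>{..<card X} \<le> \<Sum>X"
    and "\<Sum>X = \<Sum>{..<card X} \<Longrightarrow> X = {..<card X}"
proof -
  have "\<Sum>{..<card X} \<le> \<Sum>X \<and> (\<Sum>X = \<Sum>{..<card X} \<longrightarrow> X = {..<card X})"
    using assms
  proof (induction "card X" arbitrary: X)
    case 0
    then show ?case by simp
  next
    case (Suc n)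
    then have ne: "X \<noteq> {}" by auto
    define m where "m = Max X"
    have mX: "m \<in> X" using ne Suc.prems by (simp add: m_def)
    have sub: "X \<subseteq> {..m}" using Suc.prems by (auto simp: m_def)
    have cX: "card X = Suc n" using Suc.hyps by simp
    have "Suc n \<le> Suc m" using card_mono[OF _ sub] cX by simp
    then have nm: "n \<le> m" by simp
    have "card (X - {m}) = n" using mX cX Suc.prems by simp
    then have IH: "\<Sum>{..<n} \<le> \<Sum>(X - {m})" "\<Sum>(X - {m}) = \<Sum>{..<n} \<Longrightarrow> X - {m} = {..<n}"
      using Suc.hyps(1)[of "X - {m}"] Suc.prems by auto
    have s: "\<Sum>X = m + \<Sum>(X - {m})" using mX Suc.prems by (simp add: sum.remove)
    have t: "\<Sum>{..<Suc n} = n + \<Sum>{..<n}" by simp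
    show ?case
    proof (intro conjI impI)
      show "\<Sum>{..<card X} \<le> \<Sum>X" using IH(1) nm s t cX by simp
    next
      assume "\<Sum>X = \<Sum>{..<card X}"
      then have "m = n \<and> \<Sum>(X - {m}) = \<Sum>{..<n}" using IH(1) nm s t cX by simp
      then have m: "m = n" and "X - {m} = {..<n}" using IH(2) by blast+
      then have "insert m (X - {m}) = insert n {..<n}" by simp
      moreover have "insert m (X - {m}) = X" using mX by blast
      moreover have "insert n {..<n} = {..<card X}" by (auto simp: cX)
      ultimately show "X = {..<card X}" by simp
    qed
  qed
  then show "\<Sum>{..<card X} \<le> \<Sum>X" and "\<Sum>X = \<Sum>{..<card X} \<Longrightarrow> X = {..<card X}"
    by (rule conjunct1, rule mp[OF conjunct2])
qed

text \<open>Controls degrees of alternants. The inequality shows that nothing survives the removal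
  of more than \<open>d\<close> cells; the case of equality identifies the exponents of lowest
  degree as rearrangements of the staircase.\<close>

lemma sum_inj_on_nonneg:
  fixes l :: "nat \<Rightarrow> int"
  assumes "inj_on l {..<k}" "\<And>i. i < k \<Longrightarrow> 0 \<le> l i"
  shows "(\<Sum>i<k. int i) \<le> (\<Sum>i<k. l i)"
    and "(\<Sum>i<k. l i) = (\<Sum>i<k. int i) \<Longrightarrow> l ` {..<k} = int ` {..<k}"
proof -
  define X where "X = (\<lambda>i. nat (l i)) ` {..<k}"
  have inj: "inj_on (\<lambda>i. nat (l i)) {..<k}"
    using assms by (auto simp: inj_on_def eq_nat_nat_iff)
  have cX: "card X = k" unfolding X_def using inj by (simp add: card_image)
  have sX: "int (\<Sum>X) = (\<Sum>i<k. l i)"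
    unfolding X_def using inj assms by (simp add: sum.reindex)
  have fX: "finite X" by (simp add: X_def)
  have sk: "int (\<Sum>{..<k}) = (\<Sum>i<k. int i)" by simp
  show "(\<Sum>i<k. int i) \<le> (\<Sum>i<k. l i)"
    using card_le_sum_nat_set(1)[OF fX] unfolding cX sX[symmetric] sk[symmetric] by (simp only: of_nat_le_iff)
  assume "(\<Sum>i<k. l i) = (\<Sum>i<k. int i)"
  then have "int (\<Sum>X) = int (\<Sum>{..<k})" using sX sk by simp
  then have "X = {..<k}" using card_le_sum_nat_set(2)[OF fX] cX by (simp only: of_nat_eq_iff)
  then have "int ` X = int ` {..<k}" by simp
  moreover have "int ` X = l ` {..<k}" unfolding X_def image_image using assms by (auto intro!: image_cong)
  ultimately show "l ` {..<k} = int ` {..<k}" by simp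
qed

lemma all_less_split:
  fixes k :: nat
  assumes "i < k" "j < k" "P i \<longleftrightarrow> A" "P j \<longleftrightarrow> B" "\<And>x. x \<noteq> i \<Longrightarrow> x \<noteq> j \<Longrightarrow> P x \<longleftrightarrow> Q x"
  shows "(\<forall>x<k. P x) \<longleftrightarrow> A \<and> B \<and> (\<forall>x<k. x \<noteq> i \<longrightarrow> x \<noteq> j \<longrightarrow> Q x)"
proof
  assume L: "\<forall>x<k. P x"
  then have "A" "B" using assms(1-4) by blast+
  moreover have "\<forall>x<k. x \<noteq> i \<longrightarrow> x \<noteq> j \<longrightarrow> Q x" using L assms(5) by blast
  ultimately show "A \<and> B \<and> (\<forall>x<k. x \<noteq> i \<longrightarrow> x \<noteq> j \<longrightarrow> Q x)" by blast
next
  assume R: "A \<and> B \<and> (\<forall>x<k. x \<noteq> i \<longrightarrow> x \<noteq> j \<longrightarrow> Q x)"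
  show "\<forall>x<k. P x"
  proof (intro allI impI)
    fix x assume "x < k"
    then show "P x" using R assms(3-5) by (cases "x = i"; cases "x = j") auto
  qed
qed

text \<open>The determinant of the matrix with entries \<open>of_bool (l i = m j)\<close>, or the
  coefficient of x^l in the alternant with exponents \<open>m\<close>. For injective
  \<open>l\<close> and \<open>m\<close> it is the sign of the rearrangement taking one to the other,
  or 0 if there is none.\<close>

definition alt_delta :: "nat \<Rightarrow> (nat \<Rightarrow> int) \<Rightarrow> (nat \<Rightarrow> int) \<Rightarrow> int" where
  "alt_delta k l m = (\<Sum>s | s permutes {..<k}. sign s * of_bool (\<forall>i<k. l i = m (s i)))"

lemma alt_delta_commute: "alt_delta k l m = alt_delta k m l"
proof -
  have "alt_delta k l m = (\<Sum>s | s permutes {..<k}. sign (inv s) * of_bool (\<forall>i<k. l i = m (inv s i)))"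
    unfolding alt_delta_def by (rule sum_permutations_inverse)
  also have "\<dots> = alt_delta k m l"
    unfolding alt_delta_def
  proof (intro sum.cong refl)
    fix s assume "s \<in> {s. s permutes {..<k}}"
    then have s: "s permutes {..<k}" by simp
    have "(\<forall>i<k. l i = m (inv s i)) \<longleftrightarrow> (\<forall>i<k. m i = l (s i))"
      by (metis lessThan_iff permutes_in_image permutes_inverses(1) permutes_inverses(2) s)
    moreover have "sign (inv s) = sign s"
      using s by (intro sign_inverse) (auto simp: permutation_permutes)
    ultimately show "sign (inv s) * of_bool (\<forall>i<k. l i = m (inv s i)) = sign s * of_bool (\<forall>i<k. m i = l (s i))"
      by simp
  qed
  finally show ?thesis .
qed

lemma alt_delta_comp_left:
  assumes "w permutes {..<k}"
  shows "alt_delta k (l \<circ> w) m = sign w * alt_delta k l m"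
proof -
  have "alt_delta k (l \<circ> w) m = (\<Sum>s | s permutes {..<k}. sign (s \<circ> w) * of_bool (\<forall>i<k. (l \<circ> w) i = m ((s \<circ> w) i)))"
    unfolding alt_delta_def by (rule sum_permutations_compose_right[OF assms])
  also have "\<dots> = (\<Sum>s | s permutes {..<k}. sign w * (sign s * of_bool (\<forall>i<k. l i = m (s i))))"
  proof (intro sum.cong refl)
    fix s assume "s \<in> {s. s permutes {..<k}}"
    then have s: "s permutes {..<k}" by simp
    have "(\<forall>i<k. l (w i) = m (s (w i))) \<longleftrightarrow> (\<forall>i<k. l i = m (s i))"
      by (metis assms lessThan_iff permutes_in_image permutes_inverses(1))
    moreover have "sign (s \<circ> w) = sign w * sign s"
      using s assms by (subst sign_compose) (auto simp: permutation_permutes)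
    ultimately show "sign (s \<circ> w) * of_bool (\<forall>i<k. (l \<circ> w) i = m ((s \<circ> w) i)) =
        sign w * (sign s * of_bool (\<forall>i<k. l i = m (s i)))" by simp
  qed
  finally show ?thesis by (simp add: alt_delta_def sum_distrib_left)
qed

lemma alt_delta_cong:
  assumes "\<And>i. i < k \<Longrightarrow> l i = l' i" "\<And>i. i < k \<Longrightarrow> m i = m' i"
  shows "alt_delta k l m = alt_delta k l' m'"
  unfolding alt_delta_def
proof (intro sum.cong refl)
  fix s assume "s \<in> {s. s permutes {..<k}}"
  then have "s i < k" if "i < k" for i using that permutes_in_image[of s "{..<k}" i] by auto
  then show "sign s * of_bool (\<forall>i<k. l i = m (s i)) = sign s * of_bool (\<forall>i<k. l' i = m' (s i))"
    using assms by auto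
qed

lemma alt_delta_not_inj:
  assumes "\<not> inj_on l {..<k}"
  shows "alt_delta k l m = 0"
proof -
  obtain i j where ij: "i < k" "j < k" "i \<noteq> j" "l i = l j"
    using assms by (auto simp: inj_on_def)
  have "l \<circ> transpose i j = l" using ij by (auto simp: transpose_def)
  moreover have "transpose i j permutes {..<k}" using ij by (intro permutes_swap_id) auto
  ultimately have "alt_delta k l m = - alt_delta k l m"
    using alt_delta_comp_left[of "transpose i j" k l m] ij by (simp add: sign_swap_id)
  then show ?thesis by simp
qed

lemma alt_delta_refl:
  assumes "inj_on l {..<k}"
  shows "alt_delta k l l = 1"
proof -
  have "alt_delta k l l = (\<Sum>s | s permutes {..<k}. if s = id then 1 else 0)"
    unfolding alt_delta_def
  proof (intro sum.cong refl)
    fix s assume "s \<in> {s. s permutes {..<k}}"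
    then have s: "s permutes {..<k}" by simp
    have "s = id" if *: "\<forall>i<k. l i = l (s i)"
    proof
      fix i
      show "s i = id i"
      proof (cases "i < k")
        case True
        then have "s i < k" using s permutes_in_image[of s "{..<k}" i] by auto
        with * True assms show ?thesis by (auto simp: inj_on_def)
      next
        case False
        then show ?thesis using s by (simp add: permutes_def)
      qed
    qed
    then show "sign s * of_bool (\<forall>i<k. l i = l (s i)) = (if s = id then 1 else 0)"
      by (auto simp: sign_id)
  qed
  also have "\<dots> = 1" by (subst sum.delta) (auto simp: finite_permutations permutes_id)
  finally show ?thesis .
qed

lemma alt_delta_eq_0:
  assumes "j < k" "l j \<notin> m ` {..<k}"
  shows "alt_delta k l m = 0"
  unfolding alt_delta_def
proof (intro sum.neutral ballI)
  fix s assume "s \<in> {s. s permutes {..<k}}"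
  then have "s j < k" using permutes_in_image[of s "{..<k}" j] assms by auto
  then have "l j \<noteq> m (s j)" using assms by auto
  then show "sign s * of_bool (\<forall>i<k. l i = m (s i)) = 0" using assms by auto
qed

text \<open>The base case of orthogonality: the two factors on the left are the Frobenius values on
  the empty set. In this degree an injective \<open>l\<close> is a rearrangement of the staircase,
  so it contributes only a sign to either side.\<close>

lemma alt_delta_staircase:
  fixes l m :: "nat \<Rightarrow> int" and k :: nat
  defines "\<delta> \<equiv> (\<lambda>i. int k - 1 - int i)"
  assumes "\<And>i. i < k \<Longrightarrow> 0 \<le> l i" "(\<Sum>i<k. l i) = (\<Sum>i<k. int i)"
  shows "alt_delta k l \<delta> * alt_delta k m \<delta> = alt_delta k l m"
proof (cases "inj_on l {..<k}")
  case False
  then show ?thesis by (simp add: alt_delta_not_inj)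
next
  case True
  have inj\<delta>: "inj_on \<delta> {..<k}" by (auto simp: inj_on_def \<delta>_def)
  have im: "\<delta> ` {..<k} = int ` {..<k}"
  proof (intro equalityI subsetI)
    fix x assume "x \<in> \<delta> ` {..<k}"
    then obtain i where "i < k" "x = int k - 1 - int i" by (auto simp: \<delta>_def)
    then show "x \<in> int ` {..<k}" by (intro image_eqI[of _ _ "k - 1 - i"]) auto
  next
    fix x assume "x \<in> int ` {..<k}"
    then obtain i where "i < k" "x = int i" by auto
    then show "x \<in> \<delta> ` {..<k}" by (intro image_eqI[of _ _ "k - 1 - i"]) (auto simp: \<delta>_def)
  qed
  have iml: "l ` {..<k} = \<delta> ` {..<k}"
    using sum_inj_on_nonneg(2)[OF True] assms im by simp
  define w where "w i = (if i < k then inv_into {..<k} \<delta> (l i) else i)" for i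
  have wl: "w i < k \<and> \<delta> (w i) = l i" if "i < k" for i
  proof -
    have "l i \<in> \<delta> ` {..<k}" using iml that by auto
    then show ?thesis using that inv_into_into[of "l i" \<delta> "{..<k}"] f_inv_into_f[of "l i" \<delta> "{..<k}"]
      by (simp add: w_def)
  qed
  have "inj_on w {..<k}"
  proof (rule inj_onI)
    fix x y assume "x \<in> {..<k}" "y \<in> {..<k}" "w x = w y"
    then have "l x = l y" using wl[of x] wl[of y] by simp
    then show "x = y" using True \<open>x \<in> _\<close> \<open>y \<in> _\<close> by (auto simp: inj_on_def)
  qed
  moreover have "w ` {..<k} \<subseteq> {..<k}" using wl by auto
  ultimately have "bij_betw w {..<k} {..<k}"
    by (simp add: bij_betw_def endo_inj_surj)
  then have wp: "w permutes {..<k}"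
    by (rule bij_imp_permutes) (simp add: w_def)
  have l: "alt_delta k l n = sign w * alt_delta k \<delta> n" for n
    using alt_delta_cong[of k l "\<delta> \<circ> w" n n] alt_delta_comp_left[OF wp, of \<delta> n] wl by simp
  show ?thesis using alt_delta_refl[OF inj\<delta>] by (simp add: l alt_delta_commute[of k m])
qed

text \<open>Composing \<open>s\<close> with the transposition of \<open>i\<close> and
  \<open>j\<close> preserves \<open>E s i j\<close> and flips the sign, so the signed sum of
  \<open>E s i j\<close> is 0. Under \<open>E\<close>, the difference of \<open>l i\<close> and
  \<open>m (s i)\<close> is positive, negative or zero. Exchanging \<open>i\<close> and
  \<open>j\<close> matches the first two cases; the third is full agreement and occurs once for each
  of the k (k - 1) ordered pairs.\<close>

lemma alt_delta_exchange:
  fixes l m :: "nat \<Rightarrow> int" and k :: nat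
  defines "E \<equiv> (\<lambda>s i j. l i + l j = m (s i) + m (s j) \<and> (\<forall>x<k. x \<noteq> i \<longrightarrow> x \<noteq> j \<longrightarrow> l x = m (s x)))"
  shows "2 * (\<Sum>s | s permutes {..<k}. \<Sum>i<k. \<Sum>j\<in>{..<k} - {i}. sign s * of_bool (m (s i) < l i \<and> E s i j))
    = - (int k * (int k - 1)) * alt_delta k l m" (is "2 * ?X = _")
proof -
  let ?S = "{s. s permutes {..<k}}"
  have comm: "(\<Sum>i<k. \<Sum>j\<in>{..<k} - {i}. f i j) = (\<Sum>i<k. \<Sum>j\<in>{..<k} - {i}. f j i)"
    for f :: "nat \<Rightarrow> nat \<Rightarrow> int"
  proof -
    have eq: "(\<Sum>i<k. \<Sum>j\<in>{..<k} - {i}. f i j) = (\<Sum>i<k. \<Sum>j<k. if i \<noteq> j then f i j else 0)" for f :: "nat \<Rightarrow> nat \<Rightarrow> int"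
      by (intro sum.cong refl sum.mono_neutral_cong_left) auto
    show ?thesis unfolding eq by (subst sum.swap) (auto intro!: sum.cong)
  qed
  have X2: "?X = (\<Sum>s\<in>?S. \<Sum>i<k. \<Sum>j\<in>{..<k} - {i}. sign s * of_bool (l i < m (s i) \<and> E s i j))"
  proof (rule sum.cong[OF refl])
    fix s
    have "(m (s j) < l j \<and> E s j i) = (l i < m (s i) \<and> E s i j)" for i j
      unfolding E_def by auto
    then show "(\<Sum>i<k. \<Sum>j\<in>{..<k} - {i}. sign s * of_bool (m (s i) < l i \<and> E s i j)) =
      (\<Sum>i<k. \<Sum>j\<in>{..<k} - {i}. sign s * of_bool (l i < m (s i) \<and> E s i j))"
      by (subst comm) simp
  qed
  have "2 * ?X = (\<Sum>s\<in>?S. \<Sum>i<k. \<Sum>j\<in>{..<k} - {i}. sign s * of_bool (m (s i) < l i \<and> E s i j)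
      + sign s * of_bool (l i < m (s i) \<and> E s i j))"
    unfolding mult_2 by (subst (2) X2) (simp only: sum.distrib)
  also have "\<dots> = (\<Sum>s\<in>?S. \<Sum>i<k. \<Sum>j\<in>{..<k} - {i}. sign s * of_bool (E s i j)
      - sign s * of_bool (\<forall>x<k. l x = m (s x)))"
  proof (rule sum.cong[OF refl], rule sum.cong[OF refl], rule sum.cong[OF refl])
    fix s i j assume "i \<in> {..<k}" "j \<in> {..<k} - {i}"
    then have "(E s i j \<and> l i = m (s i)) \<longleftrightarrow> (\<forall>x<k. l x = m (s x))"
      by (auto simp: E_def)
    then show "sign s * of_bool (m (s i) < l i \<and> E s i j) + sign s * of_bool (l i < m (s i) \<and> E s i j)
      = sign s * of_bool (E s i j) - sign s * of_bool (\<forall>x<k. l x = m (s x))"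
      by (cases "E s i j"; cases "m (s i) < l i"; cases "l i < m (s i)") auto
  qed
  also have "\<dots> = (\<Sum>i<k. \<Sum>j\<in>{..<k} - {i}. \<Sum>s\<in>?S. sign s * of_bool (E s i j)) -
      (\<Sum>i<k. \<Sum>j\<in>{..<k} - {i}. \<Sum>s\<in>?S. sign s * of_bool (\<forall>x<k. l x = m (s x)))"
    unfolding sum_subtractf by (simp only: sum.swap[of _ _ ?S])
  also have "(\<Sum>i<k. \<Sum>j\<in>{..<k} - {i}. \<Sum>s\<in>?S. sign s * of_bool (E s i j)) = 0"
  proof (rule sum.neutral, rule ballI, rule sum.neutral, rule ballI)
    fix i j assume ij: "i \<in> {..<k}" "j \<in> {..<k} - {i}"
    let ?t = "transpose i j"
    have t: "?t permutes {..<k}" using ij by (intro permutes_swap_id) auto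
    have "(\<Sum>s\<in>?S. sign s * of_bool (E s i j)) = (\<Sum>s\<in>?S. sign (s \<circ> ?t) * of_bool (E (s \<circ> ?t) i j))"
      by (rule sum_permutations_compose_right[OF t])
    also have "\<dots> = (\<Sum>s\<in>?S. - (sign s * of_bool (E s i j)))"
    proof (rule sum.cong[OF refl])
      fix s assume "s \<in> ?S"
      then have "sign (s \<circ> ?t) = - sign s"
        using t ij by (subst sign_compose) (auto simp: permutation_permutes sign_swap_id)
      moreover have "E (s \<circ> ?t) i j = E s i j"
        by (auto simp: E_def transpose_def)
      ultimately show "sign (s \<circ> ?t) * of_bool (E (s \<circ> ?t) i j) = - (sign s * of_bool (E s i j))" by simp
    qed
    finally show "(\<Sum>s\<in>?S. sign s * of_bool (E s i j)) = 0" by (simp add: sum_negf)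
  qed
  also have "(\<Sum>i<k. \<Sum>j\<in>{..<k} - {i}. \<Sum>s\<in>?S. sign s * of_bool (\<forall>x<k. l x = m (s x))) = int k * (int k - 1) * alt_delta k l m"
  proof -
    have "(\<Sum>j\<in>{..<k} - {i}. alt_delta k l m) = (int k - 1) * alt_delta k l m" if "i < k" for i
      using that by (simp add: of_nat_diff)
    then show ?thesis unfolding alt_delta_def[symmetric] by simp
  qed
  finally show ?thesis by simp
qed

text \<open>Expand both pairings over permutations \<open>s\<close>. Summed over \<open>r\<close>, the terms with \<open>j = s i\<close>
  contribute \<open>\<Sum>l\<close> times the pairing; the others cancel, by transposing two entries, up to
  \<open>- k (k - 1) / 2\<close> times the pairing.\<close>

lemma sum_alt_delta_lower:
  fixes l m :: "nat \<Rightarrow> int"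
  assumes l0: "\<And>i. i < k \<Longrightarrow> 0 \<le> l i" and m0: "\<And>i. i < k \<Longrightarrow> 0 \<le> m i"
    and ls: "(\<Sum>i<k. l i) = int d + (\<Sum>i<k. int i)"
  shows "(\<Sum>r=1..d. \<Sum>i<k. \<Sum>j<k. if int r \<le> l i \<and> int r \<le> m j
      then alt_delta k (l(i := l i - int r)) (m(j := m j - int r)) else 0) = int d * alt_delta k l m"
proof -
  let ?S = "{s. s permutes {..<k}}"
  let ?f = "\<lambda>r i j. if int r \<le> l i \<and> int r \<le> m j
      then alt_delta k (l(i := l i - int r)) (m(j := m j - int r)) else 0"
  define E where "E = (\<lambda>s i j. l i + l j = m (s i) + m (s j) \<and> (\<forall>x<k. x \<noteq> i \<longrightarrow> x \<noteq> j \<longrightarrow> l x = m (s x)))"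
  \<comment> \<open>\<open>M\<close> is the sum of all \<open>l i\<close>, hence an upper bound for
    each of them. Extending the range of \<open>r\<close> from \<open>d\<close> to \<open>M\<close>
    lets the sum over \<open>r\<close> be evaluated for fixed \<open>s\<close>, \<open>i\<close> and
    \<open>j\<close>.\<close>
  define M where "M = d + nat (\<Sum>i<k. int i)"
  have intM: "int M = (\<Sum>i<k. l i)" unfolding M_def ls by (simp add: sum_nonneg)
  have reindex: "(\<Sum>j<k. g j) = (\<Sum>j<k. g (s j))" if "s permutes {..<k}" for g :: "nat \<Rightarrow> int" and s
    using sum.permute[OF that, of g] by (simp add: comp_def)
  have lM: "l i \<le> int M" if "i < k" for i
    unfolding intM using that l0 by (intro member_le_sum) auto
  \<comment> \<open>For \<open>r\<close> beyond \<open>d\<close> the lowered entries have too small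
    a sum to be distinct and nonnegative.\<close>
  have fz: "?f r i j = 0" if "i < k" "j < k" "d < r" for i j r
  proof (cases "int r \<le> l i \<and> inj_on (l(i := l i - int r)) {..<k}")
    case True
    have "(\<Sum>x<k. int x) \<le> (\<Sum>x<k. (l(i := l i - int r)) x)"
    proof (rule sum_inj_on_nonneg(1))
      show "inj_on (l(i := l i - int r)) {..<k}" using True by blast
      show "0 \<le> (l(i := l i - int r)) x" if "x < k" for x using True l0 that by simp
    qed
    also have "(\<Sum>x<k. (l(i := l i - int r)) x) = (\<Sum>x<k. l x - (if x = i then int r else 0))"
      by (intro sum.cong) auto
    also have "\<dots> = int d + (\<Sum>i<k. int i) - int r"
      using that by (simp add: sum_subtractf ls)
    finally show ?thesis using that by simp
  next
    case False
    then show ?thesis by (auto simp: alt_delta_not_inj)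
  qed
  have "(\<Sum>r=1..d. \<Sum>i<k. \<Sum>j<k. ?f r i j) = (\<Sum>r=1..M. \<Sum>i<k. \<Sum>j<k. ?f r i j)"
  proof (intro sum.mono_neutral_left ballI)
    show "{1..d} \<subseteq> {1..M}" by (auto simp: M_def)
    fix r assume "r \<in> {1..M} - {1..d}"
    then show "(\<Sum>i<k. \<Sum>j<k. ?f r i j) = 0" by (intro sum.neutral ballI fz) auto
  qed simp
  also have "\<dots> = (\<Sum>r=1..M. \<Sum>i<k. \<Sum>j<k. \<Sum>s\<in>?S. sign s * of_bool (int r \<le> l i \<and> int r \<le> m j \<and>
      (\<forall>x<k. (l(i := l i - int r)) x = (m(j := m j - int r)) (s x))))"
    by (intro sum.cong refl) (auto simp: alt_delta_def intro!: sum.cong)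
  also have "\<dots> = (\<Sum>s\<in>?S. \<Sum>i<k. \<Sum>j<k. \<Sum>r=1..M. sign s * of_bool (int r \<le> l i \<and> int r \<le> m j \<and>
      (\<forall>x<k. (l(i := l i - int r)) x = (m(j := m j - int r)) (s x))))"
    by (simp only: sum.swap[of _ ?S] sum.swap[of _ _ "{1..M}"])
  \<comment> \<open>Entry \<open>s j\<close> of \<open>m\<close> is compared with entry
    \<open>j\<close> of \<open>l\<close>, so reindexing by \<open>s\<close> separates the case where
    both subtractions hit the same comparison from the case where they hit two different
    ones.\<close>
  also have "\<dots> = (\<Sum>s\<in>?S. \<Sum>i<k. \<Sum>j<k. \<Sum>r=1..M. sign s * of_bool (int r \<le> l i \<and> int r \<le> m (s j) \<and>
      (\<forall>x<k. (l(i := l i - int r)) x = (m(s j := m (s j) - int r)) (s x))))"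
    by (rule sum.cong[OF refl], rule sum.cong[OF refl], rule reindex) simp
  also have "\<dots> = (\<Sum>s\<in>?S. \<Sum>i<k. l i * (sign s * of_bool (\<forall>x<k. l x = m (s x))) +
      (\<Sum>j\<in>{..<k} - {i}. sign s * of_bool (m (s i) < l i \<and> E s i j)))"
  proof (intro sum.cong refl)
    fix s i assume "s \<in> ?S" and "i \<in> {..<k}"
    then have s: "s permutes {..<k}" and i: "i < k" by auto
    have sk: "s x < k" if "x < k" for x using that s permutes_in_image[of s "{..<k}" x] by auto
    have sinj: "s x = s y \<longleftrightarrow> x = y" for x y using permutes_inj[OF s] by (auto simp: inj_def)
    let ?g = "\<lambda>j. \<Sum>r=1..M. sign s * of_bool (int r \<le> l i \<and> int r \<le> m (s j) \<and>
        (\<forall>x<k. (l(i := l i - int r)) x = (m(s j := m (s j) - int r)) (s x)))"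
    have "?g i = l i * (sign s * of_bool (\<forall>x<k. l x = m (s x)))"
    proof -
      have "?g i = (\<Sum>r=1..M. of_bool (int r \<le> l i) * (sign s * of_bool (\<forall>x<k. l x = m (s x))))"
      proof (intro sum.cong refl)
        fix r
        have "(\<forall>x<k. (l(i := l i - int r)) x = (m(s i := m (s i) - int r)) (s x)) \<longleftrightarrow> (\<forall>x<k. l x = m (s x))"
          using i by (auto simp: sinj)
        then show "sign s * of_bool (int r \<le> l i \<and> int r \<le> m (s i) \<and>
          (\<forall>x<k. (l(i := l i - int r)) x = (m(s i := m (s i) - int r)) (s x))) =
          of_bool (int r \<le> l i) * (sign s * of_bool (\<forall>x<k. l x = m (s x)))"
          using i by auto
      qed
      also have "\<dots> = l i * (sign s * of_bool (\<forall>x<k. l x = m (s x)))"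
        unfolding sum_distrib_right[symmetric] using sum_of_bool_le_interval[OF l0[OF i] lM[OF i]] by simp
      finally show ?thesis .
    qed
    moreover have "?g j = sign s * of_bool (m (s i) < l i \<and> E s i j)" if "j \<in> {..<k} - {i}" for j
    proof -
      have j: "j < k" "j \<noteq> i" using that by auto
      have "?g j = (\<Sum>r=1..M. sign s * of_bool (int r = l i - m (s i) \<and> E s i j))"
      proof (intro sum.cong refl)
        fix r
        have "(\<forall>x<k. (l(i := l i - int r)) x = (m(s j := m (s j) - int r)) (s x)) \<longleftrightarrow>
          l i - int r = m (s i) \<and> l j = m (s j) - int r \<and> (\<forall>x<k. x \<noteq> i \<longrightarrow> x \<noteq> j \<longrightarrow> l x = m (s x))"
          by (rule all_less_split) (use i j in \<open>simp_all add: sinj\<close>)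
        \<comment> \<open>Here \<open>r\<close> is forced to be \<open>l i - m (s i)\<close>. Both
          upper bounds on \<open>r\<close> then follow from the nonnegativity of
          \<open>m (s i)\<close> and \<open>l j\<close>.\<close>
        moreover have "(r' \<le> a \<and> r' \<le> b \<and> a - r' = x \<and> c = b - r' \<and> C) \<longleftrightarrow> (r' = a - x \<and> a + c = x + b \<and> C)"
          if "0 \<le> c" "0 \<le> x" for a b c x r' :: int and C
          using that by auto
        ultimately have "(int r \<le> l i \<and> int r \<le> m (s j) \<and>
          (\<forall>x<k. (l(i := l i - int r)) x = (m(s j := m (s j) - int r)) (s x))) \<longleftrightarrow>
          (int r = l i - m (s i) \<and> E s i j)"
          unfolding E_def using l0[OF j(1)] m0[OF sk[OF i]] by presburger
        then show "sign s * of_bool (int r \<le> l i \<and> int r \<le> m (s j) \<and>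
          (\<forall>x<k. (l(i := l i - int r)) x = (m(s j := m (s j) - int r)) (s x))) =
          sign s * of_bool (int r = l i - m (s i) \<and> E s i j)" by simp
      qed
      also have "\<dots> = sign s * of_bool (m (s i) < l i \<and> E s i j)"
        unfolding sum_distrib_left[symmetric]
        using sum_of_bool_single[of "l i - m (s i)" M "E s i j"] lM[OF i] m0[OF sk[OF i]] by simp
      finally show ?thesis .
    qed
    ultimately show "(\<Sum>j<k. ?g j) = l i * (sign s * of_bool (\<forall>x<k. l x = m (s x))) +
      (\<Sum>j\<in>{..<k} - {i}. sign s * of_bool (m (s i) < l i \<and> E s i j))"
      using i by (simp add: sum.remove[of "{..<k}" i])
  qed
  also have "\<dots> = (\<Sum>i<k. l i) * alt_delta k l m +
      (\<Sum>s\<in>?S. \<Sum>i<k. \<Sum>j\<in>{..<k} - {i}. sign s * of_bool (m (s i) < l i \<and> E s i j))" (is "_ = _ + ?X")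
    unfolding sum.distrib alt_delta_def
    by (simp only: sum_distrib_right[symmetric] sum_distrib_left[symmetric])
  finally have eq: "(\<Sum>r=1..d. \<Sum>i<k. \<Sum>j<k. ?f r i j) = (\<Sum>i<k. l i) * alt_delta k l m + ?X" .
  have "2 * (\<Sum>i<k. int i) = int k * (int k - 1)"
    by (induction k) (auto simp: algebra_simps)
  moreover have "2 * ?X = - (int k * (int k - 1)) * alt_delta k l m"
    using alt_delta_exchange[where k = k and l = l and m = m] by (simp add: E_def)
  ultimately have "2 * ?X = 2 * (- (\<Sum>i<k. int i) * alt_delta k l m)"
    by (metis mult.assoc mult_minus_right mult_minus_left)
  then have "?X = - (\<Sum>i<k. int i) * alt_delta k l m" by (simp only: mult_cancel_left) simp
  then show ?thesis unfolding eq ls by (simp add: algebra_simps)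
qed

section \<open>Orbits and Frobenius values\<close>

lemma orbit_subset_stable:
  assumes "g ` A \<subseteq> A" "a \<in> A"
  shows "orbit g a \<subseteq> A"
proof
  fix x assume "x \<in> orbit g a"
  then show "x \<in> A" by induction (use assms in auto)
qed

lemma orbit_step_iff:
  assumes "permutation g"
  shows "g x \<in> orbit g a \<longleftrightarrow> x \<in> orbit g a"
proof
  assume "g x \<in> orbit g a"
  moreover have "x \<in> orbit g (g x)"
    using permutation_orbit_step[OF assms, of x] permutation_self_in_orbit[OF assms, of x] by simp
  ultimately show "x \<in> orbit g a" by (metis orbit_trans)
qed (rule orbit.step)

lemma orbit_eq_iff:
  assumes "permutation g"
  shows "orbit g x = orbit g a \<longleftrightarrow> x \<in> orbit g a"
proof
  assume "orbit g x = orbit g a"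
  then show "x \<in> orbit g a" using permutation_self_in_orbit[OF assms, of x] by simp
next
  assume x: "x \<in> orbit g a"
  then have "a \<in> orbit g x"
    using permutation_self_in_orbit[OF assms, of a] by (metis orbit_swap)
  with x show "orbit g x = orbit g a" by (meson orbit_trans subsetI subset_antisym)
qed

lemma orbit_image_diff:
  assumes "permutation g"
  shows "orbit g ` (A - orbit g a) = orbit g ` A - {orbit g a}"
  using orbit_eq_iff[OF assms] by auto

text \<open>The point \<open>a\<close> is spliced into the cycle of \<open>b\<close>: it is sent to
  \<open>b\<close>, the former predecessor of \<open>b\<close> is sent to \<open>a\<close>, and all
  other steps are those of \<open>q\<close>.\<close>

lemma orbit_transpose_comp:
  assumes "finite S" "q permutes S" "a \<notin> S" "b \<in> S"
  shows "orbit (transpose a b \<circ> q) a = insert a (orbit q b)"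
proof -
  let ?g = "transpose a b \<circ> q"
  have qa: "q a = a" using assms by (simp add: permutes_def)
  have ga: "?g a = b" by (simp add: qa)
  have sub: "orbit q b \<subseteq> S" using assms by (intro orbit_subset_stable) (auto simp: permutes_in_image)
  have qS: "q y \<noteq> a" if "y \<in> S" for y using that assms permutes_in_image[of q S y] by auto
  have pq: "permutation q" using assms by (auto simp: permutation_permutes)
  then have "permutation ?g" by (intro permutation_compose permutation_swap_id)
  show ?thesis
  proof (intro equalityI subsetI)
    fix x assume "x \<in> orbit ?g a"
    then show "x \<in> insert a (orbit q b)"
    proof induction
      case base
      then show ?case using ga permutation_self_in_orbit[OF pq] by simp
    next
      case (step y)
      show ?case
      proof (cases "y = a")
        case True
        then show ?thesis using ga permutation_self_in_orbit[OF pq] by simp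
      next
        case False
        then have y: "y \<in> orbit q b" using step by simp
        then have "q y \<in> orbit q b" by (rule orbit.step)
        then show ?thesis using sub qS[of y] y by (auto simp: transpose_def)
      qed
    qed
  next
    fix x assume "x \<in> insert a (orbit q b)"
    then show "x \<in> orbit ?g a"
    proof
      assume "x = a"
      then show ?thesis using permutation_self_in_orbit[OF \<open>permutation ?g\<close>] by simp
    next
      have b: "b \<in> orbit ?g a" using orbit.base[of ?g a] unfolding ga .
      have st: "q y \<in> orbit ?g a" if "y \<in> S" "y \<in> orbit ?g a" for y
      proof (cases "q y = b")
        case False
        then have "?g y = q y" using qS[OF that(1)] by (simp add: transpose_def)
        then show ?thesis using orbit.step[OF that(2)] by simp
      qed (use b in simp)
      assume "x \<in> orbit q b"
      then show ?thesis
      proof induction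
        case base
        show ?case using st[OF assms(4) b] .
      next
        case (step y)
        then show ?case using st[of y] sub by blast
      qed
    qed
  qed
qed

text \<open>A permutation of \<open>A\<close> is chosen by deciding the orbit of \<open>a\<close> one point at a time:
  \<open>g\<close> is either trivial at \<open>a\<close> or \<open>transpose a b \<circ> h\<close> with \<open>h\<close> fixing \<open>a\<close>, in which
  case \<open>a\<close> is inserted into the \<open>h\<close>-orbit of \<open>b\<close>.\<close>

lemma sum_permutes_orbit:
  fixes Q :: "nat \<Rightarrow> 'a set \<Rightarrow> ('a \<Rightarrow> 'a) \<Rightarrow> 'b::comm_semiring_1"
  assumes "finite A" "a \<in> A"
    and "\<And>r B g h. B \<subseteq> A \<Longrightarrow> (\<And>x. x \<in> B \<Longrightarrow> g x = h x) \<Longrightarrow> Q r B g = Q r B h"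
    and "\<And>r B. 1 \<le> r \<Longrightarrow> B \<subseteq> A - {a} \<Longrightarrow> card B + r = card A \<Longrightarrow>
      (\<Sum>h | h permutes B. Q r B h) = of_nat (fact (card A - r)) * q r"
  shows "(\<Sum>g | g permutes A. Q (card (orbit g a)) (A - orbit g a) g)
    = of_nat (fact (card A - 1)) * (\<Sum>r=1..card A. q r)"
  using assms
proof (induction "card A" arbitrary: A a Q q)
  case 0
  then show ?case by simp
next
  case (Suc n)
  note cong = Suc.prems(3) and val = Suc.prems(4)
  define S where "S = A - {a}"
  have A: "A = insert a S" "a \<notin> S" "finite S" using Suc.prems by (auto simp: S_def)
  have cS: "card S = n" "card A = Suc n" using Suc.hyps(2) A by auto
  let ?f = "\<lambda>g. Q (card (orbit g a)) (A - orbit g a) g"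
  have "(\<Sum>g | g permutes A. ?f g) = (\<Sum>b\<in>insert a S. \<Sum>h | h permutes S. ?f (transpose a b \<circ> h))"
    unfolding A(1) using A by (intro sum_over_permutations_insert)
  also have "\<dots> = (\<Sum>h | h permutes S. ?f h) + (\<Sum>b\<in>S. \<Sum>h | h permutes S. ?f (transpose a b \<circ> h))"
    using A by simp
  also have "(\<Sum>h | h permutes S. ?f h) = (\<Sum>h | h permutes S. Q 1 S h)"
  proof (rule sum.cong[OF refl])
    fix h assume "h \<in> {h. h permutes S}"
    then have "h a = a" using A by (auto simp: permutes_def)
    then have "orbit h a = {a}" by (simp add: orbit_eq_singleton_iff)
    then show "?f h = Q 1 S h" by (simp add: S_def)
  qed
  also have "\<dots> = of_nat (fact n) * q 1" using val[of 1 S] cS by (simp add: S_def)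
  also have "(\<Sum>b\<in>S. \<Sum>h | h permutes S. ?f (transpose a b \<circ> h)) =
    (\<Sum>b\<in>S. of_nat (fact (n - 1)) * (\<Sum>r=1..n. q (Suc r)))"
  proof (rule sum.cong[OF refl])
    fix b assume b: "b \<in> S"
    have "(\<Sum>h | h permutes S. ?f (transpose a b \<circ> h)) =
      (\<Sum>h | h permutes S. Q (Suc (card (orbit h b))) (S - orbit h b) h)"
    proof (rule sum.cong[OF refl])
      fix h assume "h \<in> {h. h permutes S}"
      then have h: "h permutes S" by simp
      have ph: "permutation h" using h A by (auto simp: permutation_permutes)
      have o: "orbit (transpose a b \<circ> h) a = insert a (orbit h b)"
        using A b h by (intro orbit_transpose_comp)
      have sub: "orbit h b \<subseteq> S" using b h by (intro orbit_subset_stable) (auto simp: permutes_in_image)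
      then have "card (insert a (orbit h b)) = Suc (card (orbit h b))"
        using A by (intro card_insert_disjoint) (auto intro: finite_subset)
      moreover have "A - insert a (orbit h b) = S - orbit h b" by (auto simp: S_def)
      moreover have "Q r (S - orbit h b) (transpose a b \<circ> h) = Q r (S - orbit h b) h" for r
      proof (rule cong)
        fix x assume x: "x \<in> S - orbit h b"
        then have "h x \<notin> orbit h b" using orbit_step_iff[OF ph] by blast
        then have "h x \<noteq> b" using permutation_self_in_orbit[OF ph, of b] by auto
        moreover have "h x \<noteq> a" using x h A permutes_in_image[OF h, of x] by auto
        ultimately show "(transpose a b \<circ> h) x = h x" by (simp add: transpose_def)
      qed (auto simp: S_def)
      ultimately show "?f (transpose a b \<circ> h) = Q (Suc (card (orbit h b))) (S - orbit h b) h"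
        by (simp add: o)
    qed
    \<comment> \<open>Inserting \<open>a\<close> lengthens the orbit of \<open>b\<close> by one
      point and leaves its complement in place, so the induction hypothesis is applied to the family
      shifted by one.\<close>
    also have "\<dots> = of_nat (fact (card S - 1)) * (\<Sum>r=1..card S. q (Suc r))"
    proof (rule Suc.hyps(1)[where Q = "\<lambda>r. Q (Suc r)"])
      show "n = card S" "finite S" "b \<in> S" using A cS b by auto
      show "Q (Suc r) B g = Q (Suc r) B h" if "B \<subseteq> S" "\<And>x. x \<in> B \<Longrightarrow> g x = h x" for r B g h
        using that by (intro cong) (auto simp: S_def)
      show "(\<Sum>h | h permutes B. Q (Suc r) B h) = of_nat (fact (card S - r)) * q (Suc r)"
        if "1 \<le> r" "B \<subseteq> S - {b}" "card B + r = card S" for r B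
        using val[of "Suc r" B] that cS by (auto simp: S_def)
    qed
    finally show "(\<Sum>h | h permutes S. ?f (transpose a b \<circ> h)) =
      of_nat (fact (n - 1)) * (\<Sum>r=1..n. q (Suc r))" by (simp add: cS)
  qed
  \<comment> \<open>The \<open>n\<close> choices of \<open>b\<close> turn (n - 1)! into n!. For
    \<open>n = 0\<close> both sums are empty.\<close>
  also have "\<dots> = of_nat (fact n) * (\<Sum>r=1..n. q (Suc r))"
  proof (cases n)
    case (Suc m)
    then have "of_nat n * of_nat (fact (n - 1)) = (of_nat (fact n) :: 'b)"
      by (simp only: of_nat_mult[symmetric]) simp
    then show ?thesis by (simp only: sum_constant cS mult.assoc[symmetric])
  qed simp
  also have "of_nat (fact n) * q 1 + of_nat (fact n) * (\<Sum>r=1..n. q (Suc r)) =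
    of_nat (fact n) * (\<Sum>r=1..Suc n. q r)"
  proof -
    have "(\<Sum>r=1..Suc n. q r) = q 1 + (\<Sum>r=Suc 1..Suc n. q r)"
      by (rule sum.atLeast_Suc_atMost) simp
    also have "(\<Sum>r=Suc 1..Suc n. q r) = (\<Sum>r=1..n. q (Suc r))"
      by (rule sum.shift_bounds_cl_Suc_ivl)
    finally show ?thesis by (simp only: distrib_left)
  qed
  finally show ?case by (simp add: cS)
qed

lemma sum_over_orbits:
  fixes F :: "nat \<Rightarrow> 'b::comm_semiring_1"
  assumes "permutation g" "finite A" "g ` A \<subseteq> A"
  shows "(\<Sum>a\<in>A. F (card (orbit g a))) = (\<Sum>Z\<in>orbit g ` A. of_nat (card Z) * F (card Z))"
proof -
  have "(\<Sum>a\<in>A. F (card (orbit g a))) =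
    (\<Sum>Z\<in>orbit g ` A. \<Sum>a | a \<in> A \<and> orbit g a = Z. F (card (orbit g a)))"
    using assms by (intro sum.group[symmetric]) auto
  also have "\<dots> = (\<Sum>Z\<in>orbit g ` A. of_nat (card Z) * F (card Z))"
  proof (rule sum.cong[OF refl])
    fix Z assume "Z \<in> orbit g ` A"
    then obtain a where a: "a \<in> A" "Z = orbit g a" by auto
    have "{x. x \<in> A \<and> orbit g x = Z} = Z"
      unfolding a(2) using orbit_subset_stable[OF assms(3) a(1)] by (auto simp: orbit_eq_iff[OF assms(1)])
    moreover have "(\<Sum>x | x \<in> A \<and> orbit g x = Z. F (card (orbit g x))) =
        (\<Sum>x | x \<in> A \<and> orbit g x = Z. F (card Z))"
      by (rule sum.cong) auto
    ultimately show "(\<Sum>a | a \<in> A \<and> orbit g a = Z. F (card (orbit g a))) = of_nat (card Z) * F (card Z)"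
      by simp
  qed
  finally show ?thesis .
qed

section \<open>Invariant colorings and Frobenius's formula\<close>

definition colorings :: "nat \<Rightarrow> 'a set \<Rightarrow> ('a \<Rightarrow> 'a) \<Rightarrow> (nat \<Rightarrow> int) \<Rightarrow> ('a \<Rightarrow> nat) set" where
  "colorings k A g \<alpha> = {f \<in> A \<rightarrow>\<^sub>E {..<k}. (\<forall>x\<in>A. f (g x) = f x) \<and>
     (\<forall>i<k. int (card {x \<in> A. f x = i}) = \<alpha> i)}"

text \<open>The permutation character on colorings of content \<alpha>, evaluated at
  \<open>g\<close>; equivalently the coefficient of x^\<alpha> in the product of the power sums of
  the cycle lengths. The content is integer-valued so that subtracting a cycle length is always
  meaningful: a negative entry gives the count 0.\<close>

definition coloring_count :: "nat \<Rightarrow> 'a set \<Rightarrow> ('a \<Rightarrow> 'a) \<Rightarrow> (nat \<Rightarrow> int) \<Rightarrow> int" where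
  "coloring_count k A g \<alpha> = int (card (colorings k A g \<alpha>))"

lemma finite_colorings: "finite A \<Longrightarrow> finite (colorings k A g \<alpha>)"
  unfolding colorings_def by (rule finite_subset[OF _ finite_PiE[of A "\<lambda>_. {..<k}"]]) auto

lemma coloring_count_cong:
  assumes "\<And>x. x \<in> A \<Longrightarrow> g x = h x" "\<And>i. i < k \<Longrightarrow> \<alpha> i = \<beta> i"
  shows "coloring_count k A g \<alpha> = coloring_count k A h \<beta>"
proof -
  have "colorings k A g \<alpha> = colorings k A h \<beta>"
    unfolding colorings_def using assms by auto
  then show ?thesis by (simp add: coloring_count_def)
qed

lemma coloring_count_empty: "coloring_count k {} g \<alpha> = of_bool (\<forall>i<k. \<alpha> i = 0)"
proof -
  have "colorings k {} g \<alpha> = (if \<forall>i<k. \<alpha> i = 0 then {\<lambda>x. undefined} else {})"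
    by (auto simp: colorings_def)
  then show ?thesis by (simp add: coloring_count_def)
qed

lemma coloring_count_neg:
  assumes "i < k" "\<alpha> i < 0"
  shows "coloring_count k A g \<alpha> = 0"
proof -
  have "colorings k A g \<alpha> = {}" unfolding colorings_def using assms by force
  then show ?thesis by (simp add: coloring_count_def)
qed

text \<open>An invariant coloring is constant on the orbit, so it amounts to a color
  \<open>i\<close> for the orbit and an invariant coloring of the rest. On the side of polynomials
  this is multiplication by one power sum.\<close>

lemma coloring_count_remove_orbit:
  assumes g: "permutation g" and A: "finite A" "g ` A \<subseteq> A" "a \<in> A"
  defines "Z \<equiv> orbit g a"
  shows "coloring_count k A g \<alpha> = (\<Sum>i<k. coloring_count k (A - Z) g (\<alpha>(i := \<alpha> i - int (card Z))))"
proof -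
  have OA: "Z \<subseteq> A" unfolding Z_def using A by (intro orbit_subset_stable)
  have fO: "finite Z" using OA A by (auto intro: finite_subset)
  have aO: "a \<in> Z" unfolding Z_def using permutation_self_in_orbit[OF g] .
  have gO: "g x \<in> Z \<longleftrightarrow> x \<in> Z" for x unfolding Z_def by (rule orbit_step_iff[OF g])
  let ?C = "\<lambda>i. {f \<in> colorings k A g \<alpha>. f a = i}"
  have const: "f x = f a" if "f \<in> colorings k A g \<alpha>" "x \<in> Z" for f x
    using that(2) unfolding Z_def
  proof induction
    case base
    then show ?case using that(1) A by (simp add: colorings_def)
  next
    case (step y)
    then have "y \<in> A" using OA by (auto simp: Z_def)
    then show ?case using step that(1) by (simp add: colorings_def)
  qed
  have "colorings k A g \<alpha> = (\<Union>i<k. ?C i)" using A by (auto simp: colorings_def)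
  then have "card (colorings k A g \<alpha>) = (\<Sum>i<k. card (?C i))"
    using finite_colorings[OF A(1), of k g \<alpha>] by (subst card_UN_disjoint[symmetric]) auto
  also have "\<dots> = (\<Sum>i<k. card (colorings k (A - Z) g (\<alpha>(i := \<alpha> i - int (card Z)))))"
  proof (rule sum.cong[OF refl])
    fix i assume "i \<in> {..<k}"
    then have i: "i < k" by simp
    let ?D = "colorings k (A - Z) g (\<alpha>(i := \<alpha> i - int (card Z)))"
    let ?G = "\<lambda>h x. if x \<in> Z then i else h x"
    have cnt: "card {x \<in> A. f x = j} = card {x \<in> A - Z. f x = j} + (if j = i then card Z else 0)"
      if "\<And>x. x \<in> Z \<Longrightarrow> f x = i" for f j
    proof -
      have "{x \<in> A. f x = j} = {x \<in> A - Z. f x = j} \<union> (if j = i then Z else {})"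
        using that OA by auto
      also have "card \<dots> = card {x \<in> A - Z. f x = j} + card (if j = i then Z else {})"
        using A fO by (intro card_Un_disjoint) auto
      finally show ?thesis by simp
    qed
    have "bij_betw (\<lambda>f. restrict f (A - Z)) (?C i) ?D"
    proof (rule bij_betw_byWitness[where f' = ?G])
      show "\<forall>f\<in>?C i. ?G (restrict f (A - Z)) = f"
      proof
        fix f assume f: "f \<in> ?C i"
        then have ext: "f \<in> extensional A" by (auto simp: colorings_def PiE_def)
        show "?G (restrict f (A - Z)) = f"
        proof
          fix x
          show "?G (restrict f (A - Z)) x = f x"
            using const[of f x] f OA ext by (auto simp: restrict_def extensional_def)
        qed
      qed
      show "\<forall>h\<in>?D. restrict (?G h) (A - Z) = h"
      proof
        fix h assume "h \<in> ?D"
        then have ext: "h \<in> extensional (A - Z)" by (auto simp: colorings_def PiE_def)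
        show "restrict (?G h) (A - Z) = h"
          using ext by (auto simp: restrict_def extensional_def fun_eq_iff)
      qed
      show "(\<lambda>f. restrict f (A - Z)) ` ?C i \<subseteq> ?D"
      proof clarify
        fix f assume f: "f \<in> colorings k A g \<alpha>" "i = f a"
        have "f x = i" if "x \<in> Z" for x using const[OF f(1) that] f by simp
        from cnt[OF this] f A(2)
        have "int (card {x \<in> A - Z. f x = j}) = (\<alpha>(i := \<alpha> i - int (card Z))) j" if "j < k" for j
          using that by (auto simp: colorings_def)
        moreover have "{x \<in> A - Z. restrict f (A - Z) x = j} = {x \<in> A - Z. f x = j}" for j by auto
        ultimately have "\<forall>j<k. int (card {x \<in> A - Z. restrict f (A - Z) x = j}) = (\<alpha>(i := \<alpha> i - int (card Z))) j"
          by simp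
        moreover have "restrict f (A - Z) (g x) = restrict f (A - Z) x" if "x \<in> A - Z" for x
          using that A(2) gO[of x] f by (auto simp: colorings_def)
        moreover have "restrict f (A - Z) \<in> (A - Z) \<rightarrow>\<^sub>E {..<k}"
          using f by (auto simp: colorings_def)
        ultimately show "restrict f (A - Z) \<in> colorings k (A - Z) g (\<alpha>(f a := \<alpha> (f a) - int (card Z)))"
          unfolding colorings_def f(2)[symmetric] by blast
      qed
      show "?G ` ?D \<subseteq> ?C i"
      proof clarify
        fix h assume h: "h \<in> ?D"
        have "int (card {x \<in> A. ?G h x = j}) = \<alpha> j" if "j < k" for j
        proof -
          have "{x \<in> A - Z. ?G h x = j} = {x \<in> A - Z. h x = j}" by auto
          moreover have "int (card {x \<in> A - Z. h x = j}) = (\<alpha>(i := \<alpha> i - int (card Z))) j"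
            using h that by (auto simp: colorings_def)
          ultimately show ?thesis using cnt[of "?G h" j] by auto
        qed
        moreover have "?G h (g x) = ?G h x" if "x \<in> A" for x
          using that gO[of x] h by (auto simp: colorings_def)
        moreover have "?G h \<in> A \<rightarrow>\<^sub>E {..<k}"
          using h i OA by (auto simp: colorings_def PiE_iff extensional_def)
        ultimately show "?G h \<in> colorings k A g \<alpha> \<and> ?G h a = i"
          unfolding colorings_def using aO by auto
      qed
    qed
    then show "card (?C i) = card ?D" by (rule bij_betw_same_card)
  qed
  finally show ?thesis by (simp add: coloring_count_def)
qed

text \<open>The recursion sees an orbit only through its size, and removing an orbit of the same
  size on either side keeps the two multisets equal. The content changes in the recursion and is
  therefore generalized.\<close>

lemma coloring_count_orbit_type:
  assumes "permutation g" "finite A" "g ` A \<subseteq> A" "permutation h" "finite B" "h ` B \<subseteq> B"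
    and "image_mset card (mset_set (orbit g ` A)) = image_mset card (mset_set (orbit h ` B))"
  shows "coloring_count k A g \<alpha> = coloring_count k B h \<alpha>"
  using assms
proof (induction "card A" arbitrary: A B \<alpha> rule: less_induct)
  case less
  show ?case
  proof (cases "A = {}")
    case True
    then have "mset_set (orbit h ` B) = {#}" using less.prems by simp
    then have "B = {}" using less.prems by (simp add: mset_set_empty_iff)
    then show ?thesis using True by (simp add: coloring_count_empty)
  next
    case False
    then obtain a where a: "a \<in> A" by auto
    then have "card (orbit g a) \<in># image_mset card (mset_set (orbit g ` A))"
      using less.prems(2) by simp
    then have "card (orbit g a) \<in># image_mset card (mset_set (orbit h ` B))"
      by (simp only: less.prems(7))
    then obtain b where b: "b \<in> B" "card (orbit g a) = card (orbit h b)"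
      using less.prems by auto
    have rem: "image_mset card (mset_set (orbit f ` (X - orbit f x))) =
        image_mset card (mset_set (orbit f ` X)) - {#card (orbit f x)#}"
      if "permutation f" "finite X" "x \<in> X" for f X and x :: 'c
    proof -
      have "mset_set (orbit f ` X - {orbit f x}) = mset_set (orbit f ` X) - {#orbit f x#}"
        using that by (simp add: mset_set_Diff)
      then show ?thesis using that
        by (simp add: orbit_image_diff image_mset_Diff)
    qed
    have "coloring_count k (A - orbit g a) g \<beta> = coloring_count k (B - orbit h b) h \<beta>" for \<beta>
    proof (rule less.hyps)
      show "card (A - orbit g a) < card A"
        using a less.prems permutation_self_in_orbit[of g a] by (intro psubset_card_mono) auto
      show "image_mset card (mset_set (orbit g ` (A - orbit g a))) =
        image_mset card (mset_set (orbit h ` (B - orbit h b)))"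
        using rem[OF less.prems(1,2) a] rem[OF less.prems(4,5) b(1)] b(2) less.prems(7) by simp
    qed (use less.prems orbit_step_iff[OF less.prems(1)] orbit_step_iff[OF less.prems(4)] in auto)
    then show ?thesis
      using coloring_count_remove_orbit[OF less.prems(1-3) a, of k \<alpha>]
        coloring_count_remove_orbit[OF less.prems(4-6) b(1), of k \<alpha>] b(2) by simp
  qed
qed

text \<open>The coefficient of \<open>x\<^sup>l\<close> in the product of the Vandermonde determinant with the power sums
  of the cycle lengths of \<open>g\<close>. With \<open>l i = lam ! i + k - 1 - i\<close> this is Frobenius's formula for
  the character value.\<close>

definition frobenius_value :: "nat \<Rightarrow> 'a set \<Rightarrow> ('a \<Rightarrow> 'a) \<Rightarrow> (nat \<Rightarrow> int) \<Rightarrow> int" where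
  "frobenius_value k A g l =
     (\<Sum>w | w permutes {..<k}. sign w * coloring_count k A g (\<lambda>i. l i + int (w i) + 1 - int k))"

lemma frobenius_value_cong:
  assumes "\<And>x. x \<in> A \<Longrightarrow> g x = h x"
  shows "frobenius_value k A g l = frobenius_value k A h l"
  unfolding frobenius_value_def using assms by (simp cong: coloring_count_cong)

lemma frobenius_value_orbit_type:
  assumes "permutation g" "finite A" "g ` A \<subseteq> A" "permutation h" "finite B" "h ` B \<subseteq> B"
    and "image_mset card (mset_set (orbit g ` A)) = image_mset card (mset_set (orbit h ` B))"
  shows "frobenius_value k A g l = frobenius_value k B h l"
  unfolding frobenius_value_def using coloring_count_orbit_type[OF assms] by simp

lemma frobenius_value_neg:
  assumes "i < k" "l i < 0"
  shows "frobenius_value k A g l = 0"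
  unfolding frobenius_value_def
proof (intro sum.neutral ballI)
  fix w assume "w \<in> {w. w permutes {..<k}}"
  then have "w i < k" using assms permutes_in_image[of w "{..<k}" i] by auto
  \<comment> \<open>The shift \<open>int (w i) + 1 - int k\<close> is at most 0, so entry
    \<open>i\<close> of the content stays negative.\<close>
  then have "coloring_count k A g (\<lambda>i. l i + int (w i) + 1 - int k) = 0"
    using assms by (intro coloring_count_neg[of i]) auto
  then show "sign w * coloring_count k A g (\<lambda>i. l i + int (w i) + 1 - int k) = 0" by simp
qed

text \<open>Without cycles only the Vandermonde determinant is left, and its exponents are the
  staircase.\<close>

lemma frobenius_value_empty:
  "frobenius_value k {} g l = alt_delta k l (\<lambda>i. int k - 1 - int i)"
  unfolding frobenius_value_def alt_delta_def coloring_count_empty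
  by (intro sum.cong refl arg_cong2[where f = "(*)"] arg_cong[where f = of_bool]) (auto simp: algebra_simps)

text \<open>The Murnaghan--Nakayama rule: the nonzero summands correspond to the rim hooks of length
  \<open>card (orbit g a)\<close>.\<close>

lemma frobenius_value_remove_orbit:
  assumes "permutation g" "finite A" "g ` A \<subseteq> A" "a \<in> A"
  shows "frobenius_value k A g l =
    (\<Sum>i<k. frobenius_value k (A - orbit g a) g (l(i := l i - int (card (orbit g a)))))"
proof -
  have "frobenius_value k A g l = (\<Sum>w | w permutes {..<k}. \<Sum>i<k. sign w *
      coloring_count k (A - orbit g a) g
        ((\<lambda>i. l i + int (w i) + 1 - int k)(i := l i + int (w i) + 1 - int k - int (card (orbit g a)))))"
    unfolding frobenius_value_def sum_distrib_left[symmetric]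
    by (subst coloring_count_remove_orbit[OF assms]) simp
  also have "\<dots> = (\<Sum>w | w permutes {..<k}. \<Sum>i<k. sign w *
      coloring_count k (A - orbit g a) g (\<lambda>x. (l(i := l i - int (card (orbit g a)))) x + int (w x) + 1 - int k))"
    by (intro sum.cong refl arg_cong2[where f = "(*)"] coloring_count_cong) auto
  finally show ?thesis unfolding frobenius_value_def by (simp only: sum.swap[of _ _ "{..<k}"])
qed

text \<open>Orthogonality on \<open>B\<close> is a hypothesis because the computation is used twice:
  inside the induction that proves orthogonality, and afterwards with the finished theorem for the
  weighted sum of squares.\<close>

lemma sum_lowered_frobenius_values:
  assumes orth: "\<And>l m. (\<Sum>i<k. l i) = int (card B) + (\<Sum>i<k. int i) \<Longrightarrow>
      (\<Sum>i<k. m i) = int (card B) + (\<Sum>i<k. int i) \<Longrightarrow>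
      (\<Sum>g | g permutes B. frobenius_value k B g l * frobenius_value k B g m) =
      (if \<forall>i<k. 0 \<le> l i \<and> 0 \<le> m i then fact (card B) * alt_delta k l m else 0)"
    and nonneg: "\<And>i. i < k \<Longrightarrow> 0 \<le> l i \<and> 0 \<le> m i"
    and sums: "(\<Sum>i<k. l i) = int (card B + r) + (\<Sum>i<k. int i)"
      "(\<Sum>i<k. m i) = int (card B + r) + (\<Sum>i<k. int i)"
  shows "(\<Sum>h | h permutes B. (\<Sum>i<k. frobenius_value k B h (l(i := l i - int r))) *
      (\<Sum>j<k. frobenius_value k B h (m(j := m j - int r)))) =
    fact (card B) * (\<Sum>i<k. \<Sum>j<k. if int r \<le> l i \<and> int r \<le> m j
      then alt_delta k (l(i := l i - int r)) (m(j := m j - int r)) else 0)"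
proof -
  have upd: "(\<Sum>x<k. (n(i := n i - int r)) x) = (\<Sum>x<k. n x) - int r" if "i < k" for n i
  proof -
    have "(\<Sum>x<k. (n(i := n i - int r)) x) = (\<Sum>x<k. n x - (if x = i then int r else 0))"
      by (intro sum.cong) auto
    then show ?thesis using that by (simp add: sum_subtractf)
  qed
  have "(\<Sum>h | h permutes B. (\<Sum>i<k. frobenius_value k B h (l(i := l i - int r))) *
      (\<Sum>j<k. frobenius_value k B h (m(j := m j - int r)))) = (\<Sum>i<k. \<Sum>j<k. \<Sum>h | h permutes B.
    frobenius_value k B h (l(i := l i - int r)) * frobenius_value k B h (m(j := m j - int r)))"
    unfolding sum_product by (simp only: sum.swap[of _ _ "{h. h permutes B}"])
  also have "\<dots> = (\<Sum>i<k. \<Sum>j<k. fact (card B) * (if int r \<le> l i \<and> int r \<le> m j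
    then alt_delta k (l(i := l i - int r)) (m(j := m j - int r)) else 0))"
  proof (rule sum.cong[OF refl], rule sum.cong[OF refl])
    fix i j assume ij: "i \<in> {..<k}" "j \<in> {..<k}"
    have "(\<forall>x<k. 0 \<le> (l(i := l i - int r)) x \<and> 0 \<le> (m(j := m j - int r)) x) \<longleftrightarrow> int r \<le> l i \<and> int r \<le> m j"
      using ij nonneg by (auto split: if_splits)
    moreover have "(\<Sum>x<k. (l(i := l i - int r)) x) = int (card B) + (\<Sum>i<k. int i)"
      "(\<Sum>x<k. (m(j := m j - int r)) x) = int (card B) + (\<Sum>i<k. int i)"
      using ij sums upd[of i l] upd[of j m] by (simp_all del: fun_upd_apply)
    ultimately show "(\<Sum>h | h permutes B. frobenius_value k B h (l(i := l i - int r)) *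
        frobenius_value k B h (m(j := m j - int r))) = fact (card B) * (if int r \<le> l i \<and> int r \<le> m j
        then alt_delta k (l(i := l i - int r)) (m(j := m j - int r)) else 0)"
      using orth[of "l(i := l i - int r)" "m(j := m j - int r)"] by simp
  qed
  finally show ?thesis by (simp only: sum_distrib_left)
qed

text \<open>Splitting by the orbit of one point of a set of size n gives (n - 1)! times the sum of
  all lowered pairings, and \<open>sum_alt_delta_lower\<close> turns that sum into n times the
  original pairing. The case distinction matters because the recursion creates negative entries:
  there the values vanish although \<open>alt_delta\<close> may be 1.\<close>

theorem sum_frobenius_value_mult:
  fixes A :: "'a set"
  assumes "finite A"
    and "(\<Sum>i<k. l i) = int (card A) + (\<Sum>i<k. int i)"
    and "(\<Sum>i<k. m i) = int (card A) + (\<Sum>i<k. int i)"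
  shows "(\<Sum>g | g permutes A. frobenius_value k A g l * frobenius_value k A g m) =
    (if \<forall>i<k. 0 \<le> l i \<and> 0 \<le> m i then fact (card A) * alt_delta k l m else 0)"
  using assms
proof (induction "card A" arbitrary: A l m rule: less_induct)
  case less
  show ?case
  proof (cases "\<forall>i<k. 0 \<le> l i \<and> 0 \<le> m i")
    case False
    then have "frobenius_value k A g l * frobenius_value k A g m = 0" for g
      using frobenius_value_neg[of _ k l A g] frobenius_value_neg[of _ k m A g] by (auto simp: not_le)
    then have "(\<Sum>g | g permutes A. frobenius_value k A g l * frobenius_value k A g m) = 0"
      by (rule sum.neutral[OF ballI])
    then show ?thesis by (simp only: False if_False)
  next
    case nonneg: True
    show ?thesis
    proof (cases "A = {}")
      case True
      then show ?thesis using nonneg less.prems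
        by (simp add: frobenius_value_empty alt_delta_staircase)
    next
      case False
      then obtain a where a: "a \<in> A" by auto
      define Q where "Q r B g = (\<Sum>i<k. frobenius_value k B g (l(i := l i - int r))) *
        (\<Sum>j<k. frobenius_value k B g (m(j := m j - int r)))" for r B and g :: "'a \<Rightarrow> 'a"
      define q where "q r = (\<Sum>i<k. \<Sum>j<k. if int r \<le> l i \<and> int r \<le> m j
        then alt_delta k (l(i := l i - int r)) (m(j := m j - int r)) else 0)" for r
      have "(\<Sum>g | g permutes A. frobenius_value k A g l * frobenius_value k A g m) =
        (\<Sum>g | g permutes A. Q (card (orbit g a)) (A - orbit g a) g)"
      proof (rule sum.cong[OF refl])
        fix g assume "g \<in> {g. g permutes A}"
        then have "permutation g" "g ` A \<subseteq> A"
          using less.prems by (auto simp: permutation_permutes permutes_in_image)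
        then show "frobenius_value k A g l * frobenius_value k A g m = Q (card (orbit g a)) (A - orbit g a) g"
          unfolding Q_def using less.prems a by (subst (1 2) frobenius_value_remove_orbit) auto
      qed
      also have "\<dots> = of_nat (fact (card A - 1)) * (\<Sum>r=1..card A. q r)"
      proof (rule sum_permutes_orbit)
        show "finite A" "a \<in> A" using less.prems a by auto
        show "Q r B g = Q r B h" if "\<And>x. x \<in> B \<Longrightarrow> g x = h x" for r B g h
          unfolding Q_def using that by (simp cong: frobenius_value_cong)
      next
        fix r B assume r: "1 \<le> r" and B: "B \<subseteq> A - {a}" and cB: "card B + r = card A"
        have fB: "finite B" using B less.prems by (auto intro: finite_subset)
        have "(\<Sum>h | h permutes B. Q r B h) = fact (card B) * q r"
          unfolding Q_def q_def
        proof (rule sum_lowered_frobenius_values[OF less.hyps])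
          show "card B < card A" using r cB by simp
          show "0 \<le> l i \<and> 0 \<le> m i" if "i < k" for i using nonneg that by blast
        qed (use fB less.prems cB in simp_all)
        moreover have "card A - r = card B" using cB by simp
        ultimately show "(\<Sum>h | h permutes B. Q r B h) = of_nat (fact (card A - r)) * q r"
          by (simp only: of_nat_fact)
      qed
      also have "(\<Sum>r=1..card A. q r) = int (card A) * alt_delta k l m"
        unfolding q_def using nonneg less.prems by (intro sum_alt_delta_lower) auto
      also have "of_nat (fact (card A - 1)) * (int (card A) * alt_delta k l m) = fact (card A) * alt_delta k l m"
      proof -
        have "card A > 0" using False less.prems by (simp add: card_gt_0_iff)
        then show ?thesis by (simp add: fact_reduce[of "card A"] )
      qed
      finally show ?thesis using nonneg by simp
    qed
  qed
qed

section \<open>Class function properties, and counting by fibres\<close>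

lemma orbit_conjugate:
  assumes "bij x"
  shows "orbit (x \<circ> h \<circ> inv x) (x a) = x ` orbit h a"
proof (intro equalityI subsetI)
  fix y assume "y \<in> orbit (x \<circ> h \<circ> inv x) (x a)"
  then show "y \<in> x ` orbit h a"
  proof induction
    case base
    show ?case using assms by (auto simp: bij_is_inj orbit.base)
  next
    case (step y)
    then show ?case using assms by (auto simp: bij_is_inj orbit.step)
  qed
next
  have step: "x (h b) = (x \<circ> h \<circ> inv x) (x b)" for b using assms by (simp add: bij_is_inj)
  have *: "x b \<in> orbit (x \<circ> h \<circ> inv x) (x a)" if "b \<in> orbit h a" for b
    using that by induction (unfold step, (rule orbit.intros | assumption)+)
  fix y assume "y \<in> x ` orbit h a"
  with * show "y \<in> orbit (x \<circ> h \<circ> inv x) (x a)" by auto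
qed

lemma frobenius_value_conjugate:
  assumes "finite A" "x permutes A" "h permutes A"
  shows "frobenius_value k A (x \<circ> h \<circ> inv x) l = frobenius_value k A h l"
proof (rule frobenius_value_orbit_type)
  have perm: "x \<circ> h \<circ> inv x permutes A"
    using assms by (intro permutes_compose permutes_inv)
  then show "permutation (x \<circ> h \<circ> inv x)" "permutation h"
    using assms by (auto simp: permutation_permutes)
  show "(x \<circ> h \<circ> inv x) ` A \<subseteq> A" "h ` A \<subseteq> A"
    using permutes_image[OF perm] permutes_image[OF assms(3)] by auto
  have bx: "bij x" using assms by (simp add: permutes_bij)
  have "orbit (x \<circ> h \<circ> inv x) ` A = orbit (x \<circ> h \<circ> inv x) ` x ` A"
    using assms by (simp add: permutes_image)
  also have "\<dots> = (`) x ` orbit h ` A" by (simp add: image_image orbit_conjugate[OF bx])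
  finally have "image_mset card (mset_set (orbit (x \<circ> h \<circ> inv x) ` A)) =
      image_mset card (mset_set ((`) x ` orbit h ` A))" by simp
  also have "\<dots> = image_mset card (image_mset ((`) x) (mset_set (orbit h ` A)))"
    by (subst image_mset_mset_set) (use inj_image_eq_iff[OF bij_is_inj[OF bx]] in \<open>auto simp: inj_on_def\<close>)
  also have "\<dots> = image_mset card (mset_set (orbit h ` A))"
    unfolding multiset.map_comp using bx
    by (intro image_mset_cong) (auto simp: card_image inj_on_subset[OF bij_is_inj])
  finally show "image_mset card (mset_set (orbit (x \<circ> h \<circ> inv x) ` A)) =
      image_mset card (mset_set (orbit h ` A))" .
qed (use assms in auto)

lemma frobenius_value_inv:
  assumes "finite A" "h permutes A"
  shows "frobenius_value k A (inv h) l = frobenius_value k A h l"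
proof (rule frobenius_value_orbit_type)
  show "permutation (inv h)" "permutation h"
    using assms permutes_inv[OF assms(2)] by (auto simp: permutation_permutes)
  then have "orbit (inv h) = orbit h" by (auto simp: orbit_inv_eq)
  then show "image_mset card (mset_set (orbit (inv h) ` A)) = image_mset card (mset_set (orbit h ` A))"
    by simp
  show "inv h ` A \<subseteq> A" "h ` A \<subseteq> A"
    using permutes_image[OF permutes_inv[OF assms(2)]] permutes_image[OF assms(2)] by auto
qed (use assms in auto)

lemma card_less_eq_sum_fibres:
  fixes h :: "'a \<Rightarrow> nat"
  assumes "finite A"
  shows "card {x \<in> A. h x < j} = (\<Sum>i<j. card {x \<in> A. h x = i})"
proof (induction j)
  case (Suc j)
  have "{x \<in> A. h x < Suc j} = {x \<in> A. h x < j} \<union> {x \<in> A. h x = j}" by auto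
  also have "card \<dots> = card {x \<in> A. h x < j} + card {x \<in> A. h x = j}"
    using assms by (intro card_Un_disjoint) auto
  finally show ?case using Suc by simp
qed simp

lemma card_permutes_vimage:
  assumes "p permutes A"
  shows "card {x \<in> A. P (p x)} = card {x \<in> A. P x}"
proof (rule bij_betw_same_card[of p])
  have "p ` {x \<in> A. P (p x)} = {x \<in> A. P x}"
  proof (intro equalityI subsetI)
    fix y assume "y \<in> {x \<in> A. P x}"
    then show "y \<in> p ` {x \<in> A. P (p x)}"
      using permutes_inverses(1)[OF assms] permutes_in_image[OF permutes_inv[OF assms]]
      by (intro image_eqI[of _ _ "inv p y"]) auto
  qed (use permutes_in_image[OF assms] in auto)
  then show "bij_betw p {x \<in> A. P (p x)} {x \<in> A. P x}"
    using inj_on_subset[OF permutes_inj[OF assms]] by (auto simp: bij_betw_def)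
qed

lemma card_eq_sum_card_vimage:
  assumes "finite A"
  shows "card {x \<in> A. P x} = (\<Sum>c\<in>f ` A. card {x \<in> A. f x = c \<and> P x})"
proof -
  have "card {x \<in> A. P x} = (\<Sum>c\<in>f ` A. \<Sum>x | x \<in> {x \<in> A. P x} \<and> f x = c. 1)"
    using assms by (subst sum.group) auto
  also have "\<dots> = (\<Sum>c\<in>f ` A. card {x \<in> A. f x = c \<and> P x})"
    by (intro sum.cong refl) (auto intro!: arg_cong[where f = card])
  finally show ?thesis .
qed

section \<open>The Young symmetrizer\<close>

text \<open>A bijective filling of a Young diagram with rows of lengths \<open>L 0 \<ge> \<dots> \<ge> L (k - 1)\<close>
  by the numbers below \<open>d\<close>, given by the row and the column of each number.\<close>

locale filling =
  fixes d k :: nat and L row col :: "nat \<Rightarrow> nat"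
  assumes bij: "bij_betw (\<lambda>x. (row x, col x)) {..<d} {(i, j). i < k \<and> j < L i}"
    and decreasing: "\<And>i j. i \<le> j \<Longrightarrow> j < k \<Longrightarrow> L j \<le> L i"
begin

abbreviation "G \<equiv> {g. g permutes {..<d}}"

definition "R = {g. g permutes {..<d} \<and> (\<forall>x<d. row (g x) = row x)}"

definition "C = {g. g permutes {..<d} \<and> (\<forall>x<d. col (g x) = col x)}"

definition "column_injective h \<longleftrightarrow> (\<forall>x<d. \<forall>y<d. col x = col y \<longrightarrow> h x = h y \<longrightarrow> x = y)"
  for h :: "nat \<Rightarrow> nat"

section \<open>Dominance for colorings that are injective on columns\<close>

lemma row_col_less: "x < d \<Longrightarrow> row x < k \<and> col x < L (row x)"
  using bij by (auto simp: bij_betw_def)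

lemma row_col_inj: "x < d \<Longrightarrow> y < d \<Longrightarrow> row x = row y \<Longrightarrow> col x = col y \<Longrightarrow> x = y"
  using bij by (auto simp: bij_betw_def inj_on_def)

lemma row_col_surj: "i < k \<Longrightarrow> j < L i \<Longrightarrow> \<exists>x<d. row x = i \<and> col x = j"
proof -
  assume "i < k" "j < L i"
  then have "(i, j) \<in> (\<lambda>x. (row x, col x)) ` {..<d}" using bij by (auto simp: bij_betw_def)
  then show ?thesis by auto
qed

lemma card_row: "i < k \<Longrightarrow> card {x \<in> {..<d}. row x = i} = L i"
proof -
  assume i: "i < k"
  have "bij_betw col {x \<in> {..<d}. row x = i} {..<L i}"
    unfolding bij_betw_def
  proof
    show "inj_on col {x \<in> {..<d}. row x = i}"
      using row_col_inj by (auto simp: inj_on_def)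
    show "col ` {x \<in> {..<d}. row x = i} = {..<L i}"
      using row_col_less row_col_surj[OF i] by (auto simp: image_iff)
  qed
  then show ?thesis by (simp add: bij_betw_same_card)
qed

text \<open>If column \<open>c\<close> has a cell in row \<open>j\<close> or below, decreasing row
  lengths give it exactly \<open>j\<close> cells in the first \<open>j\<close> rows, while
  \<open>h\<close> can take at most \<open>j\<close> values below \<open>j\<close> on it. Otherwise
  the whole column lies in the first \<open>j\<close> rows.\<close>

lemma card_column_le:
  assumes "column_injective h"
  shows "card {x \<in> {..<d}. col x = c \<and> h x < j} \<le> card {x \<in> {..<d}. col x = c \<and> row x < j}"
proof (cases "\<exists>y<d. col y = c \<and> j \<le> row y")
  case True
  then obtain y where y: "y < d" "col y = c" "j \<le> row y" by auto
  have "card {x \<in> {..<d}. col x = c \<and> h x < j} \<le> card {..<j}"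
    using assms by (intro card_inj_on_le[of h]) (auto simp: inj_on_def column_injective_def)
  moreover have "card {..<j} \<le> card {x \<in> {..<d}. col x = c \<and> row x < j}"
  proof (rule surj_card_le[of _ _ row])
    show "{..<j} \<subseteq> row ` {x \<in> {..<d}. col x = c \<and> row x < j}"
    proof
      fix i assume "i \<in> {..<j}"
      then have "i < k" "c < L i" "i < j"
        using y row_col_less[of y] decreasing[of i "row y"] by auto
      with row_col_surj[of i c] show "i \<in> row ` {x \<in> {..<d}. col x = c \<and> row x < j}" by auto
    qed
  qed auto
  ultimately show ?thesis by simp
next
  case False
  then have "{x \<in> {..<d}. col x = c \<and> h x < j} \<subseteq> {x \<in> {..<d}. col x = c \<and> row x < j}"
    by (auto simp: not_le)
  then show ?thesis by (intro card_mono) auto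
qed

text \<open>Summing over columns shows that the content of \<open>h\<close> is dominated by the row
  lengths.\<close>

lemma column_injective_dominance:
  assumes "column_injective h"
  shows "card {x \<in> {..<d}. h x < j} \<le> card {x \<in> {..<d}. row x < j}"
  unfolding card_eq_sum_card_vimage[OF finite_lessThan, of d "\<lambda>x. h x < j" col]
    card_eq_sum_card_vimage[OF finite_lessThan, of d "\<lambda>x. row x < j" col]
  using card_column_le[OF assms] by (intro sum_mono)

text \<open>Equal contents force equality in the estimate for every single column. So
  \<open>h\<close> takes on each column the same values as \<open>row\<close>, each once, and
  differs from \<open>row\<close> by a permutation inside the columns.\<close>

lemma column_injective_imp_column_permutation:
  assumes h: "column_injective h"
    and content: "\<And>i. card {x \<in> {..<d}. h x = i} = card {x \<in> {..<d}. row x = i}"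
  shows "\<exists>q\<in>C. \<forall>x<d. h x = row (q x)"
proof -
  have less: "card {x \<in> {..<d}. col x = c \<and> h x < j} = card {x \<in> {..<d}. col x = c \<and> row x < j}"
    if c: "c \<in> col ` {..<d}" for c j
  proof (rule sum_mono_inv[OF _ card_column_le[OF h] c])
    have "card {x \<in> {..<d}. h x < j} = card {x \<in> {..<d}. row x < j}"
      unfolding card_less_eq_sum_fibres[OF finite_lessThan, of d h j]
        card_less_eq_sum_fibres[OF finite_lessThan, of d row j] by (intro sum.cong refl content)
    then show "(\<Sum>c\<in>col ` {..<d}. card {x \<in> {..<d}. col x = c \<and> h x < j}) =
        (\<Sum>c\<in>col ` {..<d}. card {x \<in> {..<d}. col x = c \<and> row x < j})"
      unfolding card_eq_sum_card_vimage[OF finite_lessThan, of d "\<lambda>x. h x < j" col]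
        card_eq_sum_card_vimage[OF finite_lessThan, of d "\<lambda>x. row x < j" col] .
  qed auto
  have split: "card {x \<in> {..<d}. col x = c \<and> f x < Suc j} =
      card {x \<in> {..<d}. col x = c \<and> f x < j} + card {x \<in> {..<d}. col x = c \<and> f x = j}"
    for c j and f :: "nat \<Rightarrow> nat"
  proof -
    have "{x \<in> {..<d}. col x = c \<and> f x < Suc j} =
      {x \<in> {..<d}. col x = c \<and> f x < j} \<union> {x \<in> {..<d}. col x = c \<and> f x = j}" by auto
    then show ?thesis by (simp only:) (rule card_Un_disjoint, auto)
  qed
  have ex: "\<exists>y<d. row y = h x \<and> col y = col x" if x: "x < d" for x
  proof -
    have "card {y \<in> {..<d}. col y = col x \<and> h y = h x} = card {y \<in> {..<d}. col y = col x \<and> row y = h x}"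
      using less[of "col x" "h x"] less[of "col x" "Suc (h x)"] split[of "col x" h "h x"]
        split[of "col x" row "h x"] x by simp
    moreover have "card {y \<in> {..<d}. col y = col x \<and> h y = h x} \<noteq> 0" using x by auto
    ultimately have "{y \<in> {..<d}. col y = col x \<and> row y = h x} \<noteq> {}" by (metis card.empty)
    then show ?thesis by auto
  qed
  define q where "q x = (if x < d then SOME y. y < d \<and> row y = h x \<and> col y = col x else x)" for x
  have q: "q x < d \<and> row (q x) = h x \<and> col (q x) = col x" if "x < d" for x
    using someI_ex[OF ex[OF that]] that by (simp add: q_def)
  have "inj_on q {..<d}"
  proof (rule inj_onI)
    fix x y assume "x \<in> {..<d}" "y \<in> {..<d}" "q x = q y"
    then have "h x = h y" "col x = col y" using q[of x] q[of y] by auto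
    then show "x = y" using h \<open>x \<in> _\<close> \<open>y \<in> _\<close> by (auto simp: column_injective_def)
  qed
  moreover have "q ` {..<d} \<subseteq> {..<d}" using q by auto
  ultimately have "bij_betw q {..<d} {..<d}" by (simp add: bij_betw_def endo_inj_surj)
  then have "q permutes {..<d}" by (rule bij_imp_permutes) (simp add: q_def)
  then show ?thesis using q by (auto simp: C_def intro!: bexI[of _ q])
qed

section \<open>Row group, column group and the Young symmetrizer\<close>

lemma G_less [simp]: "g permutes {..<d} \<Longrightarrow> g x < d \<longleftrightarrow> x < d"
  using permutes_in_image[of g "{..<d}" x] by simp

lemma R_G: "p \<in> R \<Longrightarrow> p permutes {..<d}" and C_G: "p \<in> C \<Longrightarrow> p permutes {..<d}"
  by (auto simp: R_def C_def)

lemma finite_R: "finite R" and finite_C: "finite C"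
  by (auto simp: R_def C_def intro!: finite_subset[OF _ finite_permutations[of "{..<d}"]])

lemma id_R: "id \<in> R" and id_C: "id \<in> C"
  by (auto simp: R_def C_def permutes_id)

lemma comp_R: "p \<in> R \<Longrightarrow> q \<in> R \<Longrightarrow> p \<circ> q \<in> R"
  by (auto simp: R_def intro: permutes_compose)

lemma comp_C: "p \<in> C \<Longrightarrow> q \<in> C \<Longrightarrow> p \<circ> q \<in> C"
  by (auto simp: C_def intro: permutes_compose)

lemma inv_R: "p \<in> R \<Longrightarrow> inv p \<in> R"
proof -
  assume p: "p \<in> R"
  then have i: "inv p permutes {..<d}" by (simp add: R_def permutes_inv)
  moreover have "row (inv p x) = row x" if "x < d" for x
  proof -
    have "row (p (inv p x)) = row (inv p x)" using p that i by (simp add: R_def)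
    then show ?thesis using permutes_inverses(1)[OF R_G[OF p]] by simp
  qed
  ultimately show ?thesis by (simp add: R_def)
qed

lemma inv_C: "p \<in> C \<Longrightarrow> inv p \<in> C"
proof -
  assume p: "p \<in> C"
  then have i: "inv p permutes {..<d}" by (simp add: C_def permutes_inv)
  moreover have "col (inv p x) = col x" if "x < d" for x
  proof -
    have "col (p (inv p x)) = col (inv p x)" using p that i by (simp add: C_def)
    then show ?thesis using permutes_inverses(1)[OF C_G[OF p]] by simp
  qed
  ultimately show ?thesis by (simp add: C_def)
qed

lemma R_C_eq_id:
  assumes "p \<in> R" "p \<in> C"
  shows "p = id"
proof
  fix x
  show "p x = id x"
  proof (cases "x < d")
    case True
    then show ?thesis using assms row_col_inj[of "p x" x] by (auto simp: R_def C_def)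
  next
    case False
    then show ?thesis using R_G[OF assms(1)] by (simp add: permutes_def)
  qed
qed

lemma G_inv_comp [simp]:
  assumes "g permutes {..<d}"
  shows "inv g \<circ> g = id" "g \<circ> inv g = id" "inv g \<circ> (g \<circ> x) = x" "g \<circ> (inv g \<circ> x) = x" "inv (inv g) = g"
  using permutes_inv_o[OF assms] by (simp_all add: comp_assoc[symmetric] permutes_inv_inv[OF assms])

lemma G_inv_comp_distrib [simp]:
  assumes "g permutes {..<d}" "h permutes {..<d}"
  shows "inv (g \<circ> h) = inv h \<circ> inv g"
  using assms by (simp add: o_inv_distrib permutes_bij)

lemma comp_eq_iff:
  assumes "g permutes {..<d}"
  shows "g \<circ> x = g \<circ> y \<longleftrightarrow> x = y" "x \<circ> g = y \<circ> g \<longleftrightarrow> x = y"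
  by (metis G_inv_comp(3)[OF assms], metis G_inv_comp(2)[OF assms] comp_assoc comp_id)

lemma sign_comp: "g permutes {..<d} \<Longrightarrow> h permutes {..<d} \<Longrightarrow> sign (g \<circ> h) = sign g * sign h"
  by (rule sign_compose) (auto simp: permutation_permutes)

lemma sign_inv: "g permutes {..<d} \<Longrightarrow> sign (inv g) = sign g"
  by (rule sign_inverse) (auto simp: permutation_permutes)

lemma sum_C_left: "q \<in> C \<Longrightarrow> (\<Sum>x\<in>C. F x) = (\<Sum>x\<in>C. F (q \<circ> x))" for F :: "_ \<Rightarrow> int"
  by (rule sum.reindex_bij_witness[of _ "\<lambda>x. q \<circ> x" "\<lambda>x. inv q \<circ> x"])
    (auto simp: comp_C inv_C C_G permutes_inv)

lemma sum_C_inv: "(\<Sum>x\<in>C. F x) = (\<Sum>x\<in>C. F (inv x))" for F :: "_ \<Rightarrow> int"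
  by (rule sum.reindex_bij_witness[of _ inv inv]) (auto simp: inv_C C_G)

lemma sum_R_inv: "(\<Sum>x\<in>R. F x) = (\<Sum>x\<in>R. F (inv x))" for F :: "_ \<Rightarrow> int"
  by (rule sum.reindex_bij_witness[of _ inv inv]) (auto simp: inv_R R_G)

lemma sum_G_left: "y permutes {..<d} \<Longrightarrow> (\<Sum>x\<in>G. F x) = (\<Sum>x\<in>G. F (y \<circ> x))" for F :: "_ \<Rightarrow> int"
  by (rule setum_permutations_compose_left)

lemma sum_G_right: "y permutes {..<d} \<Longrightarrow> (\<Sum>x\<in>G. F x) = (\<Sum>x\<in>G. F (x \<circ> y))" for F :: "_ \<Rightarrow> int"
  by (rule sum_permutations_compose_right)

text \<open>The coefficients are taken in the integers, where sums of squares can be compared with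
  0; \<open>sym_fun\<close> is the complex version.\<close>

definition symmetrizer :: "(nat \<Rightarrow> nat) \<Rightarrow> int" where
  "symmetrizer x = (\<Sum>p\<in>R. \<Sum>q\<in>C. sign q * of_bool (x = p \<circ> q))"

lemma symmetrizer_altdef:
  "symmetrizer x = (\<Sum>q\<in>C. sign q * of_bool (x \<circ> inv q \<in> R))"
proof -
  have "symmetrizer x = (\<Sum>q\<in>C. \<Sum>p\<in>R. sign q * of_bool (x = p \<circ> q))"
    unfolding symmetrizer_def by (rule sum.swap)
  also have "\<dots> = (\<Sum>q\<in>C. sign q * of_bool (x \<circ> inv q \<in> R))"
  proof (rule sum.cong[OF refl])
    fix q assume q: "q \<in> C"
    have "x = p \<circ> q \<longleftrightarrow> p = x \<circ> inv q" for p
      using C_G[OF q] by (auto simp: comp_assoc)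
    then have "(\<Sum>p\<in>R. of_bool (x = p \<circ> q)) = (\<Sum>p\<in>R. if p = x \<circ> inv q then 1 else (0::int))"
      by (intro sum.cong) auto
    also have "\<dots> = of_bool (x \<circ> inv q \<in> R)" using finite_R by (subst sum.delta) auto
    finally show "(\<Sum>p\<in>R. sign q * of_bool (x = p \<circ> q)) = sign q * of_bool (x \<circ> inv q \<in> R)"
      by (simp only: sum_distrib_left[symmetric])
  qed
  finally show ?thesis .
qed

lemma symmetrizer_comp_left:
  assumes "p \<in> R"
  shows "symmetrizer (p \<circ> x) = symmetrizer x"
proof -
  have "p \<circ> x \<circ> inv q \<in> R \<longleftrightarrow> x \<circ> inv q \<in> R" for q
    using comp_R[OF assms, of "x \<circ> inv q"] comp_R[OF inv_R[OF assms], of "p \<circ> (x \<circ> inv q)"] R_G[OF assms]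
    by (auto simp: comp_assoc)
  then show ?thesis by (simp add: symmetrizer_altdef)
qed

lemma symmetrizer_comp_right:
  assumes "q \<in> C"
  shows "symmetrizer (x \<circ> q) = sign q * symmetrizer x"
proof -
  have "symmetrizer (x \<circ> q) = (\<Sum>h\<in>C. sign (inv h) * of_bool (x \<circ> q \<circ> h \<in> R))"
    unfolding symmetrizer_altdef by (subst sum_C_inv) (simp add: C_G)
  also have "\<dots> = (\<Sum>h\<in>C. sign (inv (inv q \<circ> h)) * of_bool (x \<circ> h \<in> R))"
    using assms by (subst sum_C_left[OF inv_C[OF assms]]) (simp add: C_G comp_assoc)
  also have "\<dots> = (\<Sum>h\<in>C. sign q * (sign (inv h) * of_bool (x \<circ> h \<in> R)))"
  proof (rule sum.cong[OF refl])
    fix h assume "h \<in> C"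
    then show "sign (inv (inv q \<circ> h)) * of_bool (x \<circ> h \<in> R) = sign q * (sign (inv h) * of_bool (x \<circ> h \<in> R))"
      using assms by (simp add: sign_comp sign_inv C_G permutes_inv)
  qed
  also have "\<dots> = sign q * symmetrizer x"
    unfolding symmetrizer_altdef sum_distrib_left[symmetric] by (subst sum_C_inv) (simp add: C_G)
  finally show ?thesis .
qed

text \<open>Row and column group meet only in the identity, so the identity has a single
  factorization as a row permutation times a column permutation.\<close>

lemma symmetrizer_id: "symmetrizer id = 1"
proof -
  have "symmetrizer id = (\<Sum>q\<in>C. if q = id then 1 else 0)"
    unfolding symmetrizer_altdef
  proof (rule sum.cong[OF refl])
    fix q assume q: "q \<in> C"
    have "q = id" if "inv q \<in> R"
    proof -
      have "inv q = id" using that q by (intro R_C_eq_id inv_C)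
      then show ?thesis using G_inv_comp(5)[OF C_G[OF q]] by simp
    qed
    then show "sign q * of_bool (id \<circ> inv q \<in> R) = (if q = id then 1 else 0)"
      by (auto simp: sign_id id_R)
  qed
  then show ?thesis using finite_C id_C by simp
qed

lemma symmetrizer_R: "p \<in> R \<Longrightarrow> symmetrizer p = 1"
  using symmetrizer_comp_left[of p id] by (simp add: symmetrizer_id)

lemma symmetrizer_outside:
  assumes "\<not> x permutes {..<d}"
  shows "symmetrizer x = 0"
  unfolding symmetrizer_def using assms
  by (intro sum.neutral ballI) (auto dest!: R_G C_G intro: permutes_compose)

lemma sum_symmetrizer_mult:
  fixes F :: "(nat \<Rightarrow> nat) \<Rightarrow> int"
  shows "(\<Sum>x\<in>G. symmetrizer x * F x) = (\<Sum>p\<in>R. \<Sum>q\<in>C. sign q * F (p \<circ> q))"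
proof -
  have "(\<Sum>x\<in>G. symmetrizer x * F x) = (\<Sum>x\<in>G. \<Sum>p\<in>R. \<Sum>q\<in>C. if p \<circ> q = x then sign q * F x else 0)"
    unfolding symmetrizer_def sum_distrib_right by (intro sum.cong refl) auto
  also have "\<dots> = (\<Sum>p\<in>R. \<Sum>q\<in>C. \<Sum>x\<in>G. if p \<circ> q = x then sign q * F x else 0)"
    by (simp only: sum.swap[of _ _ G])
  also have "\<dots> = (\<Sum>p\<in>R. \<Sum>q\<in>C. sign q * F (p \<circ> q))"
  proof (rule sum.cong[OF refl], rule sum.cong[OF refl])
    fix p q assume "p \<in> R" "q \<in> C"
    then have "p \<circ> q \<in> G" using R_G C_G by (auto intro: permutes_compose)
    then show "(\<Sum>x\<in>G. if p \<circ> q = x then sign q * F x else 0) = sign q * F (p \<circ> q)"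
      by (subst sum.delta') (auto simp: finite_permutations)
  qed
  finally show ?thesis .
qed

lemma not_column_injective_transpose:
  assumes "\<not> column_injective h"
  obtains y z where "y < d" "z < d" "y \<noteq> z" "h y = h z" "transpose y z \<in> C"
proof -
  obtain y z where yz: "y < d" "z < d" "col y = col z" "h y = h z" "y \<noteq> z"
    using assms by (auto simp: column_injective_def)
  then have "transpose y z \<in> C" by (auto simp: C_def transpose_def intro!: permutes_swap_id)
  with yz that show ?thesis by blast
qed

text \<open>If the rows of the images under \<open>x\<close> are distinct on each column,
  \<open>x\<close> is a row permutation times a column permutation and the two symmetries determine
  \<open>f x\<close> from \<open>f id\<close>. Otherwise some transposition \<open>t\<close> in
  \<open>C\<close> has its conjugate by \<open>x\<close> in \<open>R\<close>, and evaluating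
  \<open>f\<close> at \<open>x \<circ> t\<close> in both ways gives \<open>f x = - f x\<close>. The
  same argument applied to \<open>symmetrizer\<close> yields the comparison.\<close>

lemma eq_scaled_symmetrizer:
  fixes f :: "(nat \<Rightarrow> nat) \<Rightarrow> int"
  assumes left: "\<And>p x. p \<in> R \<Longrightarrow> x permutes {..<d} \<Longrightarrow> f (p \<circ> x) = f x"
    and right: "\<And>q x. q \<in> C \<Longrightarrow> x permutes {..<d} \<Longrightarrow> f (x \<circ> q) = sign q * f x"
    and x: "x permutes {..<d}"
  shows "f x = f id * symmetrizer x"
proof (cases "column_injective (\<lambda>y. row (x y))")
  case True
  have "card {y \<in> {..<d}. row (x y) = i} = card {y \<in> {..<d}. row y = i}" for i
    using card_permutes_vimage[OF x, of "\<lambda>y. row y = i"] .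
  from column_injective_imp_column_permutation[OF True this]
  obtain q where q: "q \<in> C" "\<And>y. y < d \<Longrightarrow> row (x y) = row (q y)" by auto
  have "x \<circ> inv q \<in> R"
  proof -
    have "row (x (inv q y)) = row y" if "y < d" for y
      using q(2)[of "inv q y"] that permutes_inverses[OF C_G[OF q(1)]] permutes_inv[OF C_G[OF q(1)]] by simp
    then show ?thesis using x permutes_inv[OF C_G[OF q(1)]] by (auto simp: R_def intro: permutes_compose)
  qed
  moreover have "x = (x \<circ> inv q) \<circ> (id \<circ> q)" using C_G[OF q(1)] by (simp add: comp_assoc)
  moreover note q(1)
  ultimately have eq: "g x = sign q * g id"
    if "\<And>p x. p \<in> R \<Longrightarrow> x permutes {..<d} \<Longrightarrow> g (p \<circ> x) = g x"
      "\<And>q x. q \<in> C \<Longrightarrow> x permutes {..<d} \<Longrightarrow> g (x \<circ> q) = sign q * g x" for g :: "_ \<Rightarrow> int"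
    using that(1)[of "x \<circ> inv q" "id \<circ> q"] that(2)[of q id] q(1) C_G[OF q(1)] permutes_id[of "{..<d}"]
    by (metis id_comp)
  have "symmetrizer x = sign q * symmetrizer id"
    by (rule eq[of symmetrizer]) (simp_all only: symmetrizer_comp_left symmetrizer_comp_right)
  moreover have "f x = sign q * f id" by (rule eq[OF left right])
  ultimately show ?thesis by (simp add: symmetrizer_id)
next
  case False
  then obtain y z where yz: "y < d" "z < d" "y \<noteq> z" "row (x y) = row (x z)" and t: "transpose y z \<in> C"
    by (rule not_column_injective_transpose)
  have t': "transpose (x y) (x z) \<in> R"
    using yz x by (auto simp: R_def transpose_def intro!: permutes_swap_id)
  have "x \<circ> transpose y z = transpose (x y) (x z) \<circ> x"
    using permutes_inj[OF x] by (auto simp: fun_eq_iff transpose_def inj_def)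
  then have zero: "g x = 0"
    if "\<And>p x. p \<in> R \<Longrightarrow> x permutes {..<d} \<Longrightarrow> g (p \<circ> x) = g x"
      "\<And>q x. q \<in> C \<Longrightarrow> x permutes {..<d} \<Longrightarrow> g (x \<circ> q) = sign q * g x" for g :: "_ \<Rightarrow> int"
    using that(1)[OF t' x] that(2)[OF t x] yz(3) by (simp add: sign_swap_id)
  have "symmetrizer x = 0"
    by (rule zero[of symmetrizer]) (simp_all only: symmetrizer_comp_left symmetrizer_comp_right)
  moreover have "f x = 0" by (rule zero[OF left right])
  ultimately show ?thesis by simp
qed

text \<open>The scalar n in c * c = n c, where c is the Young symmetrizer, read off at the identity,
  where c has coefficient 1. Classically it is d! divided by the dimension of the Specht
  module.\<close>

definition "norm_const = (\<Sum>y\<in>G. symmetrizer y * symmetrizer (inv y))"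

text \<open>The left side is the coefficient of \<open>z\<close> in the product c x c, with c the
  Young symmetrizer. That product inherits invariance under \<open>R\<close> from its left factor
  and the sign rule under \<open>C\<close> from its right factor, so it is a multiple of c.\<close>

lemma symmetrizer_sandwich:
  assumes x: "x permutes {..<d}" and z: "z permutes {..<d}"
  shows "(\<Sum>y\<in>G. symmetrizer y * symmetrizer (inv x \<circ> inv y \<circ> z)) =
    (\<Sum>y\<in>G. symmetrizer y * symmetrizer (inv x \<circ> inv y)) * symmetrizer z"
proof -
  let ?f = "\<lambda>z. \<Sum>y\<in>G. symmetrizer y * symmetrizer (inv x \<circ> inv y \<circ> z)"
  have "?f z = ?f id * symmetrizer z"
  proof (rule eq_scaled_symmetrizer[OF _ _ z])
    fix p z assume p: "p \<in> R" and "z permutes {..<d}"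
    have "?f (p \<circ> z) = (\<Sum>y\<in>G. symmetrizer (p \<circ> y) * symmetrizer (inv x \<circ> inv (p \<circ> y) \<circ> (p \<circ> z)))"
      using R_G[OF p] by (rule sum_G_left)
    also have "\<dots> = ?f z"
      using R_G[OF p] by (intro sum.cong refl) (simp add: symmetrizer_comp_left[OF p] comp_assoc)
    finally show "?f (p \<circ> z) = ?f z" .
  next
    fix q z assume "q \<in> C" "z permutes {..<d}"
    then show "?f (z \<circ> q) = sign q * ?f z"
      by (simp add: comp_assoc[symmetric] symmetrizer_comp_right sum_distrib_left mult_ac)
  qed
  then show ?thesis by simp
qed

lemma symmetrizer_convolution:
  assumes "z permutes {..<d}"
  shows "(\<Sum>y\<in>G. symmetrizer y * symmetrizer (inv y \<circ> z)) = norm_const * symmetrizer z"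
  using symmetrizer_sandwich[OF permutes_id assms] by (simp add: norm_const_def)

text \<open>Positivity: with \<open>a\<close> and \<open>b\<close> the row and the signed column sum, \<open>aba\<close> is invariant under
  inversion, so the coefficient of the identity in \<open>(aba)\<^sup>2\<close> is a sum of squares; it equals
  \<open>(card R)\<^sup>2 * norm_const\<close>.\<close>

lemma norm_const_pos: "norm_const > 0"
proof -
  define e where "e x = (\<Sum>p\<in>R. symmetrizer (x \<circ> p))" for x
  have einv: "e (inv x) = e x" if x: "x permutes {..<d}" for x
  proof -
    have "e (inv x) = (\<Sum>p\<in>R. \<Sum>r\<in>R. \<Sum>q\<in>C. sign q * of_bool (inv x \<circ> p = r \<circ> q))"
      by (simp add: e_def symmetrizer_def)
    also have "\<dots> = (\<Sum>r\<in>R. \<Sum>p\<in>R. \<Sum>q\<in>C. sign q * of_bool (inv x \<circ> p = r \<circ> q))"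
      by (rule sum.swap)
    also have "\<dots> = (\<Sum>r\<in>R. \<Sum>p\<in>R. \<Sum>q\<in>C. sign (inv q) * of_bool (inv x \<circ> p = r \<circ> inv q))"
      by (subst sum_C_inv) simp
    also have "\<dots> = (\<Sum>r\<in>R. \<Sum>p\<in>R. \<Sum>q\<in>C. sign q * of_bool (x \<circ> r = p \<circ> q))"
    proof (intro sum.cong refl arg_cong2[where f = "(*)"] arg_cong[where f = of_bool])
      fix r p q assume "r \<in> R" "p \<in> R" and q: "q \<in> C"
      show "sign (inv q) = sign q" using C_G[OF q] by (rule sign_inv)
      have "inv x \<circ> p = r \<circ> inv q \<longleftrightarrow> x \<circ> (inv x \<circ> p) \<circ> q = x \<circ> (r \<circ> inv q) \<circ> q"
        by (simp only: comp_eq_iff(1)[OF x] comp_eq_iff(2)[OF C_G[OF q]])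
      then show "(inv x \<circ> p = r \<circ> inv q) = (x \<circ> r = p \<circ> q)"
        using x C_G[OF q] by (auto simp: comp_assoc)
    qed
    also have "\<dots> = e x" by (simp add: e_def symmetrizer_def)
    finally show ?thesis .
  qed
  have "(\<Sum>x\<in>G. e x * e x) = (\<Sum>x\<in>G. e x * e (inv x))"
    by (intro sum.cong refl) (simp add: einv)
  also have "\<dots> = (\<Sum>p\<in>R. \<Sum>r\<in>R. \<Sum>x\<in>G. symmetrizer (x \<circ> p) * symmetrizer (inv x \<circ> r))"
    unfolding e_def sum_product by (simp only: sum.swap[of _ _ G])
  also have "\<dots> = (\<Sum>p\<in>R. \<Sum>r\<in>R. norm_const)"
  proof (rule sum.cong[OF refl], rule sum.cong[OF refl])
    fix p r assume p: "p \<in> R" and r: "r \<in> R"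
    have "(\<Sum>x\<in>G. symmetrizer (x \<circ> p) * symmetrizer (inv x \<circ> r)) =
      (\<Sum>x\<in>G. symmetrizer ((x \<circ> inv p) \<circ> p) * symmetrizer (inv (x \<circ> inv p) \<circ> r))"
      using permutes_inv[OF R_G[OF p]] by (rule sum_G_right)
    also have "\<dots> = (\<Sum>x\<in>G. symmetrizer x * symmetrizer (inv x \<circ> r))"
      using R_G[OF p] permutes_inv[OF R_G[OF p]]
      by (intro sum.cong refl) (simp add: comp_assoc symmetrizer_comp_left[OF p])
    also have "\<dots> = norm_const" using symmetrizer_convolution[OF R_G[OF r]] symmetrizer_R[OF r] by simp
    finally show "(\<Sum>x\<in>G. symmetrizer (x \<circ> p) * symmetrizer (inv x \<circ> r)) = norm_const" .
  qed
  finally have eq: "(\<Sum>x\<in>G. e x * e x) = int (card R) * int (card R) * norm_const" by simp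
  have "card R > 0" using finite_R id_R by (auto simp: card_gt_0_iff)
  have "e id = int (card R)" by (simp add: e_def symmetrizer_R)
  then have "0 < e id * e id" using \<open>card R > 0\<close> by simp
  also have "\<dots> \<le> (\<Sum>x\<in>G. e x * e x)"
    by (rule member_le_sum[of id G "\<lambda>x. e x * e x"]) (auto simp: finite_permutations permutes_id)
  finally have "0 < int (card R) * int (card R) * norm_const" using eq by simp
  then show ?thesis by (simp add: zero_less_mult_iff)
qed

text \<open>Divided by \<open>norm_const\<close> this is the trace of \<open>left_mult g\<close> on
  the left ideal generated by the symmetrizer. The inverse of \<open>g\<close> appears because a
  group element acts on functions through its inverse.\<close>

definition "class_average g = (\<Sum>x\<in>G. symmetrizer (inv x \<circ> inv g \<circ> x))"

lemma class_average_conjugate: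
  assumes "y permutes {..<d}" "g permutes {..<d}"
  shows "class_average (y \<circ> g \<circ> inv y) = class_average g"
proof -
  have "class_average (y \<circ> g \<circ> inv y) = (\<Sum>x\<in>G. symmetrizer (inv (y \<circ> x) \<circ> inv (y \<circ> g \<circ> inv y) \<circ> (y \<circ> x)))"
    unfolding class_average_def by (rule sum_G_left[OF assms(1)])
  also have "\<dots> = class_average g"
    unfolding class_average_def using assms permutes_inv[OF assms(1)]
    by (intro sum.cong refl) (simp add: comp_assoc permutes_compose)
  finally show ?thesis .
qed

text \<open>The symmetrizer itself is not invariant under inversion: the inverse of
  \<open>p \<circ> q\<close> has its column factor on the left. Conjugating by \<open>p\<close>
  swaps the two factors, and the sum over all conjugates does not notice this.\<close>

lemma class_average_inv:
  assumes g: "g permutes {..<d}"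
  shows "class_average (inv g) = class_average g"
proof -
  have "class_average (inv g) = (\<Sum>x\<in>G. \<Sum>p\<in>R. \<Sum>q\<in>C. sign q * of_bool (inv x \<circ> g \<circ> x = p \<circ> q))"
    using g by (simp add: class_average_def symmetrizer_def)
  also have "\<dots> = (\<Sum>p\<in>R. \<Sum>q\<in>C. \<Sum>x\<in>G. sign q * of_bool (inv x \<circ> g \<circ> x = p \<circ> q))"
    by (simp only: sum.swap[of _ _ G])
  also have "\<dots> = (\<Sum>p\<in>R. \<Sum>q\<in>C. \<Sum>x\<in>G. sign q * of_bool (inv x \<circ> inv g \<circ> x = inv p \<circ> inv q))"
  proof (rule sum.cong[OF refl], rule sum.cong[OF refl])
    fix p q assume pR: "p \<in> R" and qC: "q \<in> C"
    note p = R_G[OF pR] and q = C_G[OF qC]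
    \<comment> \<open>Replacing \<open>x\<close> by \<open>x \<circ> inv p\<close> carries out the
      conjugation that turns \<open>p \<circ> q\<close> into \<open>q \<circ> p\<close>, whose
      inverse has the required order of factors.\<close>
    have "(\<Sum>x\<in>G. sign q * of_bool (inv x \<circ> g \<circ> x = p \<circ> q)) =
      (\<Sum>x\<in>G. sign q * of_bool (inv (x \<circ> inv p) \<circ> g \<circ> (x \<circ> inv p) = p \<circ> q))"
      using permutes_inv[OF p] by (rule sum_G_right)
    also have "\<dots> = (\<Sum>x\<in>G. sign q * of_bool (inv x \<circ> inv g \<circ> x = inv p \<circ> inv q))"
    proof (intro sum.cong refl arg_cong2[where f = "(*)"] arg_cong[where f = of_bool])
      fix x assume "x \<in> G"
      then have x: "x permutes {..<d}" by simp
      have "inv (x \<circ> inv p) \<circ> g \<circ> (x \<circ> inv p) = p \<circ> q \<longleftrightarrow> p \<circ> (inv x \<circ> g \<circ> x) \<circ> inv p = p \<circ> (q \<circ> p) \<circ> inv p"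
        using x p permutes_inv[OF p] by (simp add: comp_assoc)
      also have "\<dots> \<longleftrightarrow> inv x \<circ> g \<circ> x = q \<circ> p"
        by (simp only: comp_eq_iff(1)[OF p] comp_eq_iff(2)[OF permutes_inv[OF p]])
      also have "\<dots> \<longleftrightarrow> inv (inv x \<circ> g \<circ> x) = inv (q \<circ> p)"
        by (metis G_inv_comp(5) g p permutes_compose permutes_inv q x)
      also have "inv (inv x \<circ> g \<circ> x) = inv x \<circ> inv g \<circ> x"
        using x g permutes_inv[OF x] by (simp add: comp_assoc permutes_compose)
      also have "inv (q \<circ> p) = inv p \<circ> inv q" using p q by simp
      finally show "(inv (x \<circ> inv p) \<circ> g \<circ> (x \<circ> inv p) = p \<circ> q) = (inv x \<circ> inv g \<circ> x = inv p \<circ> inv q)" .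
    qed
    finally show "(\<Sum>x\<in>G. sign q * of_bool (inv x \<circ> g \<circ> x = p \<circ> q)) =
      (\<Sum>x\<in>G. sign q * of_bool (inv x \<circ> inv g \<circ> x = inv p \<circ> inv q))" .
  qed
  also have "\<dots> = (\<Sum>p\<in>R. \<Sum>q\<in>C. \<Sum>x\<in>G. sign q * of_bool (inv x \<circ> inv g \<circ> x = p \<circ> q))"
    by (subst (2) sum_R_inv, subst (2) sum_C_inv) (simp add: sign_inv C_G)
  also have "\<dots> = (\<Sum>x\<in>G. \<Sum>p\<in>R. \<Sum>q\<in>C. sign q * of_bool (inv x \<circ> inv g \<circ> x = p \<circ> q))"
    by (simp only: sum.swap[of _ _ G])
  finally show ?thesis by (simp add: class_average_def symmetrizer_def)
qed

text \<open>The averaging can be shifted onto \<open>F\<close>, where all d! conjugations act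
  trivially. Invariance of \<open>F\<close> under inversion absorbs the inverse in
  \<open>class_average\<close>.\<close>

lemma sum_class_average_mult:
  fixes F :: "(nat \<Rightarrow> nat) \<Rightarrow> int"
  assumes "\<And>x g. x permutes {..<d} \<Longrightarrow> g permutes {..<d} \<Longrightarrow> F (x \<circ> g \<circ> inv x) = F g"
    and "\<And>g. g permutes {..<d} \<Longrightarrow> F (inv g) = F g"
  shows "(\<Sum>g\<in>G. class_average g * F g) = fact d * (\<Sum>h\<in>G. symmetrizer h * F h)"
proof -
  have "(\<Sum>g\<in>G. class_average g * F g) = (\<Sum>g\<in>G. class_average (inv g) * F (inv g))"
    by (rule sum_permutations_inverse)
  also have "\<dots> = (\<Sum>g\<in>G. \<Sum>x\<in>G. symmetrizer (inv x \<circ> g \<circ> x) * F g)"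
    by (intro sum.cong refl) (simp add: assms class_average_def sum_distrib_right)
  also have "\<dots> = (\<Sum>x\<in>G. \<Sum>g\<in>G. symmetrizer (inv x \<circ> g \<circ> x) * F g)"
    by (rule sum.swap)
  also have "\<dots> = (\<Sum>x\<in>G. \<Sum>h\<in>G. symmetrizer h * F h)"
  proof (rule sum.cong[OF refl])
    fix x assume "x \<in> G"
    then have x: "x permutes {..<d}" by simp
    have "(\<Sum>g\<in>G. symmetrizer (inv x \<circ> g \<circ> x) * F g) =
      (\<Sum>g\<in>G. symmetrizer (inv x \<circ> (x \<circ> g) \<circ> x) * F (x \<circ> g))"
      by (rule sum_G_left[OF x])
    also have "\<dots> = (\<Sum>g\<in>G. symmetrizer (inv x \<circ> (x \<circ> (g \<circ> inv x)) \<circ> x) * F (x \<circ> (g \<circ> inv x)))"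
      by (rule sum_G_right[OF permutes_inv[OF x]])
    also have "\<dots> = (\<Sum>h\<in>G. symmetrizer h * F h)"
      using x assms(1) by (intro sum.cong refl) (simp add: comp_assoc)
    finally show "(\<Sum>g\<in>G. symmetrizer (inv x \<circ> g \<circ> x) * F g) = (\<Sum>h\<in>G. symmetrizer h * F h)" .
  qed
  also have "\<dots> = fact d * (\<Sum>h\<in>G. symmetrizer h * F h)"
    by (simp add: card_permutations)
  finally show ?thesis .
qed

text \<open>Unfolding one average leaves the coefficients of \<open>x\<close> in c x c, with c the
  Young symmetrizer. The sandwich identity makes each product a multiple of c, and then c * c = n c
  applies; one factor n comes from that and one from the remaining sum. This gives the trace
  character norm 1.\<close>

lemma sum_class_average_square:
  "(\<Sum>g\<in>G. class_average g * class_average g) = fact d * norm_const\<^sup>2"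
proof -
  have "(\<Sum>h\<in>G. symmetrizer h * class_average h) =
    (\<Sum>x\<in>G. \<Sum>h\<in>G. symmetrizer h * symmetrizer (inv x \<circ> inv h \<circ> x))"
    unfolding class_average_def sum_distrib_left by (rule sum.swap)
  also have "\<dots> = (\<Sum>x\<in>G. (\<Sum>y\<in>G. symmetrizer y * symmetrizer (inv x \<circ> inv y)) * symmetrizer x)"
    by (intro sum.cong refl symmetrizer_sandwich) auto
  also have "\<dots> = (\<Sum>y\<in>G. \<Sum>x\<in>G. symmetrizer y * (symmetrizer x * symmetrizer (inv x \<circ> inv y)))"
    unfolding sum_distrib_right by (subst sum.swap) (simp add: mult_ac)
  also have "\<dots> = (\<Sum>y\<in>G. symmetrizer y * (norm_const * symmetrizer (inv y)))"
    unfolding sum_distrib_left[symmetric]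
    by (intro sum.cong refl arg_cong2[where f = "(*)"] symmetrizer_convolution) (auto intro: permutes_inv)
  also have "\<dots> = norm_const * norm_const"
    by (simp add: norm_const_def sum_distrib_left mult_ac)
  finally show ?thesis
    by (subst sum_class_average_mult) (auto simp: class_average_conjugate class_average_inv power2_eq_square)
qed

end

section \<open>The symmetrizer tested against coloring counts\<close>

context filling
begin

lemma card_row_less: "j \<le> k \<Longrightarrow> card {x \<in> {..<d}. row x < j} = (\<Sum>i<j. L i)"
  unfolding card_less_eq_sum_fibres[OF finite_lessThan, of d row j]
  by (intro sum.cong refl card_row) auto

lemma sum_rows: "(\<Sum>i<k. L i) = d"
proof -
  have "{x \<in> {..<d}. row x < k} = {..<d}" using row_col_less by auto
  then show ?thesis using card_row_less[of k] by simp
qed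

definition "content \<alpha> = {f \<in> {..<d} \<rightarrow>\<^sub>E {..<k}. \<forall>i<k. int (card {x \<in> {..<d}. f x = i}) = \<alpha> i}"

lemma finite_content: "finite (content \<alpha>)"
  unfolding content_def by (rule finite_subset[OF _ finite_PiE[of "{..<d}" "\<lambda>_. {..<k}"]]) auto

text \<open>The sum over the column group is put innermost, because for fixed \<open>p\<close> and
  \<open>f\<close> it cancels unless \<open>f \<circ> p\<close> is injective on columns.\<close>

lemma sum_symmetrizer_coloring:
  "(\<Sum>h\<in>G. symmetrizer h * coloring_count k {..<d} h \<alpha>) =
   (\<Sum>p\<in>R. \<Sum>f\<in>content \<alpha>. \<Sum>q\<in>C. sign q * of_bool (\<forall>x<d. f (p (q x)) = f x))"
proof -
  have "coloring_count k {..<d} h \<alpha> = (\<Sum>f\<in>content \<alpha>. of_bool (\<forall>x<d. f (h x) = f x))" for h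
  proof -
    have "colorings k {..<d} h \<alpha> = content \<alpha> \<inter> {f. \<forall>x<d. f (h x) = f x}"
      by (auto simp: colorings_def content_def)
    then show ?thesis using finite_content[of \<alpha>] by (simp add: coloring_count_def)
  qed
  then have "(\<Sum>h\<in>G. symmetrizer h * coloring_count k {..<d} h \<alpha>) =
    (\<Sum>p\<in>R. \<Sum>q\<in>C. \<Sum>f\<in>content \<alpha>. sign q * of_bool (\<forall>x<d. f (p (q x)) = f x))"
    by (simp only: sum_symmetrizer_mult comp_apply) (simp only: sum_distrib_left)
  also have "\<dots> = (\<Sum>p\<in>R. \<Sum>f\<in>content \<alpha>. \<Sum>q\<in>C. sign q * of_bool (\<forall>x<d. f (p (q x)) = f x))"
    by (rule sum.cong[OF refl], rule sum.swap)
  finally show ?thesis .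
qed

text \<open>Some transposition in \<open>C\<close> leaves \<open>h\<close> unchanged; composing with
  it permutes the summands and reverses every sign.\<close>

lemma signed_sum_not_column_injective:
  assumes "\<not> column_injective h"
  shows "(\<Sum>q\<in>C. sign q * of_bool (\<forall>x<d. h (q x) = f x)) = 0"
proof -
  obtain y z where yz: "y < d" "z < d" "y \<noteq> z" "h y = h z" and t: "transpose y z \<in> C"
    using not_column_injective_transpose[OF assms] .
  have ht: "h (transpose y z x) = h x" for x using yz by (auto simp: transpose_def)
  have "(\<Sum>q\<in>C. sign q * of_bool (\<forall>x<d. h (q x) = f x)) =
    (\<Sum>q\<in>C. sign (transpose y z \<circ> q) * of_bool (\<forall>x<d. h ((transpose y z \<circ> q) x) = f x))"
    by (rule sum_C_left[OF t])
  also have "\<dots> = (\<Sum>q\<in>C. - (sign q * of_bool (\<forall>x<d. h (q x) = f x)))"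
    by (rule sum.cong[OF refl])
      (simp add: ht sign_comp[OF C_G[OF t]] C_G sign_swap_id yz(3))
  finally show ?thesis by (simp add: sum_negf)
qed

text \<open>The hypothesis says that the content is not dominated by the row lengths. Hence no
  coloring with this content is injective on columns, and every column sum cancels.\<close>

lemma sum_symmetrizer_coloring_eq_0:
  assumes "j \<le> k" "int (\<Sum>i<j. L i) < (\<Sum>i<j. \<alpha> i)"
  shows "(\<Sum>h\<in>G. symmetrizer h * coloring_count k {..<d} h \<alpha>) = 0"
  unfolding sum_symmetrizer_coloring
proof (rule sum.neutral, rule ballI, rule sum.neutral, rule ballI)
  fix p f assume p: "p \<in> R" and f: "f \<in> content \<alpha>"
  have "\<not> column_injective (\<lambda>x. f (p x))"
  proof
    assume "column_injective (\<lambda>x. f (p x))"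
    then have "card {x \<in> {..<d}. f (p x) < j} \<le> card {x \<in> {..<d}. row x < j}"
      by (rule column_injective_dominance)
    also have "card {x \<in> {..<d}. f (p x) < j} = card {x \<in> {..<d}. f x < j}"
      using card_permutes_vimage[OF R_G[OF p], of "\<lambda>y. f y < j"] .
    also have "\<dots> = (\<Sum>i<j. card {x \<in> {..<d}. f x = i})"
      by (rule card_less_eq_sum_fibres) simp
    finally have "int (\<Sum>i<j. card {x \<in> {..<d}. f x = i}) \<le> int (\<Sum>i<j. L i)"
      by (simp only: card_row_less[OF assms(1)] of_nat_le_iff)
    moreover have "int (\<Sum>i<j. card {x \<in> {..<d}. f x = i}) = (\<Sum>i<j. \<alpha> i)"
      unfolding of_nat_sum using f assms(1) by (intro sum.cong refl) (auto simp: content_def)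
    ultimately show False using assms(2) by simp
  qed
  then show "(\<Sum>q\<in>C. sign q * of_bool (\<forall>x<d. f (p (q x)) = f x)) = 0"
    by (rule signed_sum_not_column_injective)
qed

text \<open>Parametrizes the colorings with nonvanishing column sum in the extremal case where the
  content equals the row lengths: after undoing \<open>p\<close>, they are the column rearrangements
  of the coloring by rows.\<close>

lemma bij_betw_column_group_fillings:
  assumes p: "p \<in> R"
  shows "bij_betw (\<lambda>q x. if x < d then row (q (inv p x)) else undefined) C
    {f \<in> content (\<lambda>i. int (L i)). column_injective (\<lambda>x. f (p x))}"
    (is "bij_betw ?F C ?S")
  unfolding bij_betw_def
proof
  have ip: "inv p permutes {..<d}" using R_G[OF p] by (rule permutes_inv)
  note pp = permutes_inverses[OF R_G[OF p]]
  show "inj_on ?F C"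
  proof (rule inj_onI)
    fix q r assume qr: "q \<in> C" "r \<in> C" and eq: "?F q = ?F r"
    show "q = r"
    proof
      fix x
      show "q x = r x"
      proof (cases "x < d")
        case True
        then have "row (q x) = row (r x)"
          using fun_cong[OF eq, of "p x"] R_G[OF p] pp by simp
        moreover have "col (q x) = col (r x)" using True qr by (simp add: C_def)
        ultimately show ?thesis using row_col_inj[of "q x" "r x"] True C_G[OF qr(1)] C_G[OF qr(2)] by simp
      next
        case False
        then show ?thesis using C_G[OF qr(1)] C_G[OF qr(2)] by (simp add: permutes_def)
      qed
    qed
  qed
  show "?F ` C = ?S"
  proof (intro equalityI subsetI)
    fix f assume "f \<in> ?F ` C"
    then obtain q where q: "q \<in> C" and f: "f = ?F q" by auto
    have fp: "f (p x) = row (q x)" if "x < d" for x using that f R_G[OF p] pp by simp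
    have "column_injective (\<lambda>x. f (p x))"
      unfolding column_injective_def
    proof (intro allI impI)
      fix x y assume xy: "x < d" "y < d" "col x = col y" "f (p x) = f (p y)"
      then have "row (q x) = row (q y)" "col (q x) = col (q y)" using q by (auto simp: fp C_def)
      then have "q x = q y" using row_col_inj[of "q x" "q y"] xy C_G[OF q] by simp
      then show "x = y" using permutes_inj[OF C_G[OF q]] by (simp add: inj_eq)
    qed
    moreover have "card {x \<in> {..<d}. f x = i} = L i" if "i < k" for i
    proof -
      have "{x \<in> {..<d}. f x = i} = {x \<in> {..<d}. row ((q \<circ> inv p) x) = i}" by (auto simp: f)
      then show ?thesis
        using card_permutes_vimage[OF permutes_compose[OF ip C_G[OF q]], of "\<lambda>y. row y = i"]
          card_row[OF that] by simp
    qed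
    moreover have "f \<in> {..<d} \<rightarrow>\<^sub>E {..<k}"
      using row_col_less ip C_G[OF q] by (simp add: f PiE_iff extensional_def)
    ultimately show "f \<in> ?S" by (simp add: content_def)
  next
    fix f assume "f \<in> ?S"
    then have f: "f \<in> {..<d} \<rightarrow>\<^sub>E {..<k}" "\<And>i. i < k \<Longrightarrow> card {x \<in> {..<d}. f x = i} = L i"
      and ci: "column_injective (\<lambda>x. f (p x))" by (auto simp: content_def)
    have "card {x \<in> {..<d}. f (p x) = i} = card {x \<in> {..<d}. row x = i}" for i
    proof -
      have "card {x \<in> {..<d}. f (p x) = i} = card {x \<in> {..<d}. f x = i}"
        using card_permutes_vimage[OF R_G[OF p], of "\<lambda>y. f y = i"] .
      also have "\<dots> = card {x \<in> {..<d}. row x = i}"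
      proof (cases "i < k")
        case True
        then show ?thesis using f(2)[OF True] card_row[OF True] by simp
      next
        case False
        then have "{x \<in> {..<d}. f x = i} = {}" "{x \<in> {..<d}. row x = i} = {}"
          using f(1) row_col_less by auto
        then show ?thesis by metis
      qed
      finally show ?thesis .
    qed
    from column_injective_imp_column_permutation[OF ci this]
    obtain q where q: "q \<in> C" "\<And>x. x < d \<Longrightarrow> f (p x) = row (q x)" by auto
    have "f = ?F q"
    proof
      fix x
      show "f x = ?F q x"
        using q(2)[of "inv p x"] ip pp(1)[of x] f(1) by (auto simp: PiE_iff extensional_def)
    qed
    then show "f \<in> ?F ` C" using q(1) by blast
  qed
qed

text \<open>Brings \<open>norm_const\<close> into the form in which it arises from colorings;
  \<open>r\<close> will be the column permutation that describes the coloring.\<close>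

lemma norm_const_altdef:
  "norm_const = (\<Sum>p\<in>R. \<Sum>r\<in>C. \<Sum>q\<in>C. sign q * of_bool (r \<circ> q \<circ> p \<circ> inv r \<in> R))"
proof -
  have "norm_const = (\<Sum>p\<in>R. \<Sum>q\<in>C. sign q * symmetrizer (inv q \<circ> inv p))"
    unfolding norm_const_def sum_symmetrizer_mult
    by (intro sum.cong refl arg_cong2[where f = "(*)"] arg_cong[where f = symmetrizer])
      (auto simp: R_G C_G)
  also have "\<dots> = (\<Sum>p\<in>R. \<Sum>q\<in>C. sign q * symmetrizer (q \<circ> p))"
    by (subst (2) sum_R_inv, subst (2) sum_C_inv) (simp add: sign_inv C_G R_G)
  also have "\<dots> = (\<Sum>p\<in>R. \<Sum>r\<in>C. \<Sum>q\<in>C. sign q * (sign r * of_bool (q \<circ> p \<circ> inv r \<in> R)))"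
    unfolding symmetrizer_altdef sum_distrib_left by (rule sum.cong[OF refl], rule sum.swap)
  also have "\<dots> = (\<Sum>p\<in>R. \<Sum>r\<in>C. \<Sum>q\<in>C. sign q * of_bool (r \<circ> q \<circ> p \<circ> inv r \<in> R))"
  proof (rule sum.cong[OF refl], rule sum.cong[OF refl])
    fix p r assume r: "r \<in> C"
    have "(\<Sum>q\<in>C. sign q * (sign r * of_bool (q \<circ> p \<circ> inv r \<in> R))) =
      (\<Sum>q\<in>C. sign (r \<circ> q) * (sign r * of_bool (r \<circ> q \<circ> p \<circ> inv r \<in> R)))"
      by (rule sum_C_left[OF r])
    also have "\<dots> = (\<Sum>q\<in>C. sign q * of_bool (r \<circ> q \<circ> p \<circ> inv r \<in> R))"
    proof (rule sum.cong[OF refl])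
      fix q assume "q \<in> C"
      then have "sign (r \<circ> q) * sign r = sign q"
        using r by (simp add: sign_comp C_G mult.commute mult.left_commute sign_idempotent sign_left_idempotent)
      then show "sign (r \<circ> q) * (sign r * of_bool (r \<circ> q \<circ> p \<circ> inv r \<in> R)) =
          sign q * of_bool (r \<circ> q \<circ> p \<circ> inv r \<in> R)"
        by (simp only: mult.assoc[symmetric])
    qed
    finally show "(\<Sum>q\<in>C. sign q * (sign r * of_bool (q \<circ> p \<circ> inv r \<in> R))) =
      (\<Sum>q\<in>C. sign q * of_bool (r \<circ> q \<circ> p \<circ> inv r \<in> R))" .
  qed
  finally show ?thesis .
qed

text \<open>For the coloring \<open>row \<circ> r \<circ> inv p\<close>, invariance under
  \<open>p \<circ> q\<close> says that \<open>r \<circ> q \<circ> p \<circ> inv r\<close> preserves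
  rows. These are exactly the terms of \<open>norm_const_altdef\<close>.\<close>

lemma sum_symmetrizer_coloring_rows:
  "(\<Sum>h\<in>G. symmetrizer h * coloring_count k {..<d} h (\<lambda>i. int (L i))) = norm_const"
  unfolding sum_symmetrizer_coloring norm_const_altdef
proof (rule sum.cong[OF refl])
  fix p assume p: "p \<in> R"
  note bij = bij_betw_column_group_fillings[OF p]
  let ?F = "\<lambda>q x. if x < d then row (q (inv p x)) else undefined"
  let ?S = "{f \<in> content (\<lambda>i. int (L i)). column_injective (\<lambda>x. f (p x))}"
  let ?g = "\<lambda>f. \<Sum>q\<in>C. sign q * of_bool (\<forall>x<d. f (p (q x)) = f x)"
  have ip: "inv p permutes {..<d}" using R_G[OF p] by (rule permutes_inv)
  note pp = permutes_inverses[OF R_G[OF p]]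
  have "(\<Sum>f\<in>content (\<lambda>i. int (L i)). ?g f) = (\<Sum>f\<in>?S. ?g f)"
  proof (rule sum.mono_neutral_right)
    show "\<forall>f\<in>content (\<lambda>i. int (L i)) - ?S. ?g f = 0"
      using signed_sum_not_column_injective by auto
  qed (auto simp: finite_content)
  also have "\<dots> = (\<Sum>r\<in>C. ?g (?F r))"
    by (rule sum.reindex_bij_betw[OF bij, symmetric])
  also have "\<dots> = (\<Sum>r\<in>C. \<Sum>q\<in>C. sign q * of_bool (r \<circ> q \<circ> p \<circ> inv r \<in> R))"
  proof (rule sum.cong[OF refl], rule sum.cong[OF refl])
    fix r q assume rC: "r \<in> C" and qC: "q \<in> C"
    note r = C_G[OF rC] and q = C_G[OF qC]
    note rr = permutes_inverses[OF r] and ir = permutes_inv[OF r]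
    have "(\<forall>x<d. ?F r (p (q x)) = ?F r x) \<longleftrightarrow> (\<forall>x<d. row (r (q x)) = row (r (inv p x)))"
      using R_G[OF p] q pp by simp
    also have "\<dots> \<longleftrightarrow> (\<forall>y<d. row ((r \<circ> q \<circ> p \<circ> inv r) y) = row y)"
    proof (intro iffI allI impI)
      fix y assume "\<forall>x<d. row (r (q x)) = row (r (inv p x))" "y < d"
      then show "row ((r \<circ> q \<circ> p \<circ> inv r) y) = row y"
        using R_G[OF p] ir pp rr by (auto dest: spec[of _ "p (inv r y)"])
    next
      fix x assume *: "\<forall>y<d. row ((r \<circ> q \<circ> p \<circ> inv r) y) = row y" and x: "x < d"
      show "row (r (q x)) = row (r (inv p x))"
        using *[rule_format, of "r (inv p x)"] x ip r pp rr by simp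
    qed
    also have "\<dots> \<longleftrightarrow> r \<circ> q \<circ> p \<circ> inv r \<in> R"
      using r q ir R_G[OF p] by (auto simp: R_def intro!: permutes_compose)
    finally show "sign q * of_bool (\<forall>x<d. ?F r (p (q x)) = ?F r x) = sign q * of_bool (r \<circ> q \<circ> p \<circ> inv r \<in> R)"
      by (simp only:)
  qed
  finally show "(\<Sum>f\<in>content (\<lambda>i. int (L i)). ?g f) =
    (\<Sum>r\<in>C. \<Sum>q\<in>C. sign q * of_bool (r \<circ> q \<circ> p \<circ> inv r \<in> R))" .
qed

text \<open>The beta-numbers: row lengths plus the staircase, so that equal rows also get distinct
  entries.\<close>

definition "beta i = int (L i) + int k - 1 - int i"

lemma beta_strict_decreasing:
  assumes "i < j" "j < k"
  shows "beta j < beta i"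
  using decreasing[of i j] assms by (simp add: beta_def)

lemma inj_on_beta: "inj_on beta {..<k}"
proof (rule inj_onI)
  fix i j assume "i \<in> {..<k}" "j \<in> {..<k}" "beta i = beta j"
  then show "i = j"
    using beta_strict_decreasing[of i j] beta_strict_decreasing[of j i] by (cases i j rule: linorder_cases) auto
qed

lemma beta_nonneg: "i < k \<Longrightarrow> 0 \<le> beta i"
  by (simp add: beta_def)

lemma sum_beta: "(\<Sum>i<k. beta i) = int d + (\<Sum>i<k. int i)"
proof -
  have "(\<Sum>i<k. beta i) = (\<Sum>i<k. int (L i) + int (k - Suc i))"
    by (intro sum.cong refl) (auto simp: beta_def of_nat_diff)
  also have "\<dots> = int (\<Sum>i<k. L i) + (\<Sum>i<k. int (k - Suc i))" by (simp add: sum.distrib)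
  finally show ?thesis by (simp only: sum_rows sum.nat_diff_reindex)
qed

text \<open>The term of \<open>w\<close> has content \<open>L i + w i - i\<close>. If
  \<open>w\<close> is not the identity, the first point \<open>j\<close> that it moves is moved
  upwards, so the first \<open>j + 1\<close> entries sum to more than the corresponding row lengths
  and the term vanishes. The identity gives the extremal content.\<close>

lemma sum_symmetrizer_frobenius_value:
  "(\<Sum>h\<in>G. symmetrizer h * frobenius_value k {..<d} h beta) = norm_const"
proof -
  let ?a = "\<lambda>w i. beta i + int (w i) + 1 - int k"
  have "(\<Sum>h\<in>G. symmetrizer h * frobenius_value k {..<d} h beta) =
    (\<Sum>h\<in>G. \<Sum>w | w permutes {..<k}. sign w * (symmetrizer h * coloring_count k {..<d} h (?a w)))"
    unfolding frobenius_value_def sum_distrib_left by (intro sum.cong refl) (simp add: mult_ac)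
  also have "\<dots> = (\<Sum>w | w permutes {..<k}. sign w * (\<Sum>h\<in>G. symmetrizer h * coloring_count k {..<d} h (?a w)))"
    unfolding sum_distrib_left by (rule sum.swap)
  also have "\<dots> = (\<Sum>w | w permutes {..<k}. if w = id then norm_const else 0)"
  proof (rule sum.cong[OF refl])
    fix w assume "w \<in> {w. w permutes {..<k}}"
    then have w: "w permutes {..<k}" by simp
    show "sign w * (\<Sum>h\<in>G. symmetrizer h * coloring_count k {..<d} h (?a w)) = (if w = id then norm_const else 0)"
    proof (cases "w = id")
      case True
      then have "?a w = (\<lambda>i. int (L i))" by (auto simp: beta_def)
      then show ?thesis using True sum_symmetrizer_coloring_rows by (simp add: sign_id)
    next
      case False
      then have "\<exists>j. w j \<noteq> j" by (auto simp: fun_eq_iff)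
      define j where "j = (LEAST j. w j \<noteq> j)"
      have wj: "w j \<noteq> j" unfolding j_def using \<open>\<exists>j. w j \<noteq> j\<close> by (rule LeastI_ex)
      have wi: "w i = i" if "i < j" for i using not_less_Least[of i "\<lambda>j. w j \<noteq> j"] that unfolding j_def by blast
      have jk: "j < k" using wj w by (force simp: permutes_def)
      have "j < w j"
      proof (rule ccontr)
        assume "\<not> j < w j"
        then have "w j < j" using wj by simp
        then have "w (w j) = w j" by (rule wi)
        then show False using wj permutes_inj[OF w] by (simp add: inj_eq)
      qed
      have "(\<Sum>h\<in>G. symmetrizer h * coloring_count k {..<d} h (?a w)) = 0"
      proof (rule sum_symmetrizer_coloring_eq_0[of "Suc j"])
        have "(\<Sum>i<Suc j. ?a w i) = (\<Sum>i<j. int (L i)) + (int (L j) + int (w j) - int j)"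
          by (simp add: beta_def wi)
        then show "int (\<Sum>i<Suc j. L i) < (\<Sum>i<Suc j. ?a w i)" using \<open>j < w j\<close> by simp
      qed (use jk in simp)
      then show ?thesis using False by simp
    qed
  qed
  also have "\<dots> = norm_const" by (subst sum.delta) (auto simp: finite_permutations permutes_id)
  finally show ?thesis .
qed

text \<open>Both sides have the same norm, and the Cauchy--Schwarz inequality for their inner product is
  an equality.\<close>

lemma class_average_eq_frobenius_value:
  assumes "g permutes {..<d}"
  shows "class_average g = norm_const * frobenius_value k {..<d} g beta"
proof -
  let ?F = "\<lambda>g. frobenius_value k {..<d} g beta"
  have KF: "(\<Sum>g\<in>G. class_average g * ?F g) = fact d * norm_const"
    by (subst sum_class_average_mult)
      (auto simp: frobenius_value_conjugate frobenius_value_inv sum_symmetrizer_frobenius_value)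
  have FF: "(\<Sum>g\<in>G. ?F g * ?F g) = fact d"
    using sum_frobenius_value_mult[of "{..<d}" beta k beta] beta_nonneg sum_beta
    by (simp add: alt_delta_refl[OF inj_on_beta])
  have "(\<Sum>g\<in>G. (class_average g - norm_const * ?F g)\<^sup>2) = (\<Sum>g\<in>G. class_average g * class_average g
      - 2 * norm_const * (class_average g * ?F g) + norm_const\<^sup>2 * (?F g * ?F g))"
    by (intro sum.cong refl) (simp add: power2_eq_square algebra_simps)
  also have "\<dots> = (\<Sum>g\<in>G. class_average g * class_average g)
      - 2 * norm_const * (\<Sum>g\<in>G. class_average g * ?F g) + norm_const\<^sup>2 * (\<Sum>g\<in>G. ?F g * ?F g)"
    by (simp only: sum.distrib sum_subtractf sum_distrib_left)
  also have "\<dots> = 0"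
    unfolding KF FF sum_class_average_square by (simp add: power2_eq_square)
  finally have "\<forall>g\<in>G. (class_average g - norm_const * ?F g)\<^sup>2 = 0"
    by (subst (asm) sum_nonneg_eq_0_iff) (auto simp: finite_permutations)
  with assms show ?thesis by simp
qed

end

text \<open>The trace of \<open>F\<close> on \<open>V\<close> is the trace of \<open>F \<circ> P\<close> on the functions supported in \<open>X\<close>, where
  \<open>P\<close> is a projection onto \<open>V\<close> and \<open>v x\<close> is the image under \<open>P\<close> of the point mass at \<open>x\<close>.\<close>

lemma trace_on_eq_sum:
  fixes F :: "('a \<Rightarrow> complex) \<Rightarrow> 'a \<Rightarrow> complex"
  assumes X: "finite X" and V: "cfun.subspace V"
    and v: "\<And>x. x \<in> X \<Longrightarrow> v x \<in> V"
    and expand: "\<And>f. f \<in> V \<Longrightarrow> f = (\<Sum>x\<in>X. fun_scale (f x) (v x))"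
    and F: "\<And>f. f \<in> V \<Longrightarrow> F f \<in> V" "\<And>f g. F (f + g) = F f + F g" "\<And>c f. F (fun_scale c f) = fun_scale c (F f)"
  shows "trace_on V F = (\<Sum>x\<in>X. F (v x) x)"
proof -
  define B where "B = (SOME B. cfun.independent B \<and> cfun.span B = V)"
  have "\<exists>B. cfun.independent B \<and> cfun.span B = V"
    using cfun.basis_exists[of V] cfun.span_subspace[OF _ _ V] by metis
  then have B: "cfun.independent B" "cfun.span B = V"
    unfolding B_def using someI_ex[of "\<lambda>B. cfun.independent B \<and> cfun.span B = V"] by auto
  have BV: "B \<subseteq> V" using B(2) cfun.span_superset by blast
  \<comment> \<open>The expansion exhibits a finite spanning family, which makes the chosen basis
    \<open>B\<close> finite.\<close>
  have "V \<subseteq> cfun.span (v ` X)"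
  proof
    fix f assume "f \<in> V"
    then have "f = (\<Sum>x\<in>X. fun_scale (f x) (v x))" by (rule expand)
    also have "\<dots> \<in> cfun.span (v ` X)"
      by (intro cfun.span_sum cfun.span_scale cfun.span_base) auto
    finally show "f \<in> cfun.span (v ` X)" .
  qed
  then have finB: "finite B"
    using cfun.independent_span_bound[of "v ` X" B] X B(1) BV by auto
  let ?r = "cfun.representation B"
  have rep_sum: "?r (\<Sum>x\<in>X. fun_scale (c x) (v x)) b = (\<Sum>x\<in>X. c x * ?r (v x) b)" for c b
  proof -
    have "?r (\<Sum>x\<in>X. fun_scale (c x) (v x)) = (\<lambda>b. \<Sum>x\<in>X. ?r (fun_scale (c x) (v x)) b)"
      using v B by (intro cfun.representation_sum) (auto intro: cfun.span_scale)
    also have "\<dots> = (\<lambda>b. \<Sum>x\<in>X. c x * ?r (v x) b)"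
      using v B by (intro ext sum.cong refl) (simp add: cfun.representation_scale)
    finally show ?thesis by simp
  qed
  have F0: "F 0 = 0" using F(3)[of 0 0] by (simp add: fun_scale_def zero_fun_def)
  have Fsum: "F (\<Sum>b\<in>B. fun_scale (c b) b) = (\<Sum>b\<in>B. fun_scale (c b) (F b))" for c
    using finB by (induction B) (simp_all only: sum.empty sum.insert F0 F not_False_eq_True)
  have sum_app: "(\<Sum>b\<in>B. f b) x = (\<Sum>b\<in>B. f b x)" for f :: "_ \<Rightarrow> 'a \<Rightarrow> complex" and x
    using finB by (induction B) (simp_all add: zero_fun_def plus_fun_def)
  have "trace_on V F = (\<Sum>b\<in>B. ?r (F b) b)"
    by (simp add: trace_on_def B_def Let_def)
  also have "\<dots> = (\<Sum>b\<in>B. \<Sum>x\<in>X. F b x * ?r (v x) b)"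
  proof (rule sum.cong[OF refl])
    fix b assume "b \<in> B"
    then have "F b = (\<Sum>x\<in>X. fun_scale (F b x) (v x))" using BV F(1) by (intro expand) auto
    then show "?r (F b) b = (\<Sum>x\<in>X. F b x * ?r (v x) b)" using rep_sum[of "F b" b] by metis
  qed
  also have "\<dots> = (\<Sum>x\<in>X. \<Sum>b\<in>B. F b x * ?r (v x) b)" by (rule sum.swap)
  also have "\<dots> = (\<Sum>x\<in>X. F (v x) x)"
  proof (rule sum.cong[OF refl])
    fix x assume "x \<in> X"
    then have "v x = (\<Sum>b\<in>B. fun_scale (?r (v x) b) b)"
      using v B finB by (subst cfun.sum_representation_eq) auto
    then have "F (v x) = (\<Sum>b\<in>B. fun_scale (?r (v x) b) (F b))" using Fsum by metis
    then show "(\<Sum>b\<in>B. F b x * ?r (v x) b) = F (v x) x"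
      by (simp add: sum_app fun_scale_def mult.commute)
  qed
  finally show ?thesis .
qed

section \<open>The left ideal of the symmetrizer and its trace\<close>

context filling
begin

definition "sym_fun x = complex_of_int (symmetrizer x)"

definition "left_ideal = cfun.span {left_mult g sym_fun | g. g permutes {..<d}}"

lemma left_mult_add: "left_mult g (f + h) = left_mult g f + left_mult g h"
  and left_mult_scale: "left_mult g (fun_scale c f) = fun_scale c (left_mult g f)"
  by (simp_all add: left_mult_def plus_fun_def fun_scale_def)

lemma left_mult_left_mult:
  "g permutes {..<d} \<Longrightarrow> h permutes {..<d} \<Longrightarrow> left_mult g (left_mult h f) = left_mult (g \<circ> h) f"
  by (simp add: left_mult_def comp_assoc)

lemma sum_fun_apply: "(\<Sum>x\<in>A. f x) z = (\<Sum>x\<in>A. f x z)" for f :: "_ \<Rightarrow> _ \<Rightarrow> complex"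
  by (induction A rule: infinite_finite_induct) (simp_all add: zero_fun_def plus_fun_def)

text \<open>The sum is f c / n, where c is the Young symmetrizer and n is \<open>norm_const\<close>.
  Since c * c = n c, right multiplication by c / n fixes the generators of the left ideal, hence all
  of it by linearity.\<close>

lemma left_ideal_expand:
  assumes "f \<in> left_ideal"
  shows "f = (\<Sum>x\<in>G. fun_scale (f x) (fun_scale (1 / of_int norm_const) (left_mult x sym_fun)))"
    (is "f = ?P f")
  using assms unfolding left_ideal_def
proof (rule cfun.span_induct)
  show "cfun.subspace {f. f = ?P f}"
  proof (rule cfun.subspaceI)
    show "0 \<in> {f. f = ?P f}" by (auto simp: fun_eq_iff sum_fun_apply fun_scale_def zero_fun_def)
    show "f + g \<in> {f. f = ?P f}" if "f \<in> {f. f = ?P f}" "g \<in> {f. f = ?P f}" for f g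
    proof -
      have "?P (f + g) = ?P f + ?P g"
        by (auto simp: fun_eq_iff sum_fun_apply fun_scale_def plus_fun_def algebra_simps add_divide_distrib sum.distrib)
      then show ?thesis using that by simp
    qed
    show "fun_scale c f \<in> {f. f = ?P f}" if "f \<in> {f. f = ?P f}" for c f
    proof -
      have "?P (fun_scale c f) = fun_scale c (?P f)"
        by (auto simp: fun_eq_iff sum_fun_apply fun_scale_def sum_distrib_left mult_ac)
      then show ?thesis using that by simp
    qed
  qed
next
  fix f assume "f \<in> {left_mult g sym_fun | g. g permutes {..<d}}"
  then obtain g where g: "g permutes {..<d}" and f: "f = left_mult g sym_fun" by auto
  note ig = permutes_inv[OF g]
  have "f z = ?P f z" for z
  proof (cases "z permutes {..<d}")
    case True
    have "(\<Sum>x\<in>G. symmetrizer (inv g \<circ> x) * symmetrizer (inv x \<circ> z)) =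
      (\<Sum>x\<in>G. symmetrizer (inv g \<circ> (g \<circ> x)) * symmetrizer (inv (g \<circ> x) \<circ> z))"
      by (rule sum_G_left[OF g])
    also have "\<dots> = (\<Sum>x\<in>G. symmetrizer x * symmetrizer (inv x \<circ> (inv g \<circ> z)))"
      using g by (intro sum.cong refl) (simp add: comp_assoc)
    also have "\<dots> = norm_const * symmetrizer (inv g \<circ> z)"
      by (rule symmetrizer_convolution) (intro permutes_compose True ig)
    finally have "(\<Sum>x\<in>G. sym_fun (inv g \<circ> x) * sym_fun (inv x \<circ> z)) = of_int norm_const * sym_fun (inv g \<circ> z)"
      unfolding sym_fun_def by (simp only: of_int_mult[symmetric] of_int_sum[symmetric])
    then show ?thesis using norm_const_pos
      by (simp add: f left_mult_def sum_fun_apply fun_scale_def sum_divide_distrib[symmetric])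
  next
    case False
    have "sym_fun (inv x \<circ> z) = 0" if x: "x permutes {..<d}" for x
    proof -
      have "\<not> inv x \<circ> z permutes {..<d}"
      proof
        assume "inv x \<circ> z permutes {..<d}"
        then have "x \<circ> (inv x \<circ> z) permutes {..<d}" using x by (rule permutes_compose)
        then show False using False x by simp
      qed
      then show ?thesis by (simp add: sym_fun_def symmetrizer_outside)
    qed
    then show ?thesis using g by (simp add: f left_mult_def sum_fun_apply fun_scale_def)
  qed
  then show "f = ?P f" by (rule ext)
qed

text \<open>By the expansion, the diagonal entries to be summed are the coefficients of
  \<open>x\<close> in g x c / n, with c the Young symmetrizer and n = \<open>norm_const\<close>.
  Their sum is the class average of \<open>g\<close> divided by n.\<close>

theorem trace_left_ideal:
  assumes g: "g permutes {..<d}"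
  shows "trace_on left_ideal (left_mult g) = of_int (frobenius_value k {..<d} g beta)"
proof -
  let ?v = "\<lambda>x. fun_scale (1 / of_int norm_const) (left_mult x sym_fun)"
  have "trace_on left_ideal (left_mult g) = (\<Sum>x\<in>G. left_mult g (?v x) x)"
  proof (rule trace_on_eq_sum)
    show "cfun.subspace left_ideal" by (simp add: left_ideal_def cfun.subspace_span)
    show "?v x \<in> left_ideal" if "x \<in> G" for x
      using that unfolding left_ideal_def by (intro cfun.span_scale cfun.span_base) auto
    show "left_mult g f \<in> left_ideal" if "f \<in> left_ideal" for f
      using that unfolding left_ideal_def
    proof (induction rule: cfun.span_induct_alt)
      case base
      have "left_mult g 0 = 0" by (simp add: left_mult_def zero_fun_def)
      then show ?case by (metis cfun.span_zero)
    next
      case (step c x y)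
      then obtain h where "h permutes {..<d}" "x = left_mult h sym_fun" by auto
      then have "left_mult g x \<in> cfun.span {left_mult g sym_fun |g. g permutes {..<d}}"
        using g by (intro cfun.span_base) (auto simp: left_mult_left_mult intro: permutes_compose)
      then show ?case using step(2)
        unfolding left_mult_add left_mult_scale by (intro cfun.span_add cfun.span_scale)
    qed
    show "f = (\<Sum>x\<in>G. fun_scale (f x) (?v x))" if "f \<in> left_ideal" for f
      using that by (rule left_ideal_expand)
  qed (simp_all only: finite_permutations finite_lessThan left_mult_add left_mult_scale)
  also have "\<dots> = of_int (class_average g) / of_int norm_const"
    by (simp add: class_average_def left_mult_def fun_scale_def sym_fun_def sum_divide_distrib comp_assoc)
  also have "\<dots> = of_int (frobenius_value k {..<d} g beta)"
    using norm_const_pos by (simp add: class_average_eq_frobenius_value[OF g])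
  finally show ?thesis .
qed

end

section \<open>Hook lengths and the character sum\<close>

lemma partitions_ofD:
  assumes "lam \<in> partitions_of d"
  shows "sum_list lam = d" "i < length lam \<Longrightarrow> 0 < lam ! i" "i \<le> j \<Longrightarrow> j < length lam \<Longrightarrow> lam ! j \<le> lam ! i"
proof -
  have "sorted_wrt (\<ge>) lam" using assms by (simp add: partitions_of_def)
  then show "i \<le> j \<Longrightarrow> j < length lam \<Longrightarrow> lam ! j \<le> lam ! i"
    by (cases "i = j") (auto simp: sorted_wrt_iff_nth_less)
qed (use assms in \<open>auto simp: partitions_of_def\<close>)

lemma finite_partitions_of: "finite (partitions_of d)"
proof (rule finite_subset[OF _ finite_lists_length_le[of "{..d}" d]])
  show "partitions_of d \<subseteq> {xs. set xs \<subseteq> {..d} \<and> length xs \<le> d}"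
  proof
    fix mu assume "mu \<in> partitions_of d"
    then have mu: "sum_list mu = d" "\<And>x. x \<in> set mu \<Longrightarrow> 0 < x" by (auto simp: partitions_of_def)
    have "length mu \<le> sum_list mu" using mu(2)
    proof (induction mu)
      case (Cons a mu)
      then have "0 < a" "length mu \<le> sum_list mu" by auto
      then show ?case by simp
    qed simp
    then show "mu \<in> {xs. set xs \<subseteq> {..d} \<and> length xs \<le> d}"
      using mu(1) member_le_sum_list[of _ mu] by auto
  qed
qed simp

lemma sum_young_diagram: "(\<Sum>c\<in>young_diagram lam. f c) = (\<Sum>i<length lam. \<Sum>j<lam ! i. f (i, j))"
proof -
  have "young_diagram lam = (SIGMA i:{..<length lam}. {..<lam ! i})"
    by (auto simp: young_diagram_def)
  then show ?thesis by (simp add: sum.Sigma)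
qed

lemma finite_young_diagram: "finite (young_diagram lam)"
proof -
  have "young_diagram lam = (SIGMA i:{..<length lam}. {..<lam ! i})"
    by (auto simp: young_diagram_def)
  then show ?thesis by simp
qed

lemma card_young_diagram: "card (young_diagram lam) = sum_list lam"
  using sum_young_diagram[of "\<lambda>_. 1 :: nat" lam] finite_young_diagram[of lam]
  by (simp add: sum_list_sum_nth atLeast0LessThan)

text \<open>The rows occupy consecutive disjoint intervals, which gives injectivity; surjectivity
  follows by counting cells.\<close>

lemma bij_betw_tableau: "bij_betw (tableau lam) (young_diagram lam) {..<sum_list lam}"
proof -
  have mono: "sum_list (take i lam) \<le> sum_list (take j lam)" if "i \<le> j" for i j
  proof -
    have "take j lam = take i lam @ drop i (take j lam)"
      using that by (metis append_take_drop_id min.absorb1 take_take)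
    then show ?thesis by (metis le_add1 sum_list_append)
  qed
  have bound: "tableau lam (i, j) < sum_list (take (Suc i) lam)" if "(i, j) \<in> young_diagram lam" for i j
    using that by (simp add: young_diagram_def tableau_def take_Suc_conv_app_nth)
  have lt: "tableau lam (i, j) < tableau lam (i', j')"
    if "(i, j) \<in> young_diagram lam" "i < i'" for i j i' j'
  proof -
    have "sum_list (take (Suc i) lam) \<le> sum_list (take i' lam)" using that by (intro mono) simp
    with bound[OF that(1)] show ?thesis by (simp add: tableau_def)
  qed
  have inj: "inj_on (tableau lam) (young_diagram lam)"
  proof (rule inj_onI, clarify)
    fix i j i' j' assume *: "(i, j) \<in> young_diagram lam" "(i', j') \<in> young_diagram lam"
      "tableau lam (i, j) = tableau lam (i', j')"
    then have "i = i'" using lt[of i j i' j'] lt[of i' j' i j] by (cases i i' rule: linorder_cases) auto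
    then show "i = i' \<and> j = j'" using *(3) by (simp add: tableau_def)
  qed
  moreover have sub: "tableau lam ` young_diagram lam \<subseteq> {..<sum_list lam}"
  proof clarify
    fix i j assume ij: "(i, j) \<in> young_diagram lam"
    have "sum_list (take (Suc i) lam) \<le> sum_list (take (length lam) lam)"
      using ij by (intro mono) (simp add: young_diagram_def Suc_le_eq)
    with bound[OF ij] show "tableau lam (i, j) < sum_list lam" by simp
  qed
  moreover have "tableau lam ` young_diagram lam = {..<sum_list lam}"
    by (rule card_subset_eq[OF _ sub]) (simp_all add: card_image[OF inj] card_young_diagram)
  ultimately show ?thesis by (simp add: bij_betw_def)
qed

definition tableau_row :: "nat list \<Rightarrow> nat \<Rightarrow> nat" where
  "tableau_row lam x = fst (inv_into (young_diagram lam) (tableau lam) x)"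

definition tableau_col :: "nat list \<Rightarrow> nat \<Rightarrow> nat" where
  "tableau_col lam x = snd (inv_into (young_diagram lam) (tableau lam) x)"

lemma filling_tableau:
  assumes "lam \<in> partitions_of d"
  shows "filling d (length lam) ((!) lam) (tableau_row lam) (tableau_col lam)"
proof
  have "{(i, j). i < length lam \<and> j < lam ! i} = young_diagram lam" by (simp add: young_diagram_def)
  then show "bij_betw (\<lambda>x. (tableau_row lam x, tableau_col lam x)) {..<d} {(i, j). i < length lam \<and> j < lam ! i}"
    using bij_betw_inv_into[OF bij_betw_tableau[of lam]] partitions_ofD(1)[OF assms]
    by (simp add: tableau_row_def tableau_col_def)
qed (use partitions_ofD(3)[OF assms] in auto)

lemma tableau_row_col:
  assumes "(i, j) \<in> young_diagram lam"
  shows "tableau_row lam (tableau lam (i, j)) = i" "tableau_col lam (tableau lam (i, j)) = j"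
  using bij_betw_inv_into_left[OF bij_betw_tableau assms]
  by (simp_all add: tableau_row_def tableau_col_def)

lemma tableau_cases:
  assumes "x < sum_list lam"
  obtains i j where "(i, j) \<in> young_diagram lam" "x = tableau lam (i, j)"
proof -
  have "x \<in> tableau lam ` young_diagram lam" using bij_betw_tableau[of lam] assms by (simp add: bij_betw_def)
  then show ?thesis using that by auto
qed

lemma row_group_altdef:
  "row_group lam = {g. g permutes {..<sum_list lam} \<and> (\<forall>x<sum_list lam. tableau_row lam (g x) = tableau_row lam x)}"
proof -
  have "(\<forall>(i, j)\<in>young_diagram lam. \<exists>j'. (i, j') \<in> young_diagram lam \<and> g (tableau lam (i, j)) = tableau lam (i, j'))
    \<longleftrightarrow> (\<forall>x<sum_list lam. tableau_row lam (g x) = tableau_row lam x)" (is "?A \<longleftrightarrow> ?B")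
    if g: "g permutes {..<sum_list lam}" for g
  proof
    assume A: ?A
    show ?B
    proof (intro allI impI)
      fix x assume "x < sum_list lam"
      then obtain i j where ij: "(i, j) \<in> young_diagram lam" "x = tableau lam (i, j)" by (rule tableau_cases)
      with A obtain j' where "(i, j') \<in> young_diagram lam" "g x = tableau lam (i, j')" by auto
      then show "tableau_row lam (g x) = tableau_row lam x" using ij by (simp add: tableau_row_col)
    qed
  next
    assume B: ?B
    show ?A
    proof clarify
      fix i j assume ij: "(i, j) \<in> young_diagram lam"
      then have x: "tableau lam (i, j) < sum_list lam" using bij_betw_tableau[of lam] by (auto simp: bij_betw_def)
      then have "g (tableau lam (i, j)) < sum_list lam" using permutes_in_image[OF g] by simp
      then obtain i' j' where *: "(i', j') \<in> young_diagram lam" "g (tableau lam (i, j)) = tableau lam (i', j')"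
        by (rule tableau_cases)
      have "i' = i" using B x ij * by (metis tableau_row_col(1))
      then show "\<exists>j'. (i, j') \<in> young_diagram lam \<and> g (tableau lam (i, j)) = tableau lam (i, j')" using * by auto
    qed
  qed
  then show ?thesis unfolding row_group_def by blast
qed

lemma column_group_altdef:
  "column_group lam = {g. g permutes {..<sum_list lam} \<and> (\<forall>x<sum_list lam. tableau_col lam (g x) = tableau_col lam x)}"
proof -
  have "(\<forall>(i, j)\<in>young_diagram lam. \<exists>i'. (i', j) \<in> young_diagram lam \<and> g (tableau lam (i, j)) = tableau lam (i', j))
    \<longleftrightarrow> (\<forall>x<sum_list lam. tableau_col lam (g x) = tableau_col lam x)" (is "?A \<longleftrightarrow> ?B")
    if g: "g permutes {..<sum_list lam}" for g
  proof
    assume A: ?A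
    show ?B
    proof (intro allI impI)
      fix x assume "x < sum_list lam"
      then obtain i j where ij: "(i, j) \<in> young_diagram lam" "x = tableau lam (i, j)" by (rule tableau_cases)
      with A obtain i' where "(i', j) \<in> young_diagram lam" "g x = tableau lam (i', j)" by auto
      then show "tableau_col lam (g x) = tableau_col lam x" using ij by (simp add: tableau_row_col)
    qed
  next
    assume B: ?B
    show ?A
    proof clarify
      fix i j assume ij: "(i, j) \<in> young_diagram lam"
      then have x: "tableau lam (i, j) < sum_list lam" using bij_betw_tableau[of lam] by (auto simp: bij_betw_def)
      then have "g (tableau lam (i, j)) < sum_list lam" using permutes_in_image[OF g] by simp
      then obtain i' j' where *: "(i', j') \<in> young_diagram lam" "g (tableau lam (i, j)) = tableau lam (i', j')"
        by (rule tableau_cases)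
      have "j' = j" using B x ij * by (metis tableau_row_col(2))
      then show "\<exists>i'. (i', j) \<in> young_diagram lam \<and> g (tableau lam (i, j)) = tableau lam (i', j)" using * by auto
    qed
  qed
  then show ?thesis unfolding column_group_def by blast
qed

section \<open>Beta-numbers, characters and hook lengths\<close>

definition beta_number :: "nat list \<Rightarrow> nat \<Rightarrow> int" where
  "beta_number lam i = int (lam ! i) + int (length lam) - 1 - int i"

theorem irr_char_eq_frobenius_value:
  assumes "lam \<in> partitions_of d" "g permutes {..<d}"
  shows "irr_char lam g = of_int (frobenius_value (length lam) {..<d} g (beta_number lam))"
proof -
  interpret filling d "length lam" "(!) lam" "tableau_row lam" "tableau_col lam"
    by (rule filling_tableau[OF assms(1)])
  have d: "sum_list lam = d" by (rule partitions_ofD(1)[OF assms(1)])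
  have RC: "row_group lam = R" "column_group lam = C"
    by (simp_all add: row_group_altdef column_group_altdef R_def C_def d)
  have "young_symmetrizer lam = sym_fun"
    unfolding young_symmetrizer_def sym_fun_def symmetrizer_def RC of_int_sum
    by (intro ext sum.cong refl) simp
  then have "specht_module lam = left_ideal"
    by (simp add: specht_module_def left_ideal_def d)
  moreover have "beta = beta_number lam"
    by (simp add: beta_def beta_number_def fun_eq_iff)
  ultimately show ?thesis using trace_left_ideal[OF assms(2)] by (simp add: irr_char_def)
qed

text \<open>Subtracting the hook length of cell (i, j) from the beta-number of row i gives j + k - c
  j, with c j the length of column j. These numbers increase strictly with j and are never
  beta-numbers. Counting shows that the row has as many cells as there are admissible
  \<open>r\<close>.\<close>

lemma bij_betw_hook_lengths_row:
  assumes lam: "lam \<in> partitions_of d" and i: "i < length lam"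
  shows "bij_betw (\<lambda>j. hook_length lam (i, j)) {..<lam ! i}
    {r. 1 \<le> r \<and> int r \<le> beta_number lam i \<and> beta_number lam i - int r \<notin> beta_number lam ` {..<length lam}}"
    (is "bij_betw ?h _ ?H")
proof -
  interpret filling d "length lam" "(!) lam" "tableau_row lam" "tableau_col lam"
    by (rule filling_tableau[OF lam])
  have beta: "beta = beta_number lam"
    by (simp add: beta_def beta_number_def fun_eq_iff)
  let ?k = "length lam" and ?b = "beta_number lam"
  \<comment> \<open>\<open>c j\<close> is the length of column \<open>j\<close>, a part of the
    conjugate partition.\<close>
  define c where "c j = card {m. m < ?k \<and> j < lam ! m}" for j
  have c: "m < c j \<longleftrightarrow> m < ?k \<and> j < lam ! m" for m j
  proof
    assume m: "m < ?k \<and> j < lam ! m"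
    have "{..m} \<subseteq> {m. m < ?k \<and> j < lam ! m}"
      using m decreasing[of _ m] by (auto intro: less_le_trans)
    from card_mono[OF _ this] show "m < c j" by (simp add: c_def)
  next
    assume m: "m < c j"
    show "m < ?k \<and> j < lam ! m"
    proof (rule ccontr)
      assume "\<not> (m < ?k \<and> j < lam ! m)"
      then have "{m. m < ?k \<and> j < lam ! m} \<subseteq> {..<m}"
        using decreasing[of m] by (auto simp: not_less) (meson leD leI le_trans)
      from card_mono[OF _ this] m show False by (simp add: c_def)
    qed
  qed
  have h: "int (?h j) = int (lam ! i) - int j + int (c j) - int i - 1" if j: "j < lam ! i" for j
  proof -
    have ic: "i < c j" using c i j by simp
    have "hook lam (i, j) = {i} \<times> {j..<lam ! i} \<union> {Suc i..<c j} \<times> {j}"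
      using c i j by (auto simp: hook_def young_diagram_def)
    also have "card \<dots> = card ({i} \<times> {j..<lam ! i}) + card ({Suc i..<c j} \<times> {j})"
      by (intro card_Un_disjoint) auto
    finally show ?thesis using j ic by (simp add: hook_length_def card_cartesian_product of_nat_diff)
  qed
  have b_h: "?b i - int (?h j) = int j + int ?k - int (c j)" if "j < lam ! i" for j
    using h[OF that] by (simp add: beta_number_def)
  have c_le: "c j \<le> ?k" for j using c[of ?k j] by (simp add: not_less)
  have c_mono: "c j' \<le> c j" if "j \<le> j'" for j j'
    unfolding c_def using that by (intro card_mono) auto
  have inj: "inj_on ?h {..<lam ! i}"
  proof (rule inj_onI)
    fix j j' assume j: "j \<in> {..<lam ! i}" "j' \<in> {..<lam ! i}" and eq: "?h j = ?h j'"
    have "int (?h y) < int (?h x)" if "x < y" "y < lam ! i" for x y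
      using h[of x] h[of y] c_mono[of x y] that by simp
    then show "j = j'" using j eq by (cases j j' rule: linorder_cases) fastforce+
  qed
  have sub: "?h ` {..<lam ! i} \<subseteq> ?H"
  proof (rule image_subsetI)
    fix j assume "j \<in> {..<lam ! i}"
    then have j: "j < lam ! i" by simp
    have ic: "i < c j" using c i j by simp
    have "1 \<le> ?h j" using h[OF j] j ic by linarith
    moreover have "int (?h j) \<le> ?b i" using b_h[OF j] c_le[of j] by linarith
    \<comment> \<open>Rows that reach column \<open>j\<close> have beta-numbers above
      \<open>j + k - c j\<close>, all other rows have them below.\<close>
    moreover have "?b m \<noteq> ?b i - int (?h j)" if m: "m < ?k" for m
    proof (cases "m < c j")
      case True
      then have "j < lam ! m" using c by simp
      then show ?thesis using b_h[OF j] True by (simp add: beta_number_def)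
    next
      case False
      then have "lam ! m \<le> j" using c m by (simp add: not_less)
      then show ?thesis using b_h[OF j] False m by (simp add: beta_number_def)
    qed
    ultimately show "?h j \<in> ?H" by force
  qed
  have finH: "finite ?H"
    by (rule finite_subset[of _ "{..nat (?b i)}"]) auto
  have "card ?H \<le> lam ! i"
  proof -
    have b0: "0 \<le> ?b m" if "m < ?k" for m using that by (simp add: beta_number_def)
    let ?f = "\<lambda>r. nat (?b i - int r)"
    have "inj_on ?f ?H" by (auto simp: inj_on_def eq_nat_nat_iff)
    \<comment> \<open>The differences are nonnegative, lie below the beta-number of row
      \<open>i\<close>, and avoid those of the k - 1 - i later rows. Exactly \<open>lam ! i\<close>
      numbers are left.\<close>
    moreover have "?f ` ?H \<subseteq> {..<nat (?b i)} - (\<lambda>m. nat (?b m)) ` {Suc i..<?k}"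
    proof
      fix x assume "x \<in> ?f ` ?H"
      then obtain r where r: "1 \<le> r" "int r \<le> ?b i" "?b i - int r \<notin> ?b ` {..<?k}" "x = ?f r" by auto
      then have ne: "x \<noteq> nat (?b m)" if "m < ?k" for m
        using that b0[OF that] by (auto simp: eq_nat_nat_iff image_iff)
      show "x \<in> {..<nat (?b i)} - (\<lambda>m. nat (?b m)) ` {Suc i..<?k}"
      proof
        show "x \<in> {..<nat (?b i)}" using r by auto
        show "x \<notin> (\<lambda>m. nat (?b m)) ` {Suc i..<?k}" using ne by (metis atLeastLessThan_iff imageE)
      qed
    qed
    ultimately have "card ?H \<le> card ({..<nat (?b i)} - (\<lambda>m. nat (?b m)) ` {Suc i..<?k})"
      by (intro card_inj_on_le) auto
    also have "\<dots> = nat (?b i) - card ((\<lambda>m. nat (?b m)) ` {Suc i..<?k})"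
    proof -
      have "(\<lambda>m. nat (?b m)) ` {Suc i..<?k} \<subseteq> {..<nat (?b i)}"
      proof (rule image_subsetI)
        fix m assume "m \<in> {Suc i..<?k}"
        then have "?b m < ?b i" "0 \<le> ?b m"
          using beta_strict_decreasing[of i m] b0[of m] unfolding beta by auto
        then show "nat (?b m) \<in> {..<nat (?b i)}" by simp
      qed
      then show ?thesis by (simp add: card_Diff_subset)
    qed
    also have "card ((\<lambda>m. nat (?b m)) ` {Suc i..<?k}) = ?k - Suc i"
    proof (subst card_image)
      show "inj_on (\<lambda>m. nat (?b m)) {Suc i..<?k}"
      proof (rule inj_onI)
        fix x y assume "x \<in> {Suc i..<?k}" "y \<in> {Suc i..<?k}" "nat (?b x) = nat (?b y)"
        then have "?b x = ?b y" "x \<in> {..<?k}" "y \<in> {..<?k}" using b0 by (auto simp: eq_nat_nat_iff)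
        then show "x = y" using inj_on_beta unfolding beta by (auto dest: inj_onD)
      qed
    qed simp
    also have "nat (?b i) - (?k - Suc i) = lam ! i" using i by (simp add: beta_number_def)
    finally show ?thesis .
  qed
  moreover have "card (?h ` {..<lam ! i}) = lam ! i" using inj by (simp add: card_image)
  ultimately have "?h ` {..<lam ! i} = ?H"
    using card_mono[OF finH sub] by (intro card_subset_eq[OF finH sub]) simp
  then show ?thesis using inj by (simp add: bij_betw_def)
qed

lemma hook_power_sum_eq:
  assumes lam: "lam \<in> partitions_of d"
  shows "hook_power_sum p lam = (\<Sum>r=1..d. of_nat r powi (p - 1) *
    of_nat (card {i. i < length lam \<and> int r \<le> beta_number lam i \<and>
      beta_number lam i - int r \<notin> beta_number lam ` {..<length lam}}))"
proof -
  let ?k = "length lam" and ?b = "beta_number lam"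
  let ?P = "\<lambda>i r. int r \<le> ?b i \<and> ?b i - int r \<notin> ?b ` {..<?k}"
  have hd: "hook_length lam c \<le> d" for c
  proof -
    have "hook lam c \<subseteq> young_diagram lam" by (cases c) (auto simp: hook_def)
    from card_mono[OF finite_young_diagram this] show ?thesis
      by (simp add: hook_length_def card_young_diagram partitions_ofD(1)[OF lam])
  qed
  have "hook_power_sum p lam = (\<Sum>i<?k. \<Sum>j<lam ! i. of_nat (hook_length lam (i, j)) powi (p - 1))"
    by (simp add: hook_power_sum_def sum_young_diagram)
  also have "\<dots> = (\<Sum>i<?k. \<Sum>r=1..d. of_nat r powi (p - 1) * of_bool (?P i r))"
  proof (rule sum.cong[OF refl])
    fix i assume "i \<in> {..<?k}"
    then have bij: "bij_betw (\<lambda>j. hook_length lam (i, j)) {..<lam ! i} {r. 1 \<le> r \<and> ?P i r}"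
      using bij_betw_hook_lengths_row[OF lam] by auto
    have "(\<Sum>j<lam ! i. (of_nat (hook_length lam (i, j)) :: complex) powi (p - 1)) =
      (\<Sum>r | 1 \<le> r \<and> ?P i r. of_nat r powi (p - 1))"
      by (rule sum.reindex_bij_betw[OF bij])
    also have "\<dots> = (\<Sum>r=1..d. of_nat r powi (p - 1) * of_bool (?P i r))"
    proof (rule sum.mono_neutral_cong_left)
      have "{r. 1 \<le> r \<and> ?P i r} = (\<lambda>j. hook_length lam (i, j)) ` {..<lam ! i}"
        using bij by (simp add: bij_betw_def)
      then show "{r. 1 \<le> r \<and> ?P i r} \<subseteq> {1..d}" using hd by auto
    qed auto
    finally show "(\<Sum>j<lam ! i. (of_nat (hook_length lam (i, j)) :: complex) powi (p - 1)) =
      (\<Sum>r=1..d. of_nat r powi (p - 1) * of_bool (?P i r))" .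
  qed
  also have "\<dots> = (\<Sum>r=1..d. of_nat r powi (p - 1) * (\<Sum>i<?k. of_bool (?P i r)))"
    unfolding sum_distrib_left by (rule sum.swap)
  also have "\<dots> = (\<Sum>r=1..d. of_nat r powi (p - 1) * of_nat (card {i. i < ?k \<and> ?P i r}))"
  proof (rule sum.cong[OF refl])
    fix r
    have "{..<?k} \<inter> {i. ?P i r} = {i. i < ?k \<and> ?P i r}" by auto
    then show "of_nat r powi (p - 1) * (\<Sum>i<?k. of_bool (?P i r)) =
      (of_nat r powi (p - 1) * of_nat (card {i. i < ?k \<and> ?P i r}) :: complex)" by simp
  qed
  finally show ?thesis .
qed

text \<open>For distinct \<open>i\<close> and \<open>j\<close> the first sequence still contains
  \<open>l j\<close> and the second no longer does, so the pairing is 0. On the diagonal it is 1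
  precisely when the lowered entry misses all the others, that is, when a rim hook of length
  \<open>r\<close> can be removed from row \<open>i\<close> on.\<close>

lemma sum_alt_delta_lower_same:
  assumes "inj_on l {..<k}" "1 \<le> r"
  shows "(\<Sum>i<k. \<Sum>j<k. if int r \<le> l i \<and> int r \<le> l j
      then alt_delta k (l(i := l i - int r)) (l(j := l j - int r)) else 0) =
    int (card {i. i < k \<and> int r \<le> l i \<and> l i - int r \<notin> l ` {..<k}})"
proof -
  have "(\<Sum>i<k. \<Sum>j<k. if int r \<le> l i \<and> int r \<le> l j
      then alt_delta k (l(i := l i - int r)) (l(j := l j - int r)) else 0) =
    (\<Sum>i<k. \<Sum>j<k. if j = i then of_bool (int r \<le> l i \<and> l i - int r \<notin> l ` {..<k}) else 0)"
  proof (rule sum.cong[OF refl], rule sum.cong[OF refl])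
    fix i j assume "i \<in> {..<k}" "j \<in> {..<k}"
    then have ij: "i < k" "j < k" by auto
    show "(if int r \<le> l i \<and> int r \<le> l j then alt_delta k (l(i := l i - int r)) (l(j := l j - int r)) else 0) =
      (if j = i then of_bool (int r \<le> l i \<and> l i - int r \<notin> l ` {..<k}) else 0)"
    proof (cases "j = i")
      case False
      have "(l(i := l i - int r)) j \<notin> (l(j := l j - int r)) ` {..<k}"
        using False assms ij by (auto simp: inj_on_def)
      with ij(2) have "alt_delta k (l(i := l i - int r)) (l(j := l j - int r)) = 0"
        by (rule alt_delta_eq_0)
      then show ?thesis using False by simp
    next
      case True
      show ?thesis
      proof (cases "l i - int r \<in> l ` {..<k}")
        case mem: True
        then obtain m where m: "m < k" "l m = l i - int r" by auto
        then have "m \<noteq> i" using assms(2) by auto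
        then have "\<not> inj_on (l(i := l i - int r)) {..<k}"
          using m ij by (auto simp: inj_on_def)
        then show ?thesis using True mem by (simp add: alt_delta_not_inj)
      next
        case notin: False
        then have "inj_on (l(i := l i - int r)) {..<k}"
          using assms(1) by (auto simp: inj_on_def image_iff) (metis lessThan_iff)
        then show ?thesis using True notin by (simp add: alt_delta_refl)
      qed
    qed
  qed
  also have "\<dots> = (\<Sum>i<k. of_bool (int r \<le> l i \<and> l i - int r \<notin> l ` {..<k}))"
    by (intro sum.cong refl) simp
  also have "\<dots> = int (card ({..<k} \<inter> {i. int r \<le> l i \<and> l i - int r \<notin> l ` {..<k}}))" by simp
  also have "{..<k} \<inter> {i. int r \<le> l i \<and> l i - int r \<notin> l ` {..<k}} =
      {i. i < k \<and> int r \<le> l i \<and> l i - int r \<notin> l ` {..<k}}" by auto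
  finally show ?thesis .
qed

text \<open>The weight depends on the orbit only through its length, so it passes unchanged through
  the splitting by orbits. An arbitrary weight \<open>F\<close> covers integer exponents of either
  sign.\<close>

lemma sum_orbit_weighted_square:
  fixes F :: "nat \<Rightarrow> complex"
  assumes A: "finite A" "a \<in> A"
    and l: "inj_on l {..<k}" "\<And>i. i < k \<Longrightarrow> 0 \<le> l i" "(\<Sum>i<k. l i) = int (card A) + (\<Sum>i<k. int i)"
  shows "(\<Sum>g | g permutes A. F (card (orbit g a)) * (of_int (frobenius_value k A g l))\<^sup>2) =
    fact (card A - 1) * (\<Sum>r=1..card A. F r *
      of_nat (card {i. i < k \<and> int r \<le> l i \<and> l i - int r \<notin> l ` {..<k}}))"
proof -
  define S where "S r B g = (\<Sum>i<k. frobenius_value k B g (l(i := l i - int r)))" for r B and g :: "'a \<Rightarrow> 'a"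
  define q where "q r = F r * of_nat (card {i. i < k \<and> int r \<le> l i \<and> l i - int r \<notin> l ` {..<k}})" for r
  have "(\<Sum>g | g permutes A. F (card (orbit g a)) * (of_int (frobenius_value k A g l))\<^sup>2) =
    (\<Sum>g | g permutes A. (\<lambda>r B g. F r * of_int (S r B g * S r B g)) (card (orbit g a)) (A - orbit g a) g)"
  proof (rule sum.cong[OF refl])
    fix g assume "g \<in> {g. g permutes A}"
    then have "permutation g" "g ` A \<subseteq> A"
      using A by (auto simp: permutation_permutes permutes_in_image)
    then show "F (card (orbit g a)) * (of_int (frobenius_value k A g l))\<^sup>2 =
      (\<lambda>r B g. F r * of_int (S r B g * S r B g)) (card (orbit g a)) (A - orbit g a) g"
      using frobenius_value_remove_orbit[of g A a k l] A by (simp add: S_def power2_eq_square)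
  qed
  also have "\<dots> = of_nat (fact (card A - 1)) * (\<Sum>r=1..card A. q r)"
  proof (rule sum_permutes_orbit[OF A])
    show "F r * of_int (S r B g * S r B g) = F r * of_int (S r B h * S r B h)"
      if "\<And>x. x \<in> B \<Longrightarrow> g x = h x" for r B g h
      unfolding S_def using that by (simp cong: frobenius_value_cong)
  next
    fix r B assume r: "1 \<le> r" and B: "B \<subseteq> A - {a}" and cB: "card B + r = card A"
    have fB: "finite B" using B A by (auto intro: finite_subset)
    have "(\<Sum>h | h permutes B. S r B h * S r B h) = fact (card B) * (\<Sum>i<k. \<Sum>j<k. if int r \<le> l i \<and> int r \<le> l j
      then alt_delta k (l(i := l i - int r)) (l(j := l j - int r)) else 0)"
      unfolding S_def by (rule sum_lowered_frobenius_values[OF sum_frobenius_value_mult])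
        (use fB l cB in simp_all)
    also have "\<dots> = fact (card B) * int (card {i. i < k \<and> int r \<le> l i \<and> l i - int r \<notin> l ` {..<k}})"
      by (simp only: sum_alt_delta_lower_same[OF l(1) r])
    finally have "of_int (\<Sum>h | h permutes B. S r B h * S r B h) = (fact (card B) *
      of_nat (card {i. i < k \<and> int r \<le> l i \<and> l i - int r \<notin> l ` {..<k}}) :: complex)"
      by (simp only: of_int_mult of_int_fact of_int_of_nat_eq)
    then have "(\<Sum>h | h permutes B. F r * of_int (S r B h * S r B h)) = fact (card B) * q r"
      by (simp only: sum_distrib_left[symmetric] of_int_sum[symmetric] q_def mult_ac)
    moreover have "card A - r = card B" using cB by simp
    ultimately show "(\<Sum>h | h permutes B. F r * of_int (S r B h * S r B h)) = of_nat (fact (card A - r)) * q r"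
      by (simp only: of_nat_fact)
  qed
  finally show ?thesis by (simp only: of_nat_fact q_def)
qed

section \<open>Cycle types and the summation over classes\<close>

lemma mset_cycle_type: "mset (cycle_type d g) = image_mset card (mset_set (orbit g ` {..<d}))"
  by (simp add: cycle_type_def)

lemma cycle_type_facts:
  fixes d :: nat
  assumes "g permutes {..<d}"
  shows "permutation g" "g ` {..<d} \<subseteq> {..<d}" "a < d \<Longrightarrow> 0 < card (orbit g a)"
proof -
  show p: "permutation g" using assms by (rule permutes_imp_permutation[OF finite_lessThan])
  show "g ` {..<d} \<subseteq> {..<d}" using permutes_image[OF assms] by simp
  show "0 < card (orbit g a)"
    using permutation_self_in_orbit[OF p] finite_orbit by (fastforce simp: card_gt_0_iff)
qed

lemma part_power_sum_cycle_type:
  assumes g: "g permutes {..<d}"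
  shows "part_power_sum p (cycle_type d g) = (\<Sum>a<d. of_nat (card (orbit g a)) powi (p - 1))"
proof -
  note facts = cycle_type_facts[OF g]
  have "part_power_sum p (cycle_type d g) = \<Sum>\<^sub># (image_mset (\<lambda>x. of_nat x powi p) (mset (cycle_type d g)))"
    unfolding part_power_sum_def by (simp flip: sum_mset_sum_list)
  also have "\<dots> = (\<Sum>Z\<in>orbit g ` {..<d}. of_nat (card Z) powi p)"
    by (simp add: mset_cycle_type multiset.map_comp comp_def sum_unfold_sum_mset)
  also have "\<dots> = (\<Sum>Z\<in>orbit g ` {..<d}. of_nat (card Z) * of_nat (card Z) powi (p - 1))"
  proof (rule sum.cong[OF refl])
    fix Z assume "Z \<in> orbit g ` {..<d}"
    \<comment> \<open>Orbits are nonempty, so one factor can be split off for every integer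
      exponent, including \<open>p = 0\<close>.\<close>
    then have "card Z \<noteq> 0" using facts(3) by fastforce
    then show "(of_nat (card Z) :: complex) powi p = of_nat (card Z) * of_nat (card Z) powi (p - 1)"
      using power_int_minus_mult[of "of_nat (card Z) :: complex" p] by (simp add: mult.commute)
  qed
  also have "\<dots> = (\<Sum>a<d. of_nat (card (orbit g a)) powi (p - 1))"
    by (rule sum_over_orbits[OF facts(1) _ facts(2), symmetric]) simp
  finally show ?thesis .
qed

lemma cycle_type_partition:
  assumes g: "g permutes {..<d}"
  shows "cycle_type d g \<in> partitions_of d"
proof -
  note facts = cycle_type_facts[OF g]
  have "sorted_wrt (\<ge>) (cycle_type d g)"
    unfolding cycle_type_def sorted_wrt_rev by (simp add: sorted_sorted_list_of_multiset)
  moreover have "0 < x" if "x \<in> set (cycle_type d g)" for x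
  proof -
    have "x \<in># mset (cycle_type d g)" using that by simp
    then show ?thesis using facts(3) unfolding mset_cycle_type by auto
  qed
  moreover have "sum_list (cycle_type d g) = d"
  proof -
    have "sum_list (cycle_type d g) = \<Sum>\<^sub># (mset (cycle_type d g))" by (simp add: sum_mset_sum_list)
    also have "\<dots> = (\<Sum>Z\<in>orbit g ` {..<d}. of_nat (card Z) * 1)"
      by (simp add: mset_cycle_type sum_unfold_sum_mset)
    also have "\<dots> = (\<Sum>a<d. 1)"
      by (rule sum_over_orbits[OF facts(1) _ facts(2), symmetric, where F = "\<lambda>_. 1"]) simp
    finally show ?thesis by simp
  qed
  ultimately show ?thesis by (simp add: partitions_of_def)
qed

text \<open>\<open>chi\<close> is evaluated at a chosen representative. Frobenius values depend only
  on the cycle type, so any member of the class may take its place.\<close>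

lemma chi_cycle_type:
  assumes lam: "lam \<in> partitions_of d" and g: "g \<in> conj_class d mu"
  shows "chi lam mu = of_int (frobenius_value (length lam) {..<d} g (beta_number lam))"
proof -
  define h where "h = (SOME g. g \<in> conj_class d mu)"
  have h: "h \<in> conj_class d mu" unfolding h_def by (rule someI[of "\<lambda>g. g \<in> conj_class d mu", OF g])
  then have perm: "h permutes {..<d}" "g permutes {..<d}" and "cycle_type d h = cycle_type d g"
    using g by (auto simp: conj_class_def)
  then have "mset (cycle_type d h) = mset (cycle_type d g)" by simp
  then have "frobenius_value (length lam) {..<d} h l = frobenius_value (length lam) {..<d} g l" for l
    unfolding mset_cycle_type using cycle_type_facts[OF perm(1)] cycle_type_facts[OF perm(2)]
    by (intro frobenius_value_orbit_type) auto
  then show ?thesis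
    by (simp add: chi_def partitions_ofD(1)[OF lam] h_def[symmetric] irr_char_eq_frobenius_value[OF lam perm(1)])
qed

theorem corollary13p2:
  fixes d :: nat and p :: int and lam :: "nat list"
  assumes "d \<ge> 1" and "lam \<in> partitions_of d"
  shows "1 / fact d * (\<Sum>mu\<in>partitions_of d. part_power_sum p mu * of_nat (class_size d mu) * (chi lam mu)\<^sup>2) =
    hook_power_sum p lam"
proof -
  let ?k = "length lam" and ?b = "beta_number lam"
  let ?G = "{g. g permutes {..<d}}"
  let ?v = "\<lambda>g. of_int (frobenius_value ?k {..<d} g ?b) :: complex"
  interpret filling d ?k "(!) lam" "tableau_row lam" "tableau_col lam"
    by (rule filling_tableau[OF assms(2)])
  have beta: "beta = ?b" by (simp add: beta_def beta_number_def fun_eq_iff)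
  have "(\<Sum>mu\<in>partitions_of d. part_power_sum p mu * of_nat (class_size d mu) * (chi lam mu)\<^sup>2) =
    (\<Sum>mu\<in>partitions_of d. \<Sum>g | g \<in> ?G \<and> cycle_type d g = mu. part_power_sum p (cycle_type d g) * (?v g)\<^sup>2)"
  proof (rule sum.cong[OF refl])
    fix mu
    have "(\<Sum>g | g \<in> ?G \<and> cycle_type d g = mu. part_power_sum p (cycle_type d g) * (?v g)\<^sup>2) =
      (\<Sum>g\<in>conj_class d mu. part_power_sum p mu * (chi lam mu)\<^sup>2)"
      by (rule sum.cong) (auto simp: conj_class_def chi_cycle_type[OF assms(2)])
    then show "part_power_sum p mu * of_nat (class_size d mu) * (chi lam mu)\<^sup>2 =
      (\<Sum>g | g \<in> ?G \<and> cycle_type d g = mu. part_power_sum p (cycle_type d g) * (?v g)\<^sup>2)"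
      by (simp add: class_size_def)
  qed
  also have "\<dots> = (\<Sum>g\<in>?G. part_power_sum p (cycle_type d g) * (?v g)\<^sup>2)"
    using cycle_type_partition by (intro sum.group) (auto simp: finite_partitions_of finite_permutations)
  also have "\<dots> = (\<Sum>g\<in>?G. \<Sum>a<d. of_nat (card (orbit g a)) powi (p - 1) * (?v g)\<^sup>2)"
    by (intro sum.cong refl) (simp add: part_power_sum_cycle_type sum_distrib_right)
  also have "\<dots> = (\<Sum>a<d. \<Sum>g\<in>?G. of_nat (card (orbit g a)) powi (p - 1) * (?v g)\<^sup>2)"
    by (rule sum.swap)
  \<comment> \<open>The inner sum is the same for every point \<open>a\<close>; the \<open>d\<close>
    points turn (d - 1)! into d!.\<close>
  also have "\<dots> = (\<Sum>a<d. fact (d - 1) * hook_power_sum p lam)"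
  proof (rule sum.cong[OF refl])
    fix a assume "a \<in> {..<d}"
    then show "(\<Sum>g\<in>?G. of_nat (card (orbit g a)) powi (p - 1) * (?v g)\<^sup>2) = fact (d - 1) * hook_power_sum p lam"
      using sum_orbit_weighted_square[of "{..<d}" a ?b ?k "\<lambda>r. of_nat r powi (p - 1)"]
        inj_on_beta beta_nonneg sum_beta
      by (simp add: beta hook_power_sum_eq[OF assms(2)])
  qed
  also have "\<dots> = fact d * hook_power_sum p lam"
    using assms(1) by (simp add: fact_reduce[of d])
  finally show ?thesis by simp
qed

end
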